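(* Let $n$ be a positive integer, let $0<\mathrm{Re}(\nu)<1$, and let $k(t)$ satisfy: (1) its complex extension $k(z)$ is analytic in the interval $[0,a)$; (2) $k(0)\neq0$. Let $\rho_0$ be the distance from the origin of the singularity of $k(z)$ nearest to the origin. Let $\omega$ satisfy $|\omega|<\min(a,\rho_0)$, $-\pi<\mathrm{Arg}(\omega)\le\pi$ and $|\mathrm{Arg}(\omega)|\neq\pi/2$. Then $$\int_0^a\frac{k(t)\ln^n t}{t^{\nu}(\omega^2+t^2)}\,dt=\sum_{s=0}^{\infty}(-1)^s\omega^{2s}\;\mathrm{f.p.}\!\int_0^a\frac{k(t)\ln^n t}{t^{\nu+2s+2}}\,dt+\left[\frac{k(i\omega)+k(-i\omega)}{2}\right]\Delta_{n_1}(\nu,\omega)-i\left[\frac{k(i\omega)-k(-i\omega)}{2}\right]\Delta_{n_2}(\nu,\omega),$$ where $$\Delta_{n_1}(\nu,\omega)=\frac{\pi}{2\omega^{\nu+1}}\sum_{j=0}^{n}(-1)^j\binom{n}{j}(\mathrm{Log}\,\omega)^{n-j}\frac{d^j}{d\nu^j}\sec\left(\frac{\pi\nu}{2}\right),$$ $$\Delta_{n_2}(\nu,\omega)=\frac{\pi}{2\omega^{\nu+1}}\sum_{j=0}^{n}(-1)^j\binom{n}{j}(\mathrm{Log}\,\omega)^{n-j}\frac{d^j}{d\nu^j}\csc\left(\frac{\pi\nu}{2}\right),$$ and, with $\gamma=\frac{1-(-1)^j}{2}$, $$\frac{d^j}{d\nu^j}\sec\left(\frac{\pi\nu}{2}\right)=(-1)^{[(j+1)/2]}\left(\frac{\pi}{2}\right)^j\sec\left(\frac{\pi\nu}{2}\right)\sum_{l=0}^{j}\frac{1}{2^l}\sum_{m=0}^{[(l-\gamma)/2]}(-1)^m\binom{l}{2m+\gamma}\tan^{2m+\gamma}\left(\frac{\pi\nu}{2}\right)\sum_{p=0}^{l}(-1)^p\binom{l}{p}(2p+1)^j,$$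 $$\frac{d^j}{d\nu^j}\csc\left(\frac{\pi\nu}{2}\right)=(-1)^{[j/2]}\left(\frac{\pi}{2}\right)^j\csc\left(\frac{\pi\nu}{2}\right)\sum_{l=0}^{j}\frac{1}{2^l}\sum_{m=0}^{l}(-1)^m\binom{l}{m}(2m+1)^j\sum_{p=0}^{[(l-\gamma)/2]}(-1)^p\binom{l}{2p+\gamma}\cot^{2p+\gamma}\left(\frac{\pi\nu}{2}\right).$$ The identity still holds for $a=\infty$, if the Stieltjes integral exists as $a\to\infty$, for all $|\omega|<\infty$ when $k(z)$ is entire, or for all $|\omega|<\rho_0$ when $k(z)$ has at least one singularity. Lastly, $$\int_0^a\frac{k(t)\ln^n t}{t^{\nu}(\omega^2+t^2)}\,dt\;\sim\;k(0)\,\Delta_{n_1}(\nu,\omega),\qquad \omega\to0.$$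
   Context: Here $0<a\le\infty$, with $a<\infty$ in the first assertion and $a=\infty$ treated separately. Analytic in $[0,a)$ means that $k(z)$ is analytic in an open neighbourhood of $[0,a)$ in $\mathbb{C}$; $\rho_0=\infty$ if $k$ is entire. $\mathrm{Log}\,\omega=\ln|\omega|+i\,\mathrm{Arg}\,\omega$ with $-\pi<\mathrm{Arg}\,\omega\le\pi$ is the principal logarithm, and $\omega^{-\nu}$ takes its principal value $e^{-\nu\,\mathrm{Log}\,\omega}$. $[x]$ denotes the integer part (floor) of $x$; empty sums are $0$. Finite-part integral (written f.p. here; the paper uses a double-slashed integral sign): for $0<\epsilon<a$ write $\int_\epsilon^a k(t)t^{-\lambda}\ln^n t\,dt=C_\epsilon+D_\epsilon$, where $C_\epsilon$ converges and $D_\epsilon$ collects the diverging terms as $\epsilon\to0^+$, i.e. $D_\epsilon$ is a finite linear combination of functions $\epsilon^{-\mu}\ln^m\epsilon$ with $\mathrm{Re}\,\mu\ge0$, $m\in\mathbb{N}_0$, $(\mu,m)\ne(0,0)$. Then $\mathrm{f.p.}\int_0^a k(t)t^{-\lambda}\ln^n t\,dt:=\lim_{\epsilon\to0^+}C_\epsilon$.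
   Formalization: For |Arg ω|>π/2 the terms k(±iω), Δ_{n1}, Δ_{n2}, also in the asymptotic relation, are evaluated at −ω, since the printed formula fails there; ω≠0 is assumed, and existence of the Stieltjes integral is assumed for finite a as well. *)

theory Defs
  imports "HOL-Analysis.Analysis" "HOL-Complex_Analysis.Complex_Analysis"
    "HOL-Library.Landau_Symbols"
begin

(* Integrals are Henstock-Kurzweil integrals over the open interval einterval 0 a
   (a :: ereal, possibly infinite); these include conditionally convergent improper integrals.
   Complex powers powr, Ln and Arg are the principal ones, Arg ranging over (-pi, pi]. *)

text \<open>Diverging part \<open>D\<close> of a finite-part integral: a finite linear combination of
  \<open>\<epsilon>\<^sup>-\<^sup>\<mu> ln\<^sup>m \<epsilon>\<close> with \<open>Re \<mu> \<ge> 0\<close> and \<open>(\<mu>, m) \<noteq> (0, 0)\<close>.\<close>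

definition diverging_part :: "(real \<Rightarrow> complex) \<Rightarrow> bool" where
  "diverging_part D \<longleftrightarrow>
     (\<exists>(P :: (complex \<times> nat) set) (c :: complex \<times> nat \<Rightarrow> complex).
        finite P \<and> (\<forall>(\<mu>, m) \<in> P. 0 \<le> Re \<mu> \<and> (\<mu>, m) \<noteq> (0, 0)) \<and>
        (\<forall>\<epsilon>>0. D \<epsilon> = (\<Sum>(\<mu>, m)\<in>P. c (\<mu>, m) * of_real \<epsilon> powr (-\<mu>) * of_real (ln \<epsilon> ^ m))))"

definition has_finite_part :: "(real \<Rightarrow> complex) \<Rightarrow> ereal \<Rightarrow> complex \<Rightarrow> bool" where
  "has_finite_part g a I \<longleftrightarrow>
     (\<forall>\<epsilon>>0. ereal \<epsilon> < a \<longrightarrow> g integrable_on einterval (ereal \<epsilon>) a) \<and>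
     (\<exists>C D. diverging_part D \<and>
        (\<forall>\<epsilon>>0. ereal \<epsilon> < a \<longrightarrow> integral (einterval (ereal \<epsilon>) a) g = C \<epsilon> + D \<epsilon>) \<and>
        (C \<longlongrightarrow> I) (at_right 0))"

definition finite_part :: "(real \<Rightarrow> complex) \<Rightarrow> ereal \<Rightarrow> complex" where
  "finite_part g a = (THE I. has_finite_part g a I)"

text \<open>The integrand \<open>k(t) ln\<^sup>n t / t\<^sup>\<alpha>\<close>.\<close>

definition log_power_integrand ::
  "(complex \<Rightarrow> complex) \<Rightarrow> nat \<Rightarrow> complex \<Rightarrow> real \<Rightarrow> complex" where
  "log_power_integrand k n \<alpha> t = k (of_real t) * of_real (ln t ^ n) / of_real t powr \<alpha>"

definition stieltjes_integrand ::
  "(complex \<Rightarrow> complex) \<Rightarrow> nat \<Rightarrow> complex \<Rightarrow> complex \<Rightarrow> real \<Rightarrow> complex" where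
  "stieltjes_integrand k n \<nu> \<omega> t =
     k (of_real t) * of_real (ln t ^ n) / (of_real t powr \<nu> * (\<omega>\<^sup>2 + (of_real t)\<^sup>2))"

text \<open>Distance from the origin to the nearest singularity, i.e. to the nearest point at which
  \<open>k\<close> is not analytic. It is \<open>\<infinity>\<close> iff \<open>k\<close> is entire.\<close>

definition singularity_radius :: "(complex \<Rightarrow> complex) \<Rightarrow> ereal" where
  "singularity_radius k = (INF z\<in>{z. \<not> k analytic_on {z}}. ereal (norm z))"

text \<open>For \<open>a = \<infinity>\<close> the bound is just \<open>singularity_radius k\<close>.\<close>

definition admissible :: "(complex \<Rightarrow> complex) \<Rightarrow> ereal \<Rightarrow> complex set" where
  "admissible k a =
     {\<omega>. \<omega> \<noteq> 0 \<and> ereal (norm \<omega>) < min a (singularity_radius k) \<and> \<bar>Arg \<omega>\<bar> \<noteq> pi / 2}"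

text \<open>The Stieltjes integral is even in \<open>\<omega>\<close>, whereas the terms \<open>\<Delta>\<^sub>n\<^sub>1\<close>, \<open>\<Delta>\<^sub>n\<^sub>2\<close> below, built from
  principal values, are neither even nor odd. They give the integral when they are evaluated at
  the square root of \<open>\<omega>\<^sup>2\<close> with positive real part, which is \<open>\<omega>\<close> itself if
  \<open>\<bar>Arg \<omega>\<bar> < \<pi>/2\<close>; at a point of the left half-plane the principal values taken at \<open>\<omega>\<close>
  itself give a different number.\<close>

definition right_root :: "complex \<Rightarrow> complex" where
  "right_root \<omega> = (if \<bar>Arg \<omega>\<bar> < pi / 2 then \<omega> else - \<omega>)"

definition half_sec :: "complex \<Rightarrow> complex" where
  "half_sec \<nu> = 1 / cos (of_real pi * \<nu> / 2)"

definition half_csc :: "complex \<Rightarrow> complex" where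
  "half_csc \<nu> = 1 / sin (of_real pi * \<nu> / 2)"

definition Delta1 :: "nat \<Rightarrow> complex \<Rightarrow> complex \<Rightarrow> complex" where
  "Delta1 n \<nu> \<omega> = of_real pi / (2 * \<omega> powr (\<nu> + 1)) *
     (\<Sum>j=0..n. (-1) ^ j * of_nat (n choose j) * Ln \<omega> ^ (n - j) * (deriv ^^ j) half_sec \<nu>)"

definition Delta2 :: "nat \<Rightarrow> complex \<Rightarrow> complex \<Rightarrow> complex" where
  "Delta2 n \<nu> \<omega> = of_real pi / (2 * \<omega> powr (\<nu> + 1)) *
     (\<Sum>j=0..n. (-1) ^ j * of_nat (n choose j) * Ln \<omega> ^ (n - j) * (deriv ^^ j) half_csc \<nu>)"

text \<open>Closed forms of the derivatives. Here \<open>j mod 2\<close> is \<open>\<gamma> = (1 - (-1)\<^sup>j) / 2\<close>, and the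
  index set \<open>upto_half l \<gamma>\<close> is \<open>0, \<dots>, \<lfloor>(l - \<gamma>) / 2\<rfloor>\<close>, computed in the integers so that
  it is empty for \<open>l = 0\<close>, \<open>\<gamma> = 1\<close>.\<close>

definition upto_half :: "nat \<Rightarrow> nat \<Rightarrow> nat set" where
  "upto_half l \<gamma> = {m. int m \<le> (int l - int \<gamma>) div 2}"

definition sec_deriv_formula :: "nat \<Rightarrow> complex \<Rightarrow> complex" where
  "sec_deriv_formula j \<nu> = (let \<gamma> = j mod 2 in
     (-1) ^ ((j + 1) div 2) * (of_real pi / 2) ^ j * half_sec \<nu> *
     (\<Sum>l=0..j. 1 / 2 ^ l *
        (\<Sum>m\<in>upto_half l \<gamma>. (-1) ^ m * of_nat (l choose (2 * m + \<gamma>)) *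
            tan (of_real pi * \<nu> / 2) ^ (2 * m + \<gamma>)) *
        (\<Sum>p=0..l. (-1) ^ p * of_nat (l choose p) * of_nat (2 * p + 1) ^ j)))"

definition csc_deriv_formula :: "nat \<Rightarrow> complex \<Rightarrow> complex" where
  "csc_deriv_formula j \<nu> = (let \<gamma> = j mod 2 in
     (-1) ^ (j div 2) * (of_real pi / 2) ^ j * half_csc \<nu> *
     (\<Sum>l=0..j. 1 / 2 ^ l *
        (\<Sum>m=0..l. (-1) ^ m * of_nat (l choose m) * of_nat (2 * m + 1) ^ j) *
        (\<Sum>p\<in>upto_half l \<gamma>. (-1) ^ p * of_nat (l choose (2 * p + \<gamma>)) *
            cot (of_real pi * \<nu> / 2) ^ (2 * p + \<gamma>))))"

end

theory Submission
  imports Defs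
begin

text \<open>
  Choose \<open>r\<close> with \<open>\<bar>\<omega>\<bar> < r < min(a, \<rho>\<^sub>0)\<close> and split the integral at \<open>r\<close>. On \<open>(r, a)\<close> the finite geometric
  expansion of \<open>1 / (\<omega>\<^sup>2 + t\<^sup>2)\<close> leaves a remainder that tends to zero after an integration by parts,
  even if the integral converges only conditionally. On \<open>(0, r)\<close> one expands \<open>k\<close> into its Taylor series.
  For the monomial \<open>t\<^sup>m\<close> let \<open>d\<^sub>m\<close> be the difference between the integral over \<open>(0, r)\<close> and the series
  of finite parts. Both satisfy the same inhomogeneous recursion \<open>x\<^sub>m\<^sub>+\<^sub>2 + \<omega>\<^sup>2 x\<^sub>m = b\<^sub>m\<close>, whence
  \<open>d\<^sub>m\<^sub>+\<^sub>2 = - \<omega>\<^sup>2 d\<^sub>m\<close>. The values \<open>d\<^sub>0\<close> and \<open>d\<^sub>1\<close> are integrals over \<open>(0, \<infinity>)\<close> of a power of \<open>t\<close> times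
  a power of the logarithm divided by \<open>\<omega>\<^sup>2 + t\<^sup>2\<close>; the residue theorem evaluates them without the logarithm
  and Taylor expansion in \<open>\<nu>\<close> introduces it. This gives \<open>d\<^sub>0 = \<Delta>\<^sub>n\<^sub>1\<close> and \<open>d\<^sub>1 = \<omega> \<Delta>\<^sub>n\<^sub>2\<close>, and summing \<open>d\<^sub>m\<close>
  against the Taylor coefficients produces the values of \<open>k\<close> at \<open>\<plusminus> \<i> \<omega>\<close>.
\<close>

section \<open>Derivatives of secant and cosecant\<close>

definition sec_coeff :: "nat \<Rightarrow> nat \<Rightarrow> complex" where
  "sec_coeff l j = (\<Sum>p=0..l. (-1) ^ p * of_nat (l choose p) * of_nat (2 * p + 1) ^ j)"

lemma sec_coeff_Suc:
  "sec_coeff l (Suc j) = of_nat (2 * l + 1) * sec_coeff l j - of_nat (2 * l) * sec_coeff (l - 1) j"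
proof -
  have absorb: "of_nat (l - p) * of_nat (l choose p) = (of_nat l * of_nat ((l - 1) choose p) :: complex)" for p
    by (metis binomial_absorb_comp of_nat_mult)
  have "of_nat (2 * l) * sec_coeff (l - 1) j = of_nat l * (2 * sec_coeff (l - 1) j)"
    by simp
  also have "\<dots> = (\<Sum>p=0..l. (-1) ^ p * (2 * (of_nat l * of_nat ((l - 1) choose p))) * of_nat (2 * p + 1) ^ j)"
  proof (cases l)
    case (Suc l')
    moreover have "l' choose Suc l' = 0" by (simp add: binomial_eq_0)
    ultimately show ?thesis
      by (simp add: sec_coeff_def sum_distrib_left mult_ac del: of_nat_Suc)
  qed simp
  also have "\<dots> = (\<Sum>p=0..l. (-1) ^ p * (2 * (of_nat (l - p) * of_nat (l choose p))) * of_nat (2 * p + 1) ^ j)"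
    by (simp only: absorb)
  finally have "of_nat (2 * l + 1) * sec_coeff l j - of_nat (2 * l) * sec_coeff (l - 1) j
      = (\<Sum>p=0..l. of_nat (2 * l + 1) * ((-1) ^ p * of_nat (l choose p) * of_nat (2 * p + 1) ^ j)
           - (-1) ^ p * (2 * (of_nat (l - p) * of_nat (l choose p))) * of_nat (2 * p + 1) ^ j)"
    by (simp add: sec_coeff_def sum_distrib_left sum_subtractf)
  also have "\<dots> = sec_coeff l (Suc j)"
    unfolding sec_coeff_def
  proof (rule sum.cong)
    fix p assume "p \<in> {0..l}"
    then have l: "of_nat (2 * l + 1) = (of_nat (2 * p + 1) + 2 * of_nat (l - p) :: complex)"
      by (simp add: of_nat_diff)
    have "(u + 2 * d) * (s * c * X) - s * (2 * (d * c)) * X = s * c * (u * X)" for u d s c X :: complex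
      by algebra
    then show "of_nat (2 * l + 1) * ((-1) ^ p * of_nat (l choose p) * of_nat (2 * p + 1) ^ j)
           - (-1) ^ p * (2 * (of_nat (l - p) * of_nat (l choose p))) * of_nat (2 * p + 1) ^ j
         = (-1) ^ p * of_nat (l choose p) * (of_nat (2 * p + 1) ^ Suc j :: complex)"
      unfolding l power_Suc .
  qed simp
  finally show ?thesis ..
qed

lemma sec_coeff_eq_0: "j < l \<Longrightarrow> sec_coeff l j = 0"
proof (induction j arbitrary: l)
  case 0
  have "(\<Sum>p\<le>l. (-1) ^ p * of_nat (l choose p) :: complex) = 0"
    using 0 by (intro choose_alternating_sum) auto
  then show ?case
    by (simp add: sec_coeff_def atMost_atLeast0)
next
  case (Suc j)
  then show ?case
    by (simp add: sec_coeff_Suc)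
qed

lemma higher_deriv_half_sec:
  assumes \<sigma>: "\<sigma>\<^sup>2 = -1" and "cos (of_real pi * \<nu> / 2) \<noteq> 0"
  shows "(deriv ^^ j) half_sec \<nu> = (\<sigma> * of_real pi / 2) ^ j * half_sec \<nu> *
           (\<Sum>l\<le>j. ((1 + \<sigma> * tan (of_real pi * \<nu> / 2)) / 2) ^ l * sec_coeff l j)"
  using assms(2)
proof (induction j arbitrary: \<nu>)
  case 0
  then show ?case by (simp add: sec_coeff_def)
next
  case (Suc j)
  define Z where "Z = (\<lambda>\<nu>. (1 + \<sigma> * tan (of_real pi * \<nu> / 2)) / 2)"
  let ?q = "\<sigma> * of_real pi / 2"
  have q: "?q \<noteq> 0" "\<sigma> \<noteq> 0" "\<sigma> * \<sigma> = -1" using \<sigma> by (auto simp: power2_eq_square)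
  let ?U = "{\<nu>::complex. cos (of_real pi * \<nu> / 2) \<noteq> 0}"
  have "open ?U"
    by (intro open_Collect_neq continuous_intros) auto
  then have ev: "\<forall>\<^sub>F \<nu> in nhds \<nu>. \<nu> \<in> ?U"
    using Suc.prems by (intro eventually_nhds_in_open) auto
  have sec2: "1 / (cos (of_real pi * \<nu> / 2))\<^sup>2 = 4 * Z \<nu> - 4 * (Z \<nu>)\<^sup>2"
    and tanZ: "tan (of_real pi * \<nu> / 2) = - \<sigma> * (2 * Z \<nu> - 1)"
  proof -
    have "1 / (cos (of_real pi * \<nu> / 2))\<^sup>2 = 1 + (tan (of_real pi * \<nu> / 2))\<^sup>2"
      using Suc.prems sin_cos_squared_add[of "of_real pi * \<nu> / 2"]
      by (simp add: tan_def field_simps)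
    then show "1 / (cos (of_real pi * \<nu> / 2))\<^sup>2 = 4 * Z \<nu> - 4 * (Z \<nu>)\<^sup>2"
      using q unfolding Z_def by (simp add: power2_eq_square field_simps) algebra
    show "tan (of_real pi * \<nu> / 2) = - \<sigma> * (2 * Z \<nu> - 1)"
    proof -
      have "2 * Z \<nu> - 1 = \<sigma> * tan (of_real pi * \<nu> / 2)" by (simp add: Z_def add_divide_distrib)
      then have "- \<sigma> * (2 * Z \<nu> - 1) = - ((\<sigma> * \<sigma>) * tan (of_real pi * \<nu> / 2))"
        by (simp only: mult.assoc mult_minus_left)
      then show ?thesis unfolding q(3) by simp
    qed
  qed
  have dZ: "(Z has_field_derivative \<sigma> * of_real pi * (Z \<nu> - (Z \<nu>)\<^sup>2)) (at \<nu>)"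
  proof -
    have "(Z has_field_derivative \<sigma> * (inverse ((cos (of_real pi * \<nu> / 2))\<^sup>2) * (of_real pi / 2)) / 2) (at \<nu>)"
      unfolding Z_def using Suc.prems by (auto intro!: derivative_eq_intros)
    moreover have inv: "inverse ((cos (of_real pi * \<nu> / 2))\<^sup>2) = 4 * (Z \<nu> - (Z \<nu>)\<^sup>2)"
      using sec2 by (simp add: inverse_eq_divide)
    have "\<sigma> * (inverse ((cos (of_real pi * \<nu> / 2))\<^sup>2) * (of_real pi / 2)) / 2
        = \<sigma> * of_real pi * (Z \<nu> - (Z \<nu>)\<^sup>2)"
      unfolding inv by (simp add: field_simps)
    ultimately show ?thesis by (simp only:)
  qed
  have dsec: "(half_sec has_field_derivative ?q * (1 - 2 * Z \<nu>) * half_sec \<nu>) (at \<nu>)"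
  proof -
    have "(half_sec has_field_derivative of_real pi / 2 * half_sec \<nu> * tan (of_real pi * \<nu> / 2)) (at \<nu>)"
      unfolding half_sec_def using Suc.prems
      by (auto intro!: derivative_eq_intros simp: field_simps tan_def power2_eq_square)
    moreover have "of_real pi / 2 * half_sec \<nu> * tan (of_real pi * \<nu> / 2) = ?q * (1 - 2 * Z \<nu>) * half_sec \<nu>"
      unfolding tanZ by (simp add: field_simps)
    ultimately show ?thesis by (simp only:)
  qed
  let ?S = "\<lambda>\<nu>. \<Sum>l\<le>j. Z \<nu> ^ l * sec_coeff l j"
  let ?S' = "\<Sum>l\<le>j. of_nat l * Z \<nu> ^ (l - 1) * (\<sigma> * of_real pi * (Z \<nu> - (Z \<nu>)\<^sup>2)) * sec_coeff l j"
  have "deriv ((deriv ^^ j) half_sec) \<nu> = deriv (\<lambda>\<nu>. ?q ^ j * half_sec \<nu> * ?S \<nu>) \<nu>"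
    by (intro deriv_cong_ev refl eventually_mono[OF ev]) (simp add: Suc.IH Z_def)
  also have "\<dots> = ?q ^ j * (?q * (1 - 2 * Z \<nu>) * half_sec \<nu> * ?S \<nu> + half_sec \<nu> * ?S')"
    by (intro DERIV_imp_deriv) (auto intro!: derivative_eq_intros dZ dsec simp: algebra_simps)
  also have "\<dots> = ?q ^ Suc j * half_sec \<nu> * ((1 - 2 * Z \<nu>) * ?S \<nu> + ?S' / ?q)"
    using q by (simp add: field_simps)
  also have "(1 - 2 * Z \<nu>) * ?S \<nu> + ?S' / ?q
     = (\<Sum>l\<le>j. (of_nat (2 * l + 1) * Z \<nu> ^ l - of_nat (2 * Suc l) * Z \<nu> ^ Suc l) * sec_coeff l j)"
    unfolding sum_distrib_left sum_divide_distrib sum.distrib[symmetric]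
  proof (rule sum.cong[OF refl])
    fix l
    have "of_nat l * Z \<nu> ^ (l - 1) * (Z \<nu> - (Z \<nu>)\<^sup>2) = of_nat l * (Z \<nu> ^ l - Z \<nu> ^ Suc l)"
      by (cases l) (auto simp: algebra_simps power2_eq_square)
    moreover have "x * (\<sigma> * of_real pi * D) * c / ?q = 2 * (x * D) * c" for x D c :: complex
      using q by (simp add: field_simps)
    ultimately have "of_nat l * Z \<nu> ^ (l - 1) * (\<sigma> * of_real pi * (Z \<nu> - (Z \<nu>)\<^sup>2)) * sec_coeff l j / ?q
        = 2 * (of_nat l * (Z \<nu> ^ l - Z \<nu> ^ Suc l)) * sec_coeff l j"
      by (simp only:)
    then show "(1 - 2 * Z \<nu>) * (Z \<nu> ^ l * sec_coeff l j) +
         of_nat l * Z \<nu> ^ (l - 1) * (\<sigma> * of_real pi * (Z \<nu> - (Z \<nu>)\<^sup>2)) * sec_coeff l j / ?q =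
         (of_nat (2 * l + 1) * Z \<nu> ^ l - of_nat (2 * Suc l) * Z \<nu> ^ Suc l) * sec_coeff l j"
      by (simp add: algebra_simps)
  qed
  also have "\<dots> = (\<Sum>l\<le>Suc j. Z \<nu> ^ l * (of_nat (2 * l + 1) * sec_coeff l j))
                 - (\<Sum>l\<le>Suc j. Z \<nu> ^ l * (of_nat (2 * l) * sec_coeff (l - 1) j))"
    unfolding sum.atMost_Suc_shift[of "\<lambda>l. Z \<nu> ^ l * (of_nat (2 * l) * sec_coeff (l - 1) j)"]
    by (simp add: sec_coeff_eq_0 sum_subtractf algebra_simps)
  also have "\<dots> = (\<Sum>l\<le>Suc j. Z \<nu> ^ l * sec_coeff l (Suc j))"
    unfolding sec_coeff_Suc by (simp only: right_diff_distrib sum_subtractf)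
  finally show ?case by (simp add: Z_def add_divide_distrib)
qed

lemma binomial_parity_part:
  fixes \<sigma> t :: complex
  assumes \<sigma>: "\<sigma>\<^sup>2 = -1" and "\<gamma> < 2"
  shows "((1 + \<sigma> * t) ^ l + (-1) ^ \<gamma> * (1 - \<sigma> * t) ^ l) / 2
     = \<sigma> ^ \<gamma> * (\<Sum>m\<in>upto_half l \<gamma>. (-1) ^ m * of_nat (l choose (2 * m + \<gamma>)) * t ^ (2 * m + \<gamma>))"
proof -
  have up: "upto_half l \<gamma> = {m. 2 * m + \<gamma> \<le> l}"
    unfolding upto_half_def by auto
  let ?g = "\<lambda>k. of_nat (l choose k) * (\<sigma> * t) ^ k * ((1 + (-1) ^ (\<gamma> + k)) / 2)"
  have "(1 + \<sigma> * t) ^ l = (\<Sum>k\<le>l. of_nat (l choose k) * (\<sigma> * t) ^ k)"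
    and "(1 - \<sigma> * t) ^ l = (\<Sum>k\<le>l. of_nat (l choose k) * ((-1) ^ k * (\<sigma> * t) ^ k))"
    using binomial_ring[of "\<sigma> * t" 1 l] binomial_ring[of "- (\<sigma> * t)" 1 l]
    by (simp_all add: add.commute flip: power_mult_distrib)
  then have "((1 + \<sigma> * t) ^ l + (-1) ^ \<gamma> * (1 - \<sigma> * t) ^ l) / 2 = (\<Sum>k\<le>l. ?g k)"
    by (simp add: sum_distrib_left sum_divide_distrib algebra_simps power_add add_divide_distrib sum.distrib)
  also have "\<dots> = (\<Sum>k\<in>(\<lambda>m. 2 * m + \<gamma>) ` upto_half l \<gamma>. ?g k)"
  proof (rule sum.mono_neutral_right)
    show "\<forall>k\<in>{..l} - (\<lambda>m. 2 * m + \<gamma>) ` upto_half l \<gamma>. ?g k = 0"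
    proof
      fix k assume k: "k \<in> {..l} - (\<lambda>m. 2 * m + \<gamma>) ` upto_half l \<gamma>"
      have "odd (\<gamma> + k)"
      proof
        assume "even (\<gamma> + k)"
        then have "2 * (k div 2) + \<gamma> = k" using \<open>\<gamma> < 2\<close> by presburger
        then have "k \<in> (\<lambda>m. 2 * m + \<gamma>) ` upto_half l \<gamma>"
          using k by (intro image_eqI[of _ _ "k div 2"]) (auto simp: up)
        then show False using k by blast
      qed
      then show "?g k = 0" by simp
    qed
  qed (auto simp: up)
  also have "\<dots> = (\<Sum>m\<in>upto_half l \<gamma>. ?g (2 * m + \<gamma>))"
    by (rule sum.reindex_cong[of "\<lambda>m. 2 * m + \<gamma>"]) (auto simp: inj_on_def)
  also have "\<dots> = \<sigma> ^ \<gamma> * (\<Sum>m\<in>upto_half l \<gamma>. (-1) ^ m * of_nat (l choose (2 * m + \<gamma>)) * t ^ (2 * m + \<gamma>))"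
    unfolding sum_distrib_left
  proof (rule sum.cong[OF refl])
    fix m
    have "\<sigma> ^ (2 * m) = (-1) ^ m" unfolding power_mult \<sigma> ..
    moreover have "(-1) ^ (\<gamma> + (2 * m + \<gamma>)) = (1::complex)" by simp
    ultimately show "?g (2 * m + \<gamma>) = \<sigma> ^ \<gamma> * ((-1) ^ m * of_nat (l choose (2 * m + \<gamma>)) * t ^ (2 * m + \<gamma>))"
      by (simp add: power_add power_mult_distrib)
  qed
  finally show ?thesis .
qed

text \<open>The derivative is the average of its expansions in powers of \<open>1 + \<i> tan\<close> and of
  \<open>1 - \<i> tan\<close>, so that only the powers of the tangent with one parity survive.\<close>

lemma higher_deriv_half_sec_eq_formula:
  assumes "cos (of_real pi * \<nu> / 2) \<noteq> 0"
  shows "(deriv ^^ j) half_sec \<nu> = sec_deriv_formula j \<nu>"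
proof -
  define \<gamma> where "\<gamma> = j mod 2"
  define t where "t = tan (of_real pi * \<nu> / 2)"
  let ?D = "(deriv ^^ j) half_sec \<nu>"
  let ?c = "(\<i> * of_real pi / 2) ^ j * half_sec \<nu>"
  have neg: "(- \<i> * of_real pi / 2) ^ j = (-1) ^ \<gamma> * (\<i> * of_real pi / 2) ^ j"
  proof -
    have "(- \<i> * of_real pi / 2) ^ j = ((-1) * (\<i> * of_real pi / 2)) ^ j" by simp
    also have "\<dots> = (-1) ^ j * (\<i> * of_real pi / 2) ^ j" by (rule power_mult_distrib)
    also have "(-1) ^ j = ((-1) ^ \<gamma> :: complex)"
      unfolding \<gamma>_def by (cases "even j") (simp_all flip: even_iff_mod_2_eq_zero odd_iff_mod_2_eq_one)
    finally show ?thesis .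
  qed
  have "?D = (?D + ?D) / 2" by simp
  also have "\<dots> = ((\<i> * of_real pi / 2) ^ j * half_sec \<nu> * (\<Sum>l\<le>j. ((1 + \<i> * t) / 2) ^ l * sec_coeff l j)
        + (- \<i> * of_real pi / 2) ^ j * half_sec \<nu> * (\<Sum>l\<le>j. ((1 + - \<i> * t) / 2) ^ l * sec_coeff l j)) / 2"
    using higher_deriv_half_sec[of \<i>, OF _ assms] higher_deriv_half_sec[of "-\<i>", OF _ assms]
    by (simp add: t_def)
  also have "\<dots> = ?c * (\<Sum>l\<le>j. ((1 + \<i> * t) ^ l + (-1) ^ \<gamma> * (1 - \<i> * t) ^ l) / 2 * (1 / 2 ^ l) * sec_coeff l j)"
    unfolding neg unfolding power_divide
    by (simp add: sum_distrib_left sum_divide_distrib add_divide_distrib distrib_left distrib_right mult_ac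
             flip: sum.distrib)
  also have "\<dots> = ?c * (\<Sum>l\<le>j. \<i> ^ \<gamma> * (1 / 2 ^ l * (\<Sum>m\<in>upto_half l \<gamma>. (-1) ^ m * of_nat (l choose (2 * m + \<gamma>)) * t ^ (2 * m + \<gamma>)) * sec_coeff l j))"
    by (subst binomial_parity_part) (auto simp: \<gamma>_def algebra_simps)
  also have "\<dots> = (\<i> ^ \<gamma> * \<i> ^ j) * (of_real pi / 2) ^ j * half_sec \<nu> *
     (\<Sum>l\<le>j. 1 / 2 ^ l * (\<Sum>m\<in>upto_half l \<gamma>. (-1) ^ m * of_nat (l choose (2 * m + \<gamma>)) * t ^ (2 * m + \<gamma>)) * sec_coeff l j)"
    unfolding sum_distrib_left[symmetric] by (simp add: power_mult_distrib power_divide)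
  also have "\<i> ^ \<gamma> * \<i> ^ j = (-1) ^ ((j + 1) div 2)"
  proof -
    have "\<gamma> + j = 2 * ((j + 1) div 2)" unfolding \<gamma>_def by presburger
    then have "\<i> ^ (\<gamma> + j) = (-1) ^ ((j + 1) div 2)" by (simp add: power_mult)
    then show ?thesis by (simp add: power_add)
  qed
  finally show ?thesis
    unfolding sec_deriv_formula_def Let_def \<gamma>_def t_def sec_coeff_def atMost_atLeast0 .
qed

lemma half_csc_eq_half_sec: "half_csc \<nu> = half_sec (\<nu> - 1)"
proof -
  have "of_real pi * (\<nu> - 1) / 2 = of_real pi * \<nu> / 2 - of_real pi / 2"
    by (simp add: algebra_simps diff_divide_distrib)
  then show ?thesis
    unfolding half_csc_def half_sec_def by (simp only: cos_diff cos_of_real_pi_half sin_of_real_pi_half) simp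
qed

lemma tan_half_shift: "tan (of_real pi * (\<nu> - 1) / 2) = - cot (of_real pi * \<nu> / 2 :: complex)"
proof -
  have "of_real pi * (\<nu> - 1) / 2 = of_real pi * \<nu> / 2 - of_real pi / 2"
    by (simp add: algebra_simps diff_divide_distrib)
  then show ?thesis
    unfolding tan_def cot_def by (simp only: cos_diff sin_diff cos_of_real_pi_half sin_of_real_pi_half) simp
qed

lemma higher_deriv_half_csc:
  assumes "sin (of_real pi * \<nu> / 2) \<noteq> 0"
  shows "(deriv ^^ j) half_csc \<nu> = (deriv ^^ j) half_sec (\<nu> - 1)"
  using assms
proof (induction j arbitrary: \<nu>)
  case 0
  then show ?case by (simp add: half_csc_eq_half_sec)
next
  case (Suc j)
  let ?U = "{\<nu>::complex. sin (of_real pi * \<nu> / 2) \<noteq> 0}"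
  have "open ?U"
    by (intro open_Collect_neq continuous_intros) auto
  then have ev: "\<forall>\<^sub>F \<nu> in nhds \<nu>. \<nu> \<in> ?U"
    using Suc.prems by (intro eventually_nhds_in_open) auto
  have "deriv ((deriv ^^ j) half_csc) \<nu> = deriv (\<lambda>\<nu>. (deriv ^^ j) half_sec (\<nu> - 1)) \<nu>"
    by (intro deriv_cong_ev refl eventually_mono[OF ev]) (simp add: Suc.IH)
  also have "\<dots> = deriv ((deriv ^^ j) half_sec) (\<nu> - 1)"
  proof -
    have "deriv (\<lambda>\<nu>. g (\<nu> - 1)) \<nu> = deriv g (\<nu> - 1)" for g :: "complex \<Rightarrow> complex"
      unfolding deriv_def using DERIV_shift[of g _ \<nu> "-1"] by simp
    then show ?thesis .
  qed
  finally show ?case by simp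
qed

lemma higher_deriv_half_csc_eq_formula:
  assumes "sin (of_real pi * \<nu> / 2) \<noteq> 0"
  shows "(deriv ^^ j) half_csc \<nu> = csc_deriv_formula j \<nu>"
proof -
  define \<gamma> where "\<gamma> = j mod 2"
  define c where "c = cot (of_real pi * \<nu> / 2)"
  have "half_csc \<nu> \<noteq> 0" using assms by (simp add: half_csc_def)
  then have "cos (of_real pi * (\<nu> - 1) / 2) \<noteq> 0"
    unfolding half_csc_eq_half_sec half_sec_def by auto
  then have "(deriv ^^ j) half_csc \<nu> = sec_deriv_formula j (\<nu> - 1)"
    using higher_deriv_half_csc[OF assms] higher_deriv_half_sec_eq_formula by simp
  also have "\<dots> = (-1) ^ ((j + 1) div 2) * (of_real pi / 2) ^ j * half_csc \<nu> *
     (\<Sum>l=0..j. 1 / 2 ^ l *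
        (\<Sum>m\<in>upto_half l \<gamma>. (-1) ^ m * of_nat (l choose (2 * m + \<gamma>)) * (- c) ^ (2 * m + \<gamma>)) * sec_coeff l j)"
    unfolding sec_deriv_formula_def Let_def tan_half_shift half_csc_eq_half_sec sec_coeff_def c_def \<gamma>_def
    by simp
  also have "\<dots> = ((-1) ^ ((j + 1) div 2) * (-1) ^ \<gamma>) * (of_real pi / 2) ^ j * half_csc \<nu> *
     (\<Sum>l=0..j. 1 / 2 ^ l * sec_coeff l j *
        (\<Sum>m\<in>upto_half l \<gamma>. (-1) ^ m * of_nat (l choose (2 * m + \<gamma>)) * c ^ (2 * m + \<gamma>)))"
  proof -
    have "(- c) ^ (2 * m + \<gamma>) = (-1) ^ \<gamma> * c ^ (2 * m + \<gamma>)" for m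
      by (subst power_minus) (simp add: power_add)
    then show ?thesis by (simp add: sum_distrib_left algebra_simps)
  qed
  also have "(-1) ^ ((j + 1) div 2) * (-1) ^ \<gamma> = ((-1) ^ (j div 2) :: complex)"
  proof -
    have "even ((j + 1) div 2 + \<gamma>) \<longleftrightarrow> even (j div 2)"
      unfolding \<gamma>_def by presburger
    then show ?thesis
      by (metis power_add neg_one_even_power neg_one_odd_power)
  qed
  finally show ?thesis
    unfolding csc_deriv_formula_def Let_def \<gamma>_def c_def sec_coeff_def .
qed

section \<open>Uniqueness of the finite part\<close>

lemma diverging_part_cmult:
  assumes "diverging_part D"
  shows "diverging_part (\<lambda>\<epsilon>. b * D \<epsilon>)"
proof -
  obtain P c where P: "finite P" "\<forall>(\<mu>, m) \<in> P. 0 \<le> Re \<mu> \<and> (\<mu>, m) \<noteq> (0, 0)"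
    "\<forall>\<epsilon>>0. D \<epsilon> = (\<Sum>(\<mu>, m)\<in>P. c (\<mu>, m) * of_real \<epsilon> powr (-\<mu>) * of_real (ln \<epsilon> ^ m))"
    using assms unfolding diverging_part_def by blast
  show ?thesis unfolding diverging_part_def
    using P by (intro exI[of _ P] exI[of _ "\<lambda>q. b * c q"])
      (auto simp: sum_distrib_left case_prod_unfold mult_ac)
qed

lemma diverging_part_add:
  assumes "diverging_part D1" "diverging_part D2"
  shows "diverging_part (\<lambda>\<epsilon>. D1 \<epsilon> + D2 \<epsilon>)"
proof -
  obtain P c where P: "finite P" "\<forall>(\<mu>, m) \<in> P. 0 \<le> Re \<mu> \<and> (\<mu>, m) \<noteq> (0, 0)"
    "\<forall>\<epsilon>>0. D1 \<epsilon> = (\<Sum>(\<mu>, m)\<in>P. c (\<mu>, m) * of_real \<epsilon> powr (-\<mu>) * of_real (ln \<epsilon> ^ m))"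
    using assms(1) unfolding diverging_part_def by blast
  obtain Q d where Q: "finite Q" "\<forall>(\<mu>, m) \<in> Q. 0 \<le> Re \<mu> \<and> (\<mu>, m) \<noteq> (0, 0)"
    "\<forall>\<epsilon>>0. D2 \<epsilon> = (\<Sum>(\<mu>, m)\<in>Q. d (\<mu>, m) * of_real \<epsilon> powr (-\<mu>) * of_real (ln \<epsilon> ^ m))"
    using assms(2) unfolding diverging_part_def by blast
  define e where "e = (\<lambda>q. (if q \<in> P then c q else 0) + (if q \<in> Q then d q else 0))"
  have "D1 \<epsilon> + D2 \<epsilon> = (\<Sum>(\<mu>, m)\<in>P \<union> Q. e (\<mu>, m) * of_real \<epsilon> powr (-\<mu>) * of_real (ln \<epsilon> ^ m))"
    if "\<epsilon> > 0" for \<epsilon>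
  proof -
    let ?g = "\<lambda>b q. b q * of_real \<epsilon> powr (- fst q) * of_real (ln \<epsilon> ^ snd q) :: complex"
    have "(\<Sum>q\<in>P \<union> Q. ?g e q)
        = (\<Sum>q\<in>P \<union> Q. ?g (\<lambda>q. if q \<in> P then c q else 0) q) + (\<Sum>q\<in>P \<union> Q. ?g (\<lambda>q. if q \<in> Q then d q else 0) q)"
      by (simp add: e_def distrib_right sum.distrib)
    also have "(\<Sum>q\<in>P \<union> Q. ?g (\<lambda>q. if q \<in> P then c q else 0) q) = (\<Sum>q\<in>P. ?g c q)"
      using P(1) Q(1) by (intro sum.mono_neutral_cong_right) auto
    also have "(\<Sum>q\<in>P \<union> Q. ?g (\<lambda>q. if q \<in> Q then d q else 0) q) = (\<Sum>q\<in>Q. ?g d q)"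
      using P(1) Q(1) by (intro sum.mono_neutral_cong_right) auto
    finally show ?thesis using P(3) Q(3) that by (simp add: case_prod_unfold)
  qed
  then show ?thesis unfolding diverging_part_def
    using P(1,2) Q(1,2) by (intro exI[of _ "P \<union> Q"] exI[of _ e]) blast
qed

lemma diverging_part_0: "diverging_part (\<lambda>_. 0)"
  unfolding diverging_part_def by (intro exI[of _ "{}"]) auto

lemma diverging_part_sum:
  "finite A \<Longrightarrow> (\<And>i. i \<in> A \<Longrightarrow> diverging_part (D i)) \<Longrightarrow> diverging_part (\<lambda>\<epsilon>. \<Sum>i\<in>A. D i \<epsilon>)"
  by (induction A rule: finite_induct) (auto intro: diverging_part_0 diverging_part_add)

lemma diverging_part_power_log:
  assumes "0 < Re \<mu>"
  shows "diverging_part (\<lambda>\<epsilon>. of_real \<epsilon> powr (-\<mu>) * of_real (ln \<epsilon> ^ m))"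
  unfolding diverging_part_def using assms
  by (intro exI[of _ "{(\<mu>, m)}"] exI[of _ "\<lambda>_. 1"]) auto

lemma poly_periodic_imp_const:
  fixes p :: "complex poly"
  assumes "pcompose p [:h, 1:] = p" "h \<noteq> 0"
  shows "p = [:poly p 0:]"
proof -
  have step: "poly p (z + h) = poly p z" for z
    using arg_cong[OF assms(1), of "\<lambda>p. poly p z"] by (simp add: poly_pcompose add.commute)
  have "poly p (of_nat n * h) = poly p 0" for n
  proof (induction n)
    case (Suc n)
    then show ?case using step[of "of_nat n * h"] by (simp add: algebra_simps)
  qed simp
  then have "range (\<lambda>n. of_nat n * h) \<subseteq> {z. poly (p - [:poly p 0:]) z = 0}" by auto
  moreover have "infinite (range (\<lambda>n. of_nat n * h))"
    using assms(2) by (intro range_inj_infinite) (auto simp: inj_on_def)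
  ultimately have "infinite {z. poly (p - [:poly p 0:]) z = 0}"
    using finite_subset by blast
  then show ?thesis using poly_roots_finite[of "p - [:poly p 0:]"] by fastforce
qed

text \<open>Replacing \<open>g x\<close> by \<open>g (x + h) - exp (\<mu>\<^sub>0 h) g x\<close> lowers the degree of the polynomial
  attached to \<open>\<mu>\<^sub>0\<close> and, for small \<open>h\<close>, preserves the degrees of all others.\<close>

lemma exponential_polynomial_tendsto_0:
  fixes p :: "complex \<Rightarrow> complex poly"
  assumes M: "finite M" "\<And>\<mu>. \<mu> \<in> M \<Longrightarrow> 0 \<le> Re \<mu>"
    and lim: "((\<lambda>x::real. \<Sum>\<mu>\<in>M. poly (p \<mu>) (of_real x) * exp (\<mu> * of_real x)) \<longlongrightarrow> 0) at_top"
    and "\<mu> \<in> M"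
  shows "p \<mu> = 0"
  using lim \<open>\<mu> \<in> M\<close>
proof (induction "\<Sum>\<mu>\<in>M. length (coeffs (p \<mu>))" arbitrary: p \<mu> rule: less_induct)
  case (less p \<mu>\<^sub>0)
  define g where "g = (\<lambda>x::real. \<Sum>\<mu>\<in>M. poly (p \<mu>) (of_real x) * exp (\<mu> * of_real x))"
  have g0: "(g \<longlongrightarrow> 0) at_top" using less.prems(1) by (simp add: g_def)
  show ?case
  proof (rule ccontr)
    assume nz: "p \<mu>\<^sub>0 \<noteq> 0"
    define h where "h = 1 / (1 + (\<Sum>\<mu>\<in>M. norm (\<mu> - \<mu>\<^sub>0)))"
    have h: "h > 0" unfolding h_def by (intro divide_pos_pos add_pos_nonneg sum_nonneg) auto
    have exp_neq: "exp (\<mu> * of_real h) \<noteq> exp (\<mu>\<^sub>0 * of_real h)" if "\<mu> \<in> M" "\<mu> \<noteq> \<mu>\<^sub>0" for \<mu>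
    proof
      assume "exp (\<mu> * of_real h) = exp (\<mu>\<^sub>0 * of_real h)"
      then have "exp ((\<mu> - \<mu>\<^sub>0) * of_real h) = 1" by (simp add: left_diff_distrib exp_diff)
      then obtain k :: int where k: "Re ((\<mu> - \<mu>\<^sub>0) * of_real h) = 0" "Im ((\<mu> - \<mu>\<^sub>0) * of_real h) = of_int (2 * k) * pi"
        by (auto simp: exp_eq_1)
      have "norm (\<mu> - \<mu>\<^sub>0) \<le> (\<Sum>\<mu>\<in>M. norm (\<mu> - \<mu>\<^sub>0))"
        using that M(1) by (intro member_le_sum) auto
      then have "norm ((\<mu> - \<mu>\<^sub>0) * of_real h) < 1"
        using sum_nonneg[of M "\<lambda>\<mu>. norm (\<mu> - \<mu>\<^sub>0)"]
        unfolding h_def norm_mult norm_of_real by (simp add: divide_less_eq)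
      then have "\<bar>of_int (2 * k) * pi\<bar> < 1" using abs_Im_le_cmod k(2) by (metis order_le_less_trans)
      moreover have "\<bar>of_int (2 * k) * pi\<bar> = 2 * \<bar>of_int k\<bar> * pi" by (simp add: abs_mult)
      ultimately have small: "2 * \<bar>of_int k\<bar> * pi < 1" by linarith
      have "k = 0"
      proof (rule ccontr)
        assume "k \<noteq> 0"
        then have "1 \<le> \<bar>of_int k :: real\<bar>" by linarith
        then have "1 * pi \<le> \<bar>of_int k\<bar> * pi" by (intro mult_right_mono) auto
        then show False using small pi_gt3 by linarith
      qed
      then have "(\<mu> - \<mu>\<^sub>0) * of_real h = 0" using k by (simp add: complex_eq_iff)
      then show False using that h by simp
    qed
    define q where "q = (\<lambda>\<mu>. smult (exp (\<mu> * of_real h)) (pcompose (p \<mu>) [:of_real h, 1:])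
                          - smult (exp (\<mu>\<^sub>0 * of_real h)) (p \<mu>))"
    have deg: "degree (q \<mu>) \<le> degree (p \<mu>)" for \<mu>
      unfolding q_def by (intro degree_diff_le order.trans[OF degree_smult_le]) (auto simp: degree_pcompose)
    have lead: "coeff (q \<mu>) (degree (p \<mu>)) = (exp (\<mu> * of_real h) - exp (\<mu>\<^sub>0 * of_real h)) * lead_coeff (p \<mu>)" for \<mu>
      using lead_coeff_comp[of "[:of_real h, 1:]" "p \<mu>"]
      by (simp add: q_def degree_pcompose left_diff_distrib)
    have len: "length (coeffs (q \<mu>)) \<le> length (coeffs (p \<mu>))" for \<mu>
    proof (cases "p \<mu> = 0")
      case True
      then show ?thesis by (simp add: q_def)
    next
      case False
      then show ?thesis using deg[of \<mu>] by (cases "q \<mu> = 0") (auto simp: length_coeffs)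
    qed
    have "length (coeffs (q \<mu>\<^sub>0)) < length (coeffs (p \<mu>\<^sub>0))"
    proof (cases "q \<mu>\<^sub>0 = 0")
      case False
      have "degree (q \<mu>\<^sub>0) \<noteq> degree (p \<mu>\<^sub>0)"
        using lead[of \<mu>\<^sub>0] False by (metis diff_self leading_coeff_0_iff mult_zero_left)
      then show ?thesis using False nz deg[of \<mu>\<^sub>0] by (simp add: length_coeffs)
    qed (use nz in \<open>auto simp: length_coeffs\<close>)
    then have meas: "(\<Sum>\<mu>\<in>M. length (coeffs (q \<mu>))) < (\<Sum>\<mu>\<in>M. length (coeffs (p \<mu>)))"
      using M(1) less.prems(2) len by (intro sum_strict_mono_ex1) auto
    have "(\<Sum>\<mu>\<in>M. poly (q \<mu>) (of_real x) * exp (\<mu> * of_real x)) = g (x + h) - exp (\<mu>\<^sub>0 * of_real h) * g x" for x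
      unfolding g_def sum_distrib_left sum_subtractf[symmetric]
      by (rule sum.cong) (auto simp: q_def poly_pcompose algebra_simps exp_add)
    moreover have "((\<lambda>x. g (x + h) - exp (\<mu>\<^sub>0 * of_real h) * g x) \<longlongrightarrow> 0 - exp (\<mu>\<^sub>0 * of_real h) * 0) at_top"
    proof (intro tendsto_diff tendsto_mult tendsto_const g0 filterlim_compose[OF g0])
      show "filterlim (\<lambda>x. x + h) at_top at_top"
        using filterlim_tendsto_add_at_top[OF tendsto_const[of h] filterlim_ident] by (simp add: add.commute)
    qed
    ultimately have q0: "q \<mu> = 0" if "\<mu> \<in> M" for \<mu>
      using less.hyps[OF meas _ that] by simp
    have p0: "p \<mu> = 0" if "\<mu> \<in> M - {\<mu>\<^sub>0}" for \<mu>
      using lead[of \<mu>] q0[of \<mu>] exp_neq[of \<mu>] that by auto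
    have "pcompose (p \<mu>\<^sub>0) [:of_real h, 1:] = p \<mu>\<^sub>0"
      using q0[OF less.prems(2)] unfolding q_def by (simp flip: smult_diff_right)
    then have const: "p \<mu>\<^sub>0 = [:poly (p \<mu>\<^sub>0) 0:]" using h by (intro poly_periodic_imp_const) auto
    define c where "c = poly (p \<mu>\<^sub>0) 0"
    have c: "p \<mu>\<^sub>0 = [:c:]" "c \<noteq> 0" using const nz by (auto simp: c_def)
    have "g x = c * exp (\<mu>\<^sub>0 * of_real x)" for x
      unfolding g_def using M(1) less.prems(2) p0 c
      by (subst sum.remove[of _ \<mu>\<^sub>0]) (auto intro!: sum.neutral)
    then have "norm c \<le> norm (g x)" if "x \<ge> 0" for x
      using mult_left_mono[of 1 "exp (Re \<mu>\<^sub>0 * x)" "norm c"] M(2)[OF less.prems(2)] that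
      by (simp add: norm_mult)
    moreover have "((\<lambda>x. norm (g x)) \<longlongrightarrow> 0) at_top" using g0 by (rule tendsto_norm_zero)
    ultimately have "norm c \<le> 0"
      by (intro tendsto_lowerbound[of "\<lambda>x. norm (g x)"]) (auto intro!: eventually_at_top_linorderI[of 0])
    then show False using c by simp
  qed
qed

lemma diverging_part_tendsto_imp_0:
  assumes "diverging_part D" and lim: "(D \<longlongrightarrow> L) (at_right 0)"
  shows "L = 0"
proof -
  obtain P c where P: "finite P" "\<forall>(\<mu>, m) \<in> P. 0 \<le> Re \<mu> \<and> (\<mu>, m) \<noteq> (0, 0)"
    "\<forall>\<epsilon>>0. D \<epsilon> = (\<Sum>(\<mu>, m)\<in>P. c (\<mu>, m) * of_real \<epsilon> powr (-\<mu>) * of_real (ln \<epsilon> ^ m))"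
    using assms(1) unfolding diverging_part_def by blast
  define M where "M = insert 0 (fst ` P)"
  define p where "p = (\<lambda>\<mu>. (\<Sum>q\<in>P. if fst q = \<mu> then monom (c q * (-1) ^ snd q) (snd q) else 0)
                          - (if \<mu> = 0 then [:L:] else 0))"
  have M: "finite M" "\<And>\<mu>. \<mu> \<in> M \<Longrightarrow> 0 \<le> Re \<mu>"
    using P(1,2) by (auto simp: M_def)
  have "D (exp (-x)) - L = (\<Sum>\<mu>\<in>M. poly (p \<mu>) (of_real x) * exp (\<mu> * of_real x))" for x :: real
  proof -
    have "(\<Sum>\<mu>\<in>M. poly (p \<mu>) (of_real x) * exp (\<mu> * of_real x))
        = (\<Sum>\<mu>\<in>M. \<Sum>q\<in>P. if fst q = \<mu> then c q * (-1) ^ snd q * of_real x ^ snd q * exp (\<mu> * of_real x) else 0)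
          - (\<Sum>\<mu>\<in>M. if \<mu> = 0 then L else 0)"
      unfolding sum_subtractf[symmetric]
      by (rule sum.cong) (auto simp: p_def left_diff_distrib poly_sum sum_distrib_right poly_monom intro!: sum.cong)
    also have "(\<Sum>\<mu>\<in>M. if \<mu> = 0 then L else 0) = L"
      using M(1) by (subst sum.delta) (auto simp: M_def)
    also have "(\<Sum>\<mu>\<in>M. \<Sum>q\<in>P. if fst q = \<mu> then c q * (-1) ^ snd q * of_real x ^ snd q * exp (\<mu> * of_real x) else 0)
       = (\<Sum>q\<in>P. c q * (-1) ^ snd q * of_real x ^ snd q * exp (fst q * of_real x))"
      using M(1) by (subst sum.swap, intro sum.cong refl) (auto simp: M_def sum.delta')
    also have "\<dots> = D (exp (-x))"
    proof -
      have "of_real (exp (-x)) powr (-\<mu>) = exp (\<mu> * of_real x)" for \<mu> :: complex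
        by (simp add: powr_def Ln_of_real)
      moreover have "(-1) ^ m * of_real x ^ m = (- of_real x :: complex) ^ m" for m
        by (simp flip: power_mult_distrib)
      ultimately show ?thesis
        unfolding P(3)[rule_format, OF exp_gt_zero]
        by (intro sum.cong) (auto simp: mult_ac)
    qed
    finally show ?thesis by simp
  qed
  moreover have "((\<lambda>x. D (exp (-x)) - L) \<longlongrightarrow> L - L) at_top"
  proof (intro tendsto_diff tendsto_const filterlim_compose[OF lim])
    have "filterlim (\<lambda>x::real. exp (- x)) (at 0 within {0<..}) at_top"
      unfolding filterlim_at using filterlim_compose[OF exp_at_bot filterlim_uminus_at_bot_at_top]
      by auto
    then show "filterlim (\<lambda>x::real. exp (- x)) (at_right 0) at_top" .
  qed
  ultimately have "p 0 = 0"
    by (intro exponential_polynomial_tendsto_0[OF M, of p]) (auto simp: M_def)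
  then have "coeff (p 0) 0 = 0" by simp
  moreover have "coeff (p 0) 0 = - L"
  proof -
    have "(\<Sum>q\<in>P. coeff (if fst q = 0 then monom (c q * (-1) ^ snd q) (snd q) else 0) 0) = 0"
      using P(2) by (intro sum.neutral) auto
    then show ?thesis by (simp add: p_def coeff_sum)
  qed
  ultimately show ?thesis by simp
qed

lemma has_finite_part_unique:
  assumes "has_finite_part g a I" "has_finite_part g a J" and "0 < a"
  shows "I = J"
proof -
  obtain C D where 1: "diverging_part D"
      "\<forall>\<epsilon>>0. ereal \<epsilon> < a \<longrightarrow> integral (einterval (ereal \<epsilon>) a) g = C \<epsilon> + D \<epsilon>" "(C \<longlongrightarrow> I) (at_right 0)"
    using assms(1) unfolding has_finite_part_def by blast
  obtain C' D' where 2: "diverging_part D'"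
      "\<forall>\<epsilon>>0. ereal \<epsilon> < a \<longrightarrow> integral (einterval (ereal \<epsilon>) a) g = C' \<epsilon> + D' \<epsilon>" "(C' \<longlongrightarrow> J) (at_right 0)"
    using assms(2) unfolding has_finite_part_def by blast
  have "diverging_part (\<lambda>\<epsilon>. D \<epsilon> + (-1) * D' \<epsilon>)"
    by (intro diverging_part_add diverging_part_cmult 1 2)
  moreover obtain b where b: "0 < b" "ereal b < a"
    using ereal_dense2[OF \<open>0 < a\<close>] by (auto simp: zero_ereal_def)
  have "\<forall>\<^sub>F \<epsilon> in at_right 0. C' \<epsilon> - C \<epsilon> = D \<epsilon> + (-1) * D' \<epsilon>"
    using eventually_at_right_less[of 0] order_tendstoD(2)[OF tendsto_ident_at b(1)]
  proof eventually_elim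
    case (elim \<epsilon>)
    then have "ereal \<epsilon> < a" using b(2) by (metis ereal_less(2) less_ereal.simps(1) order.strict_trans)
    then have "C \<epsilon> + D \<epsilon> = C' \<epsilon> + D' \<epsilon>" using 1(2) 2(2) elim by simp
    then show ?case by algebra
  qed
  then have "((\<lambda>\<epsilon>. D \<epsilon> + (-1) * D' \<epsilon>) \<longlongrightarrow> J - I) (at_right 0)"
    by (rule Lim_transform_eventually[rotated]) (intro tendsto_diff 1 2)
  ultimately have "J - I = 0" by (rule diverging_part_tendsto_imp_0)
  then show ?thesis by simp
qed

lemma finite_part_eqI: "has_finite_part g a I \<Longrightarrow> 0 < a \<Longrightarrow> finite_part g a = I"
  unfolding finite_part_def by (rule the_equality) (auto intro: has_finite_part_unique)

section \<open>Powers times powers of the logarithm\<close>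

lemma power_le_fact_mult_exp:
  fixes y \<eta> :: real
  assumes "0 \<le> y" "0 < \<eta>"
  shows "y ^ n \<le> fact n / \<eta> ^ n * exp (\<eta> * y)"
proof -
  have "(\<Sum>k\<in>{n}. (\<eta> * y) ^ k /\<^sub>R fact k) \<le> (\<Sum>k. (\<eta> * y) ^ k /\<^sub>R fact k)"
    using assms by (intro sum_le_suminf summable_exp_generic) auto
  then show ?thesis
    using assms by (simp add: exp_def power_mult_distrib field_simps)
qed

definition log_power :: "complex \<Rightarrow> nat \<Rightarrow> real \<Rightarrow> complex" where
  "log_power \<alpha> n t = of_real t powr \<alpha> * of_real (ln t ^ n)"

lemma norm_log_power: "0 < t \<Longrightarrow> norm (log_power \<alpha> n t) = t powr Re \<alpha> * \<bar>ln t\<bar> ^ n"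
  by (simp add: log_power_def norm_mult norm_power norm_powr_real_powr)

lemma norm_log_power_le:
  assumes "0 < t" "0 < \<eta>"
  shows "norm (log_power \<alpha> n t) \<le> fact n / \<eta> ^ n * (t powr (Re \<alpha> + \<eta>) + t powr (Re \<alpha> - \<eta>))"
proof -
  have "\<bar>ln t\<bar> ^ n \<le> fact n / \<eta> ^ n * exp (\<eta> * \<bar>ln t\<bar>)"
    using assms by (intro power_le_fact_mult_exp) auto
  also have "\<dots> \<le> fact n / \<eta> ^ n * (t powr \<eta> + t powr (-\<eta>))"
    using assms by (intro mult_left_mono) (auto simp: powr_def abs_if)
  finally have "t powr Re \<alpha> * \<bar>ln t\<bar> ^ n \<le> t powr Re \<alpha> * (fact n / \<eta> ^ n * (t powr \<eta> + t powr (-\<eta>)))"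
    by (rule mult_left_mono) auto
  also have "\<dots> = fact n / \<eta> ^ n * (t powr (Re \<alpha> + \<eta>) + t powr (Re \<alpha> - \<eta>))"
    by (simp add: algebra_simps powr_add powr_diff powr_minus divide_inverse)
  finally show ?thesis using assms by (simp add: norm_log_power)
qed

lemma log_power_add: "0 < t \<Longrightarrow> log_power (\<alpha> + of_nat m) n t = log_power \<alpha> n t * of_real t ^ m"
  by (simp add: log_power_def powr_add powr_nat')

lemma continuous_on_log_power [continuous_intros]: "continuous_on {0<..} (log_power \<alpha> n)"
  unfolding log_power_def
  by (intro continuous_intros) (auto simp: complex_nonpos_Reals_iff)

lemma log_power_tendsto_0:
  assumes "0 < Re \<alpha>"
  shows "(log_power \<alpha> n \<longlongrightarrow> 0) (at_right 0)"
proof -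
  define \<eta> where "\<eta> = Re \<alpha> / 2"
  have \<eta>: "0 < \<eta>" "0 < Re \<alpha> + \<eta>" "0 < Re \<alpha> - \<eta>" using assms by (auto simp: \<eta>_def)
  have pw: "((\<lambda>t::real. t powr s) \<longlongrightarrow> 0) (at_right 0)" if "0 < s" for s
  proof -
    have "((\<lambda>t::real. t powr s) \<longlongrightarrow> 0 powr s) (at_right 0)"
      by (intro tendsto_powr' tendsto_ident_at tendsto_const)
        (use that in \<open>auto intro: eventually_at_rightI[of 0 1]\<close>)
    then show ?thesis by simp
  qed
  have ev: "\<forall>\<^sub>F t in at_right 0. norm (log_power \<alpha> n t) \<le> fact n / \<eta> ^ n * (t powr (Re \<alpha> + \<eta>) + t powr (Re \<alpha> - \<eta>))"
    using eventually_at_right_less[of 0] by eventually_elim (rule norm_log_power_le[OF _ \<eta>(1)])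
  have "((\<lambda>t. fact n / \<eta> ^ n * (t powr (Re \<alpha> + \<eta>) + t powr (Re \<alpha> - \<eta>))) \<longlongrightarrow> fact n / \<eta> ^ n * (0 + 0)) (at_right 0)"
    by (intro tendsto_mult tendsto_const tendsto_add pw \<eta>)
  then show ?thesis by (intro Lim_null_comparison[OF ev]) simp
qed

lemma log_power_tendsto_0_at_top:
  assumes "Re \<alpha> < 0"
  shows "(log_power \<alpha> n \<longlongrightarrow> 0) at_top"
proof -
  define \<eta> where "\<eta> = - Re \<alpha> / 2"
  have \<eta>: "0 < \<eta>" "Re \<alpha> + \<eta> < 0" "Re \<alpha> - \<eta> < 0" using assms by (auto simp: \<eta>_def)
  have ev: "\<forall>\<^sub>F t in at_top. norm (log_power \<alpha> n t) \<le> fact n / \<eta> ^ n * (t powr (Re \<alpha> + \<eta>) + t powr (Re \<alpha> - \<eta>))"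
    using eventually_gt_at_top[of 0] by eventually_elim (rule norm_log_power_le[OF _ \<eta>(1)])
  have "((\<lambda>t. fact n / \<eta> ^ n * (t powr (Re \<alpha> + \<eta>) + t powr (Re \<alpha> - \<eta>))) \<longlongrightarrow> fact n / \<eta> ^ n * (0 + 0)) at_top"
    by (intro tendsto_mult tendsto_const tendsto_add tendsto_neg_powr \<eta> filterlim_ident)
  then show ?thesis by (intro Lim_null_comparison[OF ev]) simp
qed

fun log_power_primitive :: "complex \<Rightarrow> nat \<Rightarrow> real \<Rightarrow> complex" where
  "log_power_primitive \<alpha> 0 t = log_power (\<alpha> + 1) 0 t / (\<alpha> + 1)"
| "log_power_primitive \<alpha> (Suc n) t =
     (log_power (\<alpha> + 1) (Suc n) t - of_nat (Suc n) * log_power_primitive \<alpha> n t) / (\<alpha> + 1)"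

lemma has_vector_derivative_log_power:
  assumes "0 < t"
  shows "(log_power \<alpha> n has_vector_derivative
           (\<alpha> * log_power (\<alpha> - 1) n t + of_nat n * log_power (\<alpha> - 1) (n - 1) t)) (at t)"
proof -
  let ?f = "\<lambda>z. z powr \<alpha> * Ln z ^ n"
  have t: "of_real t \<notin> \<real>\<^sub>\<le>\<^sub>0" "Ln (of_real t) = of_real (ln t)"
    using assms by (auto simp: complex_nonpos_Reals_iff Ln_of_real)
  have "(?f has_field_derivative \<alpha> * log_power (\<alpha> - 1) n t + of_nat n * log_power (\<alpha> - 1) (n - 1) t) (at (of_real t))"
    using t assms
    by (auto intro!: derivative_eq_intros simp: log_power_def powr_diff field_simps)
  then have "((\<lambda>t. ?f (of_real t)) has_vector_derivative \<alpha> * log_power (\<alpha> - 1) n t + of_nat n * log_power (\<alpha> - 1) (n - 1) t) (at t)"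
    by (rule has_vector_derivative_real_field)
  then show ?thesis
  proof (rule has_vector_derivative_transform_within_open[of _ _ _ "{0<..}"])
    show "?f (of_real x) = log_power \<alpha> n x" if "x \<in> {0<..}" for x
      using that by (simp add: log_power_def Ln_of_real)
  qed (use assms in auto)
qed

lemma has_vector_derivative_log_power_primitive:
  assumes "0 < t" "\<alpha> \<noteq> -1"
  shows "(log_power_primitive \<alpha> n has_vector_derivative log_power \<alpha> n t) (at t)"
proof (induction n)
  have nz: "\<alpha> + 1 \<noteq> 0" using assms by (simp add: add_eq_0_iff2)
  case 0
  have "((\<lambda>t. 1 / (\<alpha> + 1) * log_power (\<alpha> + 1) 0 t) has_vector_derivative
           1 / (\<alpha> + 1) * ((\<alpha> + 1) * log_power (\<alpha> + 1 - 1) 0 t + of_nat 0 * log_power (\<alpha> + 1 - 1) (0 - 1) t)) (at t)"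
    by (intro has_vector_derivative_mult_right has_vector_derivative_log_power assms)
  then show ?case using nz by (simp add: fun_eq_iff)
next
  have nz: "\<alpha> + 1 \<noteq> 0" using assms by (simp add: add_eq_0_iff2)
  case (Suc n)
  have "((\<lambda>t. 1 / (\<alpha> + 1) * (log_power (\<alpha> + 1) (Suc n) t - of_nat (Suc n) * log_power_primitive \<alpha> n t)) has_vector_derivative
           1 / (\<alpha> + 1) * (((\<alpha> + 1) * log_power (\<alpha> + 1 - 1) (Suc n) t + of_nat (Suc n) * log_power (\<alpha> + 1 - 1) (Suc n - 1) t)
             - of_nat (Suc n) * log_power \<alpha> n t)) (at t)"
    by (intro has_vector_derivative_mult_right has_vector_derivative_diff has_vector_derivative_log_power assms Suc)
  then show ?case using nz by (simp add: fun_eq_iff)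
qed

lemma log_power_primitive_tendsto_0:
  assumes "-1 < Re \<alpha>"
  shows "(log_power_primitive \<alpha> n \<longlongrightarrow> 0) (at_right 0)"
proof (induction n)
  case 0
  have "((\<lambda>t. log_power (\<alpha> + 1) 0 t / (\<alpha> + 1)) \<longlongrightarrow> 0 / (\<alpha> + 1)) (at_right 0)"
    by (intro tendsto_divide tendsto_const log_power_tendsto_0) (use assms in \<open>auto simp: complex_eq_iff\<close>)
  then show ?case by simp
next
  case (Suc n)
  have "((\<lambda>t. (log_power (\<alpha> + 1) (Suc n) t - of_nat (Suc n) * log_power_primitive \<alpha> n t) / (\<alpha> + 1)) \<longlongrightarrow> (0 - of_nat (Suc n) * 0) / (\<alpha> + 1)) (at_right 0)"
    by (intro tendsto_divide tendsto_diff tendsto_mult tendsto_const log_power_tendsto_0 Suc) (use assms in \<open>auto simp: complex_eq_iff\<close>)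
  then show ?case by simp
qed

lemma log_power_primitive_tendsto_0_at_top:
  assumes "Re \<alpha> < -1"
  shows "(log_power_primitive \<alpha> n \<longlongrightarrow> 0) at_top"
proof (induction n)
  case 0
  have "((\<lambda>t. log_power (\<alpha> + 1) 0 t / (\<alpha> + 1)) \<longlongrightarrow> 0 / (\<alpha> + 1)) at_top"
    by (intro tendsto_divide tendsto_const log_power_tendsto_0_at_top) (use assms in \<open>auto simp: complex_eq_iff\<close>)
  then show ?case by simp
next
  case (Suc n)
  have "((\<lambda>t. (log_power (\<alpha> + 1) (Suc n) t - of_nat (Suc n) * log_power_primitive \<alpha> n t) / (\<alpha> + 1)) \<longlongrightarrow> (0 - of_nat (Suc n) * 0) / (\<alpha> + 1)) at_top"
    by (intro tendsto_divide tendsto_diff tendsto_mult tendsto_const log_power_tendsto_0_at_top Suc) (use assms in \<open>auto simp: complex_eq_iff\<close>)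
  then show ?case by simp
qed

lemma norm_log_power_primitive_le:
  assumes "0 < r" "0 < \<delta>"
  obtains B where "0 \<le> B" "\<And>\<alpha>. \<delta> \<le> norm (\<alpha> + 1) \<Longrightarrow> norm (log_power_primitive \<alpha> n r) \<le> B * r powr Re \<alpha>"
proof -
  have "\<exists>B\<ge>0. \<forall>\<alpha>. \<delta> \<le> norm (\<alpha> + 1) \<longrightarrow> norm (log_power_primitive \<alpha> n r) \<le> B * r powr Re \<alpha>"
  proof (induction n)
    case 0
    have "norm (log_power_primitive \<alpha> 0 r) \<le> r / \<delta> * r powr Re \<alpha>" if "\<delta> \<le> norm (\<alpha> + 1)" for \<alpha>
      using that assms
      by (auto simp: norm_divide norm_log_power powr_add mult.commute intro!: frac_le)
    then show ?case using assms by (intro exI[of _ "r / \<delta>"]) auto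
  next
    case (Suc n)
    then obtain B where B: "0 \<le> B" "\<And>\<alpha>. \<delta> \<le> norm (\<alpha> + 1) \<Longrightarrow> norm (log_power_primitive \<alpha> n r) \<le> B * r powr Re \<alpha>"
      by blast
    have "norm (log_power_primitive \<alpha> (Suc n) r) \<le> (r * \<bar>ln r\<bar> ^ Suc n + real (Suc n) * B) / \<delta> * r powr Re \<alpha>"
      if "\<delta> \<le> norm (\<alpha> + 1)" for \<alpha>
    proof -
      have "norm (log_power (\<alpha> + 1) (Suc n) r - of_nat (Suc n) * log_power_primitive \<alpha> n r)
          \<le> norm (log_power (\<alpha> + 1) (Suc n) r) + norm (of_nat (Suc n) * log_power_primitive \<alpha> n r)"
        by (rule norm_triangle_ineq4)
      also have "\<dots> \<le> r * \<bar>ln r\<bar> ^ Suc n * r powr Re \<alpha> + real (Suc n) * (B * r powr Re \<alpha>)"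
        unfolding norm_mult norm_of_nat
        using assms B that by (intro add_mono mult_left_mono) (auto simp: norm_log_power powr_add)
      finally have "norm (log_power_primitive \<alpha> (Suc n) r) \<le> (r * \<bar>ln r\<bar> ^ Suc n * r powr Re \<alpha> + real (Suc n) * (B * r powr Re \<alpha>)) / \<delta>"
        unfolding log_power_primitive.simps norm_divide using that assms B(1)
        by (intro frac_le) (auto intro!: add_nonneg_nonneg mult_nonneg_nonneg)
      then show ?thesis by (simp add: algebra_simps)
    qed
    then show ?case using assms B
      by (intro exI[of _ "(r * \<bar>ln r\<bar> ^ Suc n + real (Suc n) * B) / \<delta>"]) auto
  qed
  then show ?thesis using that by blast
qed

lemma continuous_bounded_imp_absolutely_integrable:
  fixes f :: "real \<Rightarrow> 'a::euclidean_space"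
  assumes "open S" "continuous_on S f" "g integrable_on S" "\<And>x. x \<in> S \<Longrightarrow> norm (f x) \<le> g x"
  shows "f absolutely_integrable_on S" "f integrable_on S"
proof -
  have "S \<in> sets lebesgue" using assms(1) by auto
  then show "f absolutely_integrable_on S"
    using assms by (intro measurable_bounded_by_integrable_imp_absolutely_integrable[of _ _ g]
        continuous_imp_measurable_on_sets_lebesgue)
  then show "f integrable_on S" by (simp add: absolutely_integrable_on_def)
qed

definition to_end :: "ereal \<Rightarrow> real filter" where
  "to_end a = (if a = \<infinity> then at_top else at_left (real_of_ereal a))"

lemma to_end_simps [simp]: "to_end \<infinity> = at_top" "to_end (ereal b) = at_left b"
  by (auto simp: to_end_def)

lemma to_end_neq_bot [simp]: "to_end a \<noteq> bot"
  by (auto simp: to_end_def)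

lemma ereal_less_cases:
  assumes "ereal r < a"
  obtains (real) b where "a = ereal b" "r < b" | (infinite) "a = \<infinity>"
  using assms by (cases a) auto

lemma eventually_to_end_ge:
  assumes "ereal b < a"
  shows "\<forall>\<^sub>F x in to_end a. b < x \<and> ereal x < a"
  using assms
proof (cases rule: ereal_less_cases)
  case (real c)
  then show ?thesis
    using eventually_at_left_real[of b c] by (auto elim: eventually_mono)
qed (auto intro: eventually_gt_at_top)

lemma eventually_to_end:
  assumes "ereal r < a" "eventually P (to_end a)"
  obtains b where "r < b" "ereal b < a" "\<And>x. b \<le> x \<Longrightarrow> ereal x < a \<Longrightarrow> P x"
  using assms(1)
proof (cases rule: ereal_less_cases)
  case (real c)
  then obtain b where "b < c" "\<forall>y>b. y < c \<longrightarrow> P y"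
    using assms(2) by (auto simp: eventually_at_left_field)
  moreover obtain b' where "max r b < b'" "b' < c"
    using dense[of "max r b" c] real \<open>b < c\<close> by auto
  ultimately show ?thesis using real by (intro that[of b']) auto
next
  case infinite
  then obtain b where "\<forall>y\<ge>b. P y" using assms(2) by (auto simp: eventually_at_top_linorder)
  then show ?thesis using infinite by (intro that[of "\<bar>b\<bar> + \<bar>r\<bar> + 1"]) auto
qed

lemma fundamental_theorem_of_calculus_limits:
  fixes f :: "real \<Rightarrow> 'a::banach"
  assumes "r < b"
    and der: "\<And>x. r < x \<Longrightarrow> x < b \<Longrightarrow> (f has_vector_derivative f' x) (at x)"
    and A: "(f \<longlongrightarrow> A) (at_right r)" and L: "(f \<longlongrightarrow> L) (at_left b)"
  shows "(f' has_integral (L - A)) {r..b}"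
proof -
  define g where "g = (\<lambda>x. if x = r then A else if x = b then L else f x)"
  have dg: "(g has_vector_derivative f' x) (at x)" if "x \<in> {r<..<b}" for x
    by (rule has_vector_derivative_transform_within_open[of f _ _ "{r<..<b}"])
       (use that der in \<open>auto simp: g_def\<close>)
  have "continuous_on {r..b} g"
  proof (rule continuous_on_IccI)
    have "\<forall>\<^sub>F x in at_right r. f x = g x"
      using eventually_at_right_real[OF \<open>r < b\<close>] by eventually_elim (auto simp: g_def)
    then show "(g \<longlongrightarrow> g r) (at_right r)"
      using A by (auto simp: g_def intro: Lim_transform_eventually)
    have "\<forall>\<^sub>F x in at_left b. f x = g x"
      using eventually_at_left_real[OF \<open>r < b\<close>] by eventually_elim (auto simp: g_def)
    then show "(g \<longlongrightarrow> g b) (at_left b)"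
      using L \<open>r < b\<close> by (auto simp: g_def intro: Lim_transform_eventually)
    show "g \<midarrow>x\<rightarrow> g x" if "r < x" "x < b" for x
      using has_vector_derivative_continuous[OF dg[of x]] that by (simp add: continuous_at)
  qed fact
  then have "(f' has_integral (g b - g r)) {r..b}"
    using dg \<open>r < b\<close> by (intro fundamental_theorem_of_calculus_interior) auto
  then show ?thesis using \<open>r < b\<close> by (simp add: g_def)
qed

lemma fundamental_theorem_of_calculus_improper:
  fixes f :: "real \<Rightarrow> 'a::banach"
  assumes "ereal r < a"
    and der: "\<And>x. r < x \<Longrightarrow> ereal x < a \<Longrightarrow> (f has_vector_derivative f' x) (at x)"
    and A: "(f \<longlongrightarrow> A) (at_right r)" and L: "(f \<longlongrightarrow> L) (to_end a)"
  shows "(f' has_integral (L - A)) (einterval (ereal r) a)"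
  using assms(1)
proof (cases rule: ereal_less_cases)
  case (real b)
  have "(f' has_integral (L - A)) {r..b}"
    by (rule fundamental_theorem_of_calculus_limits) (use real der A L in auto)
  then show ?thesis using real by (simp add: has_integral_Icc_iff_Ioo)
next
  case infinite
  have int: "(f' has_integral (f y - A)) {r<..y}" if "r < y" for y
  proof -
    have "f \<midarrow>y\<rightarrow> f y"
      using has_vector_derivative_continuous[OF der[of y]] that infinite by (simp add: continuous_at)
    then have "(f \<longlongrightarrow> f y) (at_left y)" by (rule tendsto_within_subset) auto
    then have "(f' has_integral (f y - A)) {r..y}"
      by (intro fundamental_theorem_of_calculus_limits) (use that infinite der A in auto)
    then show ?thesis
      by (rule iffD1[OF has_integral_spike_set_eq, rotated 2]) (auto intro: negligible_subset[of "{r}"])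
  qed
  have sub: "f' integrable_on ({r<..} \<inter> cbox c d)" for c d
  proof (cases "c > r")
    case True
    then have "f' integrable_on {c..d}"
    proof (cases "d > r")
      case d: True
      then show ?thesis
        using int[OF d] \<open>c > r\<close>
        by (intro integrable_on_subinterval[of _ "{r<..d}"]) auto
    qed auto
    moreover have "{r<..} \<inter> cbox c d = {c..d}" using True by auto
    ultimately show ?thesis by simp
  next
    case False
    then have "{r<..} \<inter> cbox c d = {r<..d}" by auto
    then show ?thesis using int[of d] by (cases "d > r") auto
  qed
  show ?thesis
    unfolding infinite einterval_eq has_integral_alt'
  proof (intro conjI allI impI)
    show "(\<lambda>x. if x \<in> {r<..} then f' x else 0) integrable_on cbox c d" for c d
      unfolding integrable_restrict_Int by (rule sub)
    fix e :: real assume "e > 0"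
    then have "\<forall>\<^sub>F y in at_top. dist (f y) L < e"
      using L infinite by (auto dest: tendstoD)
    then obtain Y where Y: "\<And>y. y \<ge> Y \<Longrightarrow> dist (f y) L < e"
      by (auto simp: eventually_at_top_linorder)
    define B where "B = \<bar>r\<bar> + \<bar>Y\<bar> + 1"
    have "norm (integral (cbox c d) (\<lambda>x. if x \<in> {r<..} then f' x else 0) - (L - A)) < e"
      if "ball 0 B \<subseteq> cbox c d" for c d
    proof -
      have "r \<in> ball 0 B" "max (r + 1/2) Y \<in> ball 0 B" by (auto simp: B_def dist_norm)
      then have cd: "c \<le> r" "r < d" "Y \<le> d" using that by (auto simp: subset_iff dist_norm)
      then have "{r<..} \<inter> cbox c d = {r<..d}" by auto
      then have "integral (cbox c d) (\<lambda>x. if x \<in> {r<..} then f' x else 0) = f d - A"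
        unfolding integral_restrict_Int using integral_unique[OF int[OF cd(2)]] by simp
      then show ?thesis using Y[OF cd(3)] by (simp add: dist_norm)
    qed
    then show "\<exists>B>0. \<forall>c d. ball 0 B \<subseteq> cbox c d \<longrightarrow>
        norm (integral (cbox c d) (\<lambda>x. if x \<in> {r<..} then f' x else 0) - (L - A)) < e"
      by (intro exI[of _ B]) (auto simp: B_def)
  qed
qed

lemma tendsto_integral_to_end:
  fixes f :: "real \<Rightarrow> 'a::banach"
  assumes "ereal r < a" and f: "f integrable_on einterval (ereal r) a"
  shows "((\<lambda>x. integral {r..x} f) \<longlongrightarrow> integral (einterval (ereal r) a) f) (to_end a)"
  using assms(1)
proof (cases rule: ereal_less_cases)
  case (real b)
  then have "f integrable_on {r..b}" using f by (simp add: integrable_on_Icc_iff_Ioo)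
  then have "continuous_on {r..b} (\<lambda>x. integral {r..x} f)" by (rule indefinite_integral_continuous_1)
  then have "((\<lambda>x. integral {r..x} f) \<longlongrightarrow> integral {r..b} f) (at b within {r..b})"
    using real by (simp add: continuous_on)
  then have "((\<lambda>x. integral {r..x} f) \<longlongrightarrow> integral {r..b} f) (at_left b)"
    using real at_within_Icc_at_left by metis
  moreover have "integral {r..b} f = integral (einterval (ereal r) a) f"
    using real by (simp add: integral_open_interval_real)
  ultimately show ?thesis using real by simp
next
  case infinite
  let ?I = "integral {r<..} f"
  have "(f has_integral ?I) {r<..}" using f infinite by (auto intro: integrable_integral)
  then have alt: "\<And>e. e > 0 \<Longrightarrow> \<exists>B>0. \<forall>c d. ball 0 B \<subseteq> cbox c d \<longrightarrow>
        norm (integral (cbox c d) (\<lambda>x. if x \<in> {r<..} then f x else 0) - ?I) < e"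
    unfolding has_integral_alt' by blast
  have "((\<lambda>x. integral {r..x} f) \<longlongrightarrow> ?I) at_top"
  proof (rule tendstoI)
    fix e :: real assume "e > 0"
    then obtain B where B: "B > 0" "\<And>c d. ball 0 B \<subseteq> cbox c d \<Longrightarrow>
        norm (integral (cbox c d) (\<lambda>x. if x \<in> {r<..} then f x else 0) - ?I) < e"
      using alt by blast
    have "dist (integral {r..x} f) ?I < e" if "x \<ge> B + \<bar>r\<bar>" for x
    proof -
      have "ball 0 B \<subseteq> cbox (- (B + \<bar>r\<bar>)) x" using that by (auto simp: dist_norm)
      moreover have "integral (cbox (- (B + \<bar>r\<bar>)) x) (\<lambda>x. if x \<in> {r<..} then f x else 0) = integral {r..x} f"
      proof -
        have "{r<..} \<inter> cbox (- (B + \<bar>r\<bar>)) x = {r<..x}" using B(1) by auto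
        then have "integral (cbox (- (B + \<bar>r\<bar>)) x) (\<lambda>x. if x \<in> {r<..} then f x else 0) = integral {r<..x} f"
          unfolding integral_restrict_Int by simp
        also have "\<dots> = integral {r..x} f"
          by (rule integral_spike_set) (auto intro: negligible_subset[of "{r}"])
        finally show ?thesis .
      qed
      ultimately show ?thesis using B(2) by (metis dist_norm)
    qed
    then show "\<forall>\<^sub>F x in at_top. dist (integral {r..x} f) ?I < e"
      by (rule eventually_at_top_linorderI)
  qed
  then show ?thesis using infinite by simp
qed

section \<open>Integrals away from the origin\<close>

lemma inverse_power_to_end:
  assumes "0 < r" "ereal r < a"
  obtains l :: real where "0 \<le> l" "((\<lambda>x. 1 / x ^ Suc m) \<longlongrightarrow> l) (to_end a)"
  using assms(2)
proof (cases rule: ereal_less_cases)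
  case (real b)
  have "((\<lambda>x. 1 / x ^ Suc m) \<longlongrightarrow> 1 / b ^ Suc m) (at_left b)"
    using assms real by (intro tendsto_intros) auto
  then show ?thesis using assms real by (intro that[of "1 / b ^ Suc m"]) auto
next
  case infinite
  have "((\<lambda>x::real. 1 / x) \<longlongrightarrow> 0) at_top"
    by (rule tendsto_divide_0[OF tendsto_const filterlim_at_top_imp_at_infinity[OF filterlim_ident]])
  then have "((\<lambda>x::real. (1 / x) ^ Suc m) \<longlongrightarrow> 0 ^ Suc m) at_top"
    by (rule tendsto_power)
  then show ?thesis using infinite by (intro that[of 0]) (auto simp: power_one_over)
qed

lemma DERIV_one_over_power:
  fixes x :: "'a::real_normed_field"
  assumes "x \<noteq> 0"
  shows "((\<lambda>z. 1 / z ^ m) has_field_derivative - of_nat m / x ^ Suc m) (at x)"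
proof (induction m)
  case (Suc m)
  have "((\<lambda>z. 1 / z ^ m * inverse z) has_field_derivative
      - of_nat m / x ^ Suc m * inverse x + - (inverse x * 1 * inverse x) * (1 / x ^ m)) (at x)"
    by (intro DERIV_mult Suc DERIV_inverse' DERIV_ident assms)
  then show ?case using assms by (simp add: field_simps)
qed simp

text \<open>Integration by parts against the bounded primitive of \<open>F\<close>; only conditional
  convergence of the integral of \<open>F\<close> is available.\<close>

lemma integral_over_power_bound:
  fixes F :: "real \<Rightarrow> complex"
  assumes r: "0 < r" "ereal r < a" and cont: "continuous_on {t. r \<le> t \<and> ereal t < a} F"
    and int: "F integrable_on einterval (ereal r) a"
  obtains B where
    "\<And>m. (\<lambda>t. F t / of_real t ^ m) integrable_on einterval (ereal r) a"
    "\<And>m. norm (integral (einterval (ereal r) a) (\<lambda>t. F t / of_real t ^ m)) \<le> B / r ^ m"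
proof -
  define H where "H = (\<lambda>x. integral {r..x} F)"
  define I where "I = integral (einterval (ereal r) a) F"
  have contF: "continuous_on {r..y} F" if "ereal y < a" for y
    by (rule continuous_on_subset[OF cont]) (use that in \<open>auto intro: le_less_trans[of "ereal _" "ereal y"]\<close>)
  have contH: "continuous_on {r..y} H" if "ereal y < a" for y
    unfolding H_def by (intro indefinite_integral_continuous_1 integrable_continuous_interval contF that)
  have derH: "(H has_vector_derivative F x) (at x)" if x: "r < x" "ereal x < a" for x
  proof -
    obtain y where y: "x < y" "ereal y < a" using ereal_dense2[OF x(2)] by auto
    have "(H has_vector_derivative F x) (at x within {r..y})"
      unfolding H_def using x y by (intro integral_has_vector_derivative contF) auto
    then show ?thesis using x y by (simp add: at_within_Icc_at)
  qed
  have H0: "(H \<longlongrightarrow> 0) (at_right r)"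
  proof -
    obtain y where y: "r < y" "ereal y < a" using ereal_dense2[OF r(2)] by auto
    show ?thesis using continuous_on_Icc_at_rightD[OF contH[OF y(2)] y(1)] by (simp add: H_def)
  qed
  have HI: "(H \<longlongrightarrow> I) (to_end a)"
    unfolding H_def I_def by (rule tendsto_integral_to_end[OF r(2) int])
  obtain B where B: "\<And>x. r \<le> x \<Longrightarrow> ereal x < a \<Longrightarrow> norm (H x) \<le> B"
  proof -
    have "\<forall>\<^sub>F x in to_end a. norm (H x) < norm I + 1"
      using tendsto_norm[OF HI] by (rule order_tendstoD) simp
    then obtain b where b: "r < b" "ereal b < a" "\<And>x. b \<le> x \<Longrightarrow> ereal x < a \<Longrightarrow> norm (H x) < norm I + 1"
      using eventually_to_end[OF r(2)] by blast
    have "bounded (H ` {r..b})"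
      by (intro compact_imp_bounded compact_continuous_image contH b) auto
    then obtain B' where "\<And>x. x \<in> {r..b} \<Longrightarrow> norm (H x) \<le> B'"
      unfolding bounded_iff by blast
    then have "norm (H x) \<le> max B' (norm I + 1)" if "r \<le> x" "ereal x < a" for x
      using b(3)[of x] that by (cases "x \<le> b") (force simp: le_max_iff_disj)+
    then show ?thesis using that by blast
  qed
  have B0: "0 \<le> B" using B[of r] r norm_ge_zero order_trans by blast
  have evr: "\<forall>\<^sub>F x in to_end a. r < x \<and> ereal x < a" by (rule eventually_to_end_ge[OF r(2)])
  have IB: "norm I \<le> B"
    by (rule tendsto_upperbound[OF tendsto_norm[OF HI]])
       (use evr in \<open>auto elim!: eventually_mono intro: B\<close>)
  have main: "(\<lambda>t. F t / of_real t ^ m) integrable_on einterval (ereal r) a \<and>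
        norm (integral (einterval (ereal r) a) (\<lambda>t. F t / of_real t ^ m)) \<le> B / r ^ m" for m
  proof (cases m)
    case 0
    then show ?thesis using int IB by (simp add: I_def)
  next
    case (Suc m')
    obtain l :: real where l: "0 \<le> l" "((\<lambda>x. 1 / x ^ m) \<longlongrightarrow> l) (to_end a)"
      using inverse_power_to_end[OF r] Suc by metis
    define v where "v = (\<lambda>x. of_nat m * H x / of_real x ^ Suc m)"
    define g where "g = (\<lambda>x. B * (real m / x ^ Suc m))"
    let ?S = "einterval (ereal r) a"
    have "((\<lambda>x. H x * (1 / of_real x ^ m)) has_vector_derivative
            (H x * (- of_nat m / of_real x ^ Suc m) + F x * (1 / of_real x ^ m))) (at x)"
      if "r < x" "ereal x < a" for x
    proof (rule has_vector_derivative_mult[OF derH[OF that]])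
      have "((\<lambda>z. 1 / z ^ m) has_field_derivative - of_nat m / of_real x ^ Suc m) (at (of_real x :: complex))"
        using that r by (intro DERIV_one_over_power) auto
      then show "((\<lambda>x. 1 / of_real x ^ m) has_vector_derivative (- of_nat m / of_real x ^ Suc m :: complex)) (at x)"
        by (rule has_vector_derivative_real_field)
    qed
    moreover have "((\<lambda>x. H x * (1 / of_real x ^ m)) \<longlongrightarrow> 0 * (1 / of_real r ^ m)) (at_right r)"
      using r by (intro tendsto_intros H0) auto
    moreover have "((\<lambda>x. H x * (1 / of_real x ^ m)) \<longlongrightarrow> I * of_real l) (to_end a)"
      using tendsto_mult[OF HI tendsto_of_real[OF l(2)]] by simp
    ultimately have u: "((\<lambda>x. H x * (- of_nat m / of_real x ^ Suc m) + F x * (1 / of_real x ^ m)) has_integral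
        (I * of_real l - 0 * (1 / of_real r ^ m))) ?S"
      by (intro fundamental_theorem_of_calculus_improper[OF r(2)])
    have g: "(g has_integral (- B * l - (- B * (1 / r ^ m)))) ?S"
    proof (rule fundamental_theorem_of_calculus_improper[OF r(2)])
      show "((\<lambda>x. - B * (1 / x ^ m)) has_vector_derivative g x) (at x)" if "r < x" "ereal x < a" for x
        unfolding has_real_derivative_iff_has_vector_derivative[symmetric] g_def
        using DERIV_cmult[OF DERIV_one_over_power[of x m], of "-B"] that r by simp
      show "((\<lambda>x. - B * (1 / x ^ m)) \<longlongrightarrow> - B * (1 / r ^ m)) (at_right r)"
        using r by (intro tendsto_intros) auto
      show "((\<lambda>x. - B * (1 / x ^ m)) \<longlongrightarrow> - B * l) (to_end a)"
        by (intro tendsto_intros l)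
    qed
    have bound: "norm (v x) \<le> g x" if "x \<in> ?S" for x
    proof -
      have x: "r < x" "ereal x < a" using that by (auto simp: einterval_iff)
      have "norm (v x) = norm (H x) * (real m / x ^ Suc m)"
        using x r unfolding v_def norm_mult norm_divide norm_power norm_of_nat norm_of_real by simp
      also have "\<dots> \<le> g x"
        unfolding g_def using x r by (intro mult_right_mono B) auto
      finally show ?thesis .
    qed
    have "continuous_on ?S v"
      unfolding v_def
      using r derH by (intro continuous_intros continuous_at_imp_continuous_on ballI)
        (auto simp: einterval_iff intro: has_vector_derivative_continuous)
    then have v: "v integrable_on ?S"
      using bound by (rule continuous_bounded_imp_absolutely_integrable(2)[OF open_einterval _ has_integral_integrable[OF g]])
    have nv: "norm (integral ?S v) \<le> B / r ^ m - B * l"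
      using integral_norm_bound_integral[OF v has_integral_integrable[OF g] bound] integral_unique[OF g]
      by simp
    have F_eq: "F x / of_real x ^ m = (H x * (- of_nat m / of_real x ^ Suc m) + F x * (1 / of_real x ^ m)) + v x" for x
      by (simp add: v_def)
    have "((\<lambda>t. F t / of_real t ^ m) has_integral (I * of_real l - 0 * (1 / of_real r ^ m)) + integral ?S v) ?S"
      unfolding F_eq by (intro has_integral_add u integrable_integral v)
    then have fi: "((\<lambda>t. F t / of_real t ^ m) has_integral I * of_real l + integral ?S v) ?S" by simp
    have "norm (I * of_real l + integral ?S v) \<le> norm I * l + norm (integral ?S v)"
      using norm_triangle_ineq[of "I * of_real l" "integral ?S v"] l by (simp add: norm_mult)
    also have "\<dots> \<le> B * l + (B / r ^ m - B * l)"
      using IB nv l by (intro add_mono mult_right_mono) auto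
    finally show ?thesis using fi by (simp add: has_integral_integrable_integral)
  qed
  show ?thesis using main that by blast
qed

lemma stieltjes_tail_sums:
  fixes F :: "real \<Rightarrow> complex"
  assumes r: "0 < r" "ereal r < a" and cont: "continuous_on {t. r \<le> t \<and> ereal t < a} F"
    and int: "F integrable_on einterval (ereal r) a"
  shows "(\<lambda>t. F t * (\<omega>\<^sup>2 + of_real t ^ 2) / of_real t ^ (2 * s + 2)) integrable_on einterval (ereal r) a"
    and "norm \<omega> < r \<Longrightarrow> (\<lambda>s. (-1) ^ s * \<omega> ^ (2 * s) *
           integral (einterval (ereal r) a) (\<lambda>t. F t * (\<omega>\<^sup>2 + of_real t ^ 2) / of_real t ^ (2 * s + 2)))
         sums integral (einterval (ereal r) a) F"
proof -
  let ?S = "einterval (ereal r) a"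
  obtain B where B: "\<And>m. (\<lambda>t. F t / of_real t ^ m) integrable_on ?S"
    "\<And>m. norm (integral ?S (\<lambda>t. F t / of_real t ^ m)) \<le> B / r ^ m"
    using integral_over_power_bound[OF assms] by blast
  define J where "J = (\<lambda>m. integral ?S (\<lambda>t. F t / of_real t ^ m))"
  have eq: "\<omega>\<^sup>2 * (F t / of_real t ^ (2 * s + 2)) + F t / of_real t ^ (2 * s)
       = F t * (\<omega>\<^sup>2 + of_real t ^ 2) / of_real t ^ (2 * s + 2)" if "t \<in> ?S" for s t
  proof -
    have "of_real t \<noteq> (0 :: complex)" using that r by (auto simp: einterval_iff)
    then show ?thesis by (simp add: field_simps power2_eq_square)
  qed
  have hi: "((\<lambda>t. F t * (\<omega>\<^sup>2 + of_real t ^ 2) / of_real t ^ (2 * s + 2)) has_integral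
     \<omega>\<^sup>2 * J (2 * s + 2) + J (2 * s)) ?S" for s
  proof (rule has_integral_eq[OF eq])
    show "((\<lambda>t. \<omega>\<^sup>2 * (F t / of_real t ^ (2 * s + 2)) + F t / of_real t ^ (2 * s)) has_integral
       \<omega>\<^sup>2 * J (2 * s + 2) + J (2 * s)) ?S"
      unfolding J_def by (intro has_integral_add has_integral_mult_right integrable_integral B)
  qed
  then show "(\<lambda>t. F t * (\<omega>\<^sup>2 + of_real t ^ 2) / of_real t ^ (2 * s + 2)) integrable_on ?S"
    by blast
  assume \<omega>: "norm \<omega> < r"
  define b where "b = (\<lambda>s. (-1) ^ s * \<omega> ^ (2 * s) * J (2 * s))"
  have "b \<longlonglongrightarrow> 0"
  proof (rule Lim_null_comparison)
    have "norm (b s) \<le> B * ((norm \<omega> / r) ^ 2) ^ s" for s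
    proof -
      have "norm (b s) \<le> norm \<omega> ^ (2 * s) * (B / r ^ (2 * s))"
        using mult_left_mono[OF B(2)[of "2 * s"], of "norm \<omega> ^ (2 * s)"]
        by (simp add: b_def J_def norm_mult norm_power)
      then show ?thesis by (simp add: power_divide mult.commute flip: power_mult)
    qed
    then show "\<forall>\<^sub>F s in sequentially. norm (b s) \<le> B * ((norm \<omega> / r) ^ 2) ^ s" by simp
    have "(norm \<omega> / r) ^ 2 < 1" using \<omega> r by (simp add: power_less_one_iff)
    then have "(\<lambda>s. B * ((norm \<omega> / r) ^ 2) ^ s) \<longlonglongrightarrow> B * 0"
      by (intro tendsto_mult tendsto_const LIMSEQ_power_zero) auto
    then show "(\<lambda>s. B * ((norm \<omega> / r) ^ 2) ^ s) \<longlonglongrightarrow> 0" by simp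
  qed
  then have "(\<lambda>s. b s - b (Suc s)) sums (b 0 - 0)" by (rule telescope_sums')
  moreover have "b s - b (Suc s) = (-1) ^ s * \<omega> ^ (2 * s) *
           integral ?S (\<lambda>t. F t * (\<omega>\<^sup>2 + of_real t ^ 2) / of_real t ^ (2 * s + 2))" for s
    unfolding integral_unique[OF hi] by (simp add: b_def power_add power2_eq_square algebra_simps)
  ultimately show "(\<lambda>s. (-1) ^ s * \<omega> ^ (2 * s) *
           integral ?S (\<lambda>t. F t * (\<omega>\<^sup>2 + of_real t ^ 2) / of_real t ^ (2 * s + 2))) sums integral ?S F"
    by (simp add: b_def J_def)
qed

section \<open>The Stieltjes transform of a power\<close>

lemma contour_integral_linepath_translate:
  assumes "f contour_integrable_on linepath (a + c) (b + c)"
  shows "contour_integral (linepath (a + c) (b + c)) f = contour_integral (linepath a b) (\<lambda>z. f (z + c))"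
proof -
  have "linepath (a + c) (b + c) x = linepath a b x + c" for x
    by (simp add: linepath_def algebra_simps)
  then have "((\<lambda>z. f (z + c)) has_contour_integral contour_integral (linepath (a + c) (b + c)) f) (linepath a b)"
    using has_contour_integral_integral[OF assms] unfolding has_contour_integral_linepath by simp
  then show ?thesis by (metis contour_integral_unique)
qed

lemma cos_half_pi_neq_0:
  assumes "\<bar>Re \<nu>\<bar> < 1"
  shows "cos (of_real pi * \<nu> / 2) \<noteq> 0"
proof
  assume "cos (of_real pi * \<nu> / 2) = 0"
  then obtain n :: int where "of_real pi * \<nu> / 2 = of_real (of_int n * pi) + of_real pi / 2"
    unfolding cos_eq_0 by auto
  then have "of_real pi * \<nu> = of_real pi * of_int (2 * n + 1)"
    by (simp add: field_simps)
  then have "\<nu> = of_int (2 * n + 1)" by (metis mult_left_cancel of_real_eq_0_iff pi_neq_zero)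
  then have "\<bar>of_int (2 * n + 1) :: real\<bar> < 1" using assms by (simp only: complex_Re_of_int)
  then have "of_int \<bar>2 * n + 1\<bar> < (of_int 1 :: real)" by simp
  then show False unfolding of_int_less_iff by presburger
qed

text \<open>Projection of \<open>w\<^sup>2 + t\<^sup>2\<close> onto the direction of \<open>w\<close>.\<close>

lemma norm_square_plus_square_ge:
  fixes w :: complex and t :: real
  shows "Re w * ((norm w)\<^sup>2 + t\<^sup>2) \<le> norm w * norm (w\<^sup>2 + (of_real t)\<^sup>2)"
proof -
  have "Re (cnj w * (w\<^sup>2 + (of_real t)\<^sup>2)) = Re w * ((norm w)\<^sup>2 + t\<^sup>2)"
    unfolding cmod_power2 by (simp add: power2_eq_square algebra_simps)
  then show ?thesis
    using complex_Re_le_cmod[of "cnj w * (w\<^sup>2 + (of_real t)\<^sup>2)"] by (simp add: norm_mult)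
qed

lemma square_plus_square_neq_0:
  fixes w :: complex and t :: real
  assumes "0 < Re w"
  shows "w\<^sup>2 + (of_real t)\<^sup>2 \<noteq> 0"
proof -
  have "w \<noteq> 0" using assms by auto
  then have "0 < Re w * ((norm w)\<^sup>2 + t\<^sup>2)" using assms by (intro mult_pos_pos add_pos_nonneg) auto
  then show ?thesis using norm_square_plus_square_ge[of w t] by auto
qed

definition stieltjes_kernel :: "complex \<Rightarrow> nat \<Rightarrow> complex \<Rightarrow> real \<Rightarrow> complex" where
  "stieltjes_kernel \<nu> n w t = log_power (-\<nu>) n t / (w\<^sup>2 + (of_real t)\<^sup>2)"

lemma continuous_on_stieltjes_kernel:
  assumes "0 < Re w"
  shows "continuous_on {0<..} (stieltjes_kernel \<nu> n w)"
  unfolding stieltjes_kernel_def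
  by (intro continuous_intros) (use square_plus_square_neq_0[OF assms] in auto)

lemma norm_stieltjes_kernel_le:
  assumes "0 < Re w" "0 < t"
  shows "norm (stieltjes_kernel \<nu> n w t) \<le> norm w / Re w * (norm (log_power (-\<nu>) n t) / ((norm w)\<^sup>2 + t\<^sup>2))"
proof -
  have "w \<noteq> 0" using assms by auto
  then have p: "0 < (norm w)\<^sup>2 + t\<^sup>2" by (intro add_pos_nonneg) auto
  have "norm (log_power (-\<nu>) n t) * (Re w * ((norm w)\<^sup>2 + t\<^sup>2))
      \<le> norm (log_power (-\<nu>) n t) * (norm w * norm (w\<^sup>2 + (of_real t)\<^sup>2))"
    by (intro mult_left_mono norm_square_plus_square_ge) auto
  then show ?thesis
    using p assms square_plus_square_neq_0[OF assms(1), of t]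
    by (simp add: stieltjes_kernel_def norm_divide divide_simps mult_ac)
qed

lemma integrable_powr_over_square:
  fixes s W :: real
  assumes "\<bar>s\<bar> < 1" "0 < W"
  shows "(\<lambda>t. t powr (-s) / (W + t\<^sup>2)) integrable_on {0<..}"
proof -
  define g where "g = (\<lambda>t::real. if t \<le> 1 then t powr (-s) / W else t powr (-s - 2))"
  have "(\<lambda>t. t powr (-s) / W) integrable_on {0<..1}"
    unfolding divide_inverse
    by (intro integrable_on_mult_left integrable_on_powr_from_0') (use assms in auto)
  then have g1: "g integrable_on {0<..1}" by (rule integrable_eq) (auto simp: g_def)
  have "(\<lambda>t. t powr (-s - 2)) integrable_on {1..}"
    using has_integral_powr_to_inf[of "-s - 2" 1] assms unfolding integrable_on_def by (auto simp: abs_less_iff)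
  then have g2: "g integrable_on {1..}"
    by (rule integrable_spike_finite[of "{1}", rotated 2]) (auto simp: g_def)
  have "g integrable_on ({0<..1} \<union> {1..})"
    by (rule integrable_Un[OF _ g1 g2]) (auto intro: negligible_subset[of "{1}"])
  also have "{0<..1} \<union> {1..} = {0::real<..}" by auto
  finally have g: "g integrable_on {0<..}" .
  have bound: "norm (t powr (-s) / (W + t\<^sup>2)) \<le> g t" if "t \<in> {0<..}" for t
  proof (cases "t \<le> 1")
    case True
    then show ?thesis using assms by (auto simp: g_def intro!: divide_left_mono mult_pos_pos add_pos_nonneg)
  next
    case False
    then have "t powr (-s) / (W + t\<^sup>2) \<le> t powr (-s) / t\<^sup>2"
      using assms by (intro divide_left_mono mult_pos_pos add_pos_nonneg) auto
    also have "\<dots> = t powr (-s - 2)" using False by (simp add: powr_diff)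
    finally show ?thesis using assms False by (simp add: g_def)
  qed
  have "continuous_on {0<..} (\<lambda>t. t powr (-s) / (W + t\<^sup>2))"
  proof (intro continuous_intros ballI)
    fix t :: real assume "t \<in> {0<..}"
    then have "0 < W + t\<^sup>2" using assms by (intro add_pos_nonneg) auto
    then show "W + t\<^sup>2 \<noteq> 0" by simp
  qed auto
  then show ?thesis
    by (rule continuous_bounded_imp_absolutely_integrable(2)[OF open_greaterThan _ g bound])
qed

lemma absolutely_integrable_stieltjes_kernel:
  assumes "\<bar>Re \<nu>\<bar> < 1" "0 < Re w"
  shows "stieltjes_kernel \<nu> n w absolutely_integrable_on {0<..}"
proof -
  define \<eta> where "\<eta> = (1 - \<bar>Re \<nu>\<bar>) / 2"
  have \<eta>: "0 < \<eta>" "\<bar>Re \<nu> - \<eta>\<bar> < 1" "\<bar>Re \<nu> + \<eta>\<bar> < 1" using assms by (auto simp: \<eta>_def abs_if field_simps)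
  have w: "w \<noteq> 0" using assms by auto
  let ?W = "(norm w)\<^sup>2"
  let ?p = "\<lambda>s t. t powr (-s) / (?W + t\<^sup>2)"
  let ?g = "\<lambda>t. norm w / Re w * (fact n / \<eta> ^ n) * (?p (Re \<nu> - \<eta>) t + ?p (Re \<nu> + \<eta>) t)"
  have bound: "norm (stieltjes_kernel \<nu> n w t) \<le> ?g t" if "t \<in> {0<..}" for t
  proof -
    have p: "0 < ?W + t\<^sup>2" using w by (intro add_pos_nonneg) auto
    have "norm (stieltjes_kernel \<nu> n w t) \<le> norm w / Re w * (norm (log_power (-\<nu>) n t) / (?W + t\<^sup>2))"
      using that assms by (intro norm_stieltjes_kernel_le) auto
    also have "\<dots> \<le> norm w / Re w * ((fact n / \<eta> ^ n * (t powr (Re (-\<nu>) + \<eta>) + t powr (Re (-\<nu>) - \<eta>))) / (?W + t\<^sup>2))"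
      using that assms p \<eta>(1) by (intro mult_left_mono divide_right_mono norm_log_power_le) auto
    also have "Re (-\<nu>) + \<eta> = - (Re \<nu> - \<eta>)" by simp
    also have "Re (-\<nu>) - \<eta> = - (Re \<nu> + \<eta>)" by simp
    finally have "norm (stieltjes_kernel \<nu> n w t) \<le> norm w / Re w * (fact n / \<eta> ^ n * (t powr - (Re \<nu> - \<eta>) + t powr - (Re \<nu> + \<eta>)) / (?W + t\<^sup>2))" .
    also have "\<dots> = ?g t"
      by (simp only: times_divide_eq_right[symmetric] add_divide_distrib mult.assoc)
    finally show ?thesis .
  qed
  have "?g integrable_on {0<..}"
    using w \<eta> by (intro integrable_on_mult_right integrable_add integrable_powr_over_square) auto
  then show ?thesis
    by (rule continuous_bounded_imp_absolutely_integrable(1)[OF open_greaterThan continuous_on_stieltjes_kernel[OF assms(2)] _ bound])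
qed

lemma integral_exp_substitution:
  fixes f :: "real \<Rightarrow> complex"
  assumes f: "f absolutely_integrable_on {0<..}" "continuous_on {0<..} f"
  shows "(\<lambda>M::nat. integral {- real M..real M} (\<lambda>x. exp x *\<^sub>R f (exp x))) \<longlonglongrightarrow> integral {0<..} f"
proof -
  have int: "f integrable_on {0<..}" "(\<lambda>t. norm (f t)) integrable_on {0<..}"
    using f(1) by (auto simp: absolutely_integrable_on_def)
  define J where "J = (\<lambda>M::nat. {exp (- real M)..exp (real M)})"
  have J: "{0<..} \<inter> J M = J M" "J M \<inter> {0<..} = J M" "J M \<subseteq> {0<..}" for M
    unfolding J_def by (auto intro: less_le_trans[OF exp_gt_zero])
  have "(\<lambda>M. integral {0<..} (\<lambda>x. if x \<in> J M then f x else 0)) \<longlonglongrightarrow> integral {0<..} f"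
  proof (rule dominated_convergence(2)[of _ _ "\<lambda>t. norm (f t)"])
    show "(\<lambda>x. if x \<in> J M then f x else 0) integrable_on {0<..}" for M
      unfolding integrable_restrict_Int J
      using continuous_on_subset[OF f(2) J(3)] unfolding J_def by (rule integrable_continuous_interval)
    fix x :: real assume "x \<in> {0<..}"
    then have "\<forall>\<^sub>F M in sequentially. \<bar>ln x\<bar> \<le> real M"
      by (meson eventually_sequentiallyI nat_ceiling_le_eq)
    then have "\<forall>\<^sub>F M in sequentially. (if x \<in> J M then f x else 0) = f x"
    proof eventually_elim
      case (elim M)
      moreover obtain u where "x = exp u" using \<open>x \<in> {0<..}\<close> by (metis exp_ln greaterThan_iff)
      ultimately have "x \<in> J M" by (simp add: J_def abs_le_iff)
      then show ?case by simp
    qed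
    then show "(\<lambda>M. if x \<in> J M then f x else 0) \<longlonglongrightarrow> f x" by (rule tendsto_eventually)
  qed (use int in auto)
  moreover have "integral {0<..} (\<lambda>x. if x \<in> J M then f x else 0) = integral {- real M..real M} (\<lambda>x. exp x *\<^sub>R f (exp x))" for M
  proof -
    have "((\<lambda>x. exp x *\<^sub>R f (exp x)) has_integral integral {exp (- real M)..exp (real M)} f) {- real M..real M}"
    proof (rule has_integral_substitution[where c = "exp (- real M)" and d = "exp (real M)"])
      show "continuous_on {exp (- real M)..exp (real M)} f"
        using continuous_on_subset[OF f(2) J(3)] unfolding J_def .
    qed (auto intro!: derivative_eq_intros)
    then show ?thesis
      unfolding integral_restrict_Int J by (simp add: J_def integral_unique)
  qed
  ultimately show ?thesis by simp
qed

lemma exp_ratio_tendsto_0: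
  fixes p W :: real
  assumes "\<bar>p\<bar> < 1"
  shows "((\<lambda>M. exp ((1 - p) * M) / (exp (2 * M) - W)) \<longlongrightarrow> 0) at_top"
proof -
  have lim: "((\<lambda>M. exp (- (c * M))) \<longlongrightarrow> 0) at_top" if "0 < c" for c :: real
    by (intro filterlim_compose[OF exp_at_bot] filterlim_compose[OF filterlim_uminus_at_bot_at_top]
          filterlim_tendsto_pos_mult_at_top[OF tendsto_const that filterlim_ident])
  have "((\<lambda>M. exp (- ((1 + p) * M)) / (1 - W * exp (- (2 * M)))) \<longlongrightarrow> 0 / (1 - W * 0)) at_top"
    by (intro tendsto_divide tendsto_diff tendsto_mult tendsto_const lim) (use assms in auto)
  moreover have "exp (- ((1 + p) * M)) / (1 - W * exp (- (2 * M))) = exp ((1 - p) * M) / (exp (2 * M) - W)" for M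
  proof -
    have "exp (- ((1 + p) * M)) = exp ((1 - p) * M) * exp (- (2 * M))"
      by (simp add: algebra_simps flip: exp_add)
    moreover have "1 - W * exp (- (2 * M)) = (exp (2 * M) - W) * exp (- (2 * M))"
      by (simp add: algebra_simps flip: exp_add)
    ultimately show ?thesis by simp
  qed
  ultimately show ?thesis by simp
qed

text \<open>After \<open>t = exp x\<close> the integrand is multiplied by the constant \<open>exp (\<i> \<pi> (1 - \<nu>))\<close> when \<open>x\<close> is shifted
  by \<open>\<i> \<pi>\<close>, and a strip of that width contains the single pole \<open>Ln w + \<i> \<pi> / 2\<close>.\<close>

lemma integral_stieltjes_kernel_0:
  assumes \<nu>: "\<bar>Re \<nu>\<bar> < 1" and w: "0 < Re w"
  shows "integral {0<..} (stieltjes_kernel \<nu> 0 w) = of_real pi / (2 * w powr (\<nu> + 1)) * half_sec \<nu>"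
proof -
  have w0: "w \<noteq> 0" using w by auto
  define I where "I = integral {0<..} (stieltjes_kernel \<nu> 0 w)"
  define z0 where "z0 = Ln w + \<i> * of_real pi / 2"
  define f where "f = (\<lambda>z. exp ((1 - \<nu>) * z) / (w\<^sup>2 + exp (2 * z)))"
  have Imz0: "0 < Im z0" "Im z0 < pi"
    using w w0 Re_Ln_pos_lt[of w] by (auto simp: z0_def)
  have w2: "exp (2 * z0) = - w\<^sup>2"
  proof -
    have "exp (2 * z0) = exp (Ln w) ^ 2 * exp (\<i> * of_real pi)"
      by (simp add: z0_def algebra_simps exp_add flip: exp_double)
    then show ?thesis using w0 by (simp add: exp_Ln mult.commute[of \<i>])
  qed
  define S where "S = {z. Im z0 - pi < Im z \<and> Im z < Im z0 + pi}"
  have "S = {z. Im z0 - pi < Im z} \<inter> {z. Im z < Im z0 + pi}" by (auto simp: S_def)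
  then have S: "open S" "convex S" 
    by (auto intro!: open_Int convex_Int open_halfspace_Im_gt open_halfspace_Im_lt convex_halfspace_Im_gt convex_halfspace_Im_lt)
  have pole: "w\<^sup>2 + exp (2 * z) \<noteq> 0" if "z \<in> S - {z0}" for z
  proof
    assume "w\<^sup>2 + exp (2 * z) = 0"
    then have eq: "exp (2 * z) = exp (2 * z0)" using w2 by (simp add: add_eq_0_iff)
    have "\<bar>Im (2 * z) - Im (2 * z0)\<bar> < 2 * pi" using that by (auto simp: S_def)
    then have "2 * z = 2 * z0" by (rule exp_complex_eqI[OF _ eq])
    then show False using that by simp
  qed
  have holo: "f holomorphic_on S - {z0}"
    unfolding f_def by (intro holomorphic_intros) (use pole in auto)
  have res: "residue f z0 = exp ((1 - \<nu>) * z0) / (2 * exp (2 * z0))"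
    unfolding f_def
  proof (rule residue_simple_pole_deriv[where s = UNIV])
    show "((\<lambda>z. w\<^sup>2 + exp (2 * z)) has_field_derivative 2 * exp (2 * z0)) (at z0)"
      by (auto intro!: derivative_eq_intros)
  qed (use w0 in \<open>auto intro!: holomorphic_intros simp: w2\<close>)
  define E where "E = exp (\<i> * of_real pi * (1 - \<nu>))"
  have shift: "f (z + \<i> * of_real pi) = E * f z" for z
  proof -
    have "exp (2 * (z + \<i> * of_real pi)) = exp (2 * z) * exp (2 * of_real pi * \<i>)"
      unfolding exp_add[symmetric] by (rule arg_cong[of _ _ exp]) (simp add: algebra_simps)
    moreover have "exp ((1 - \<nu>) * (z + \<i> * of_real pi)) = E * exp ((1 - \<nu>) * z)"
      by (simp add: E_def algebra_simps flip: exp_add)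
    ultimately show ?thesis by (simp add: f_def)
  qed
  define A where "A = (\<lambda>M::nat. integral {- real M..real M} (\<lambda>x. f (of_real x)))"
  define K where "K = exp (pi * \<bar>Im \<nu>\<bar>)"
  define R where "R = (\<lambda>M. K * (exp ((1 - Re \<nu>) * real M) / (exp (2 * real M) - (norm w)\<^sup>2)) * pi)"
  define R' where "R' = (\<lambda>M. K * (exp (- ((1 - Re \<nu>) * real M)) / ((norm w)\<^sup>2 - exp (- (2 * real M)))) * pi)"
  have normf: "norm (exp ((1 - \<nu>) * z)) \<le> K * exp ((1 - Re \<nu>) * Re z)" if "0 \<le> Im z" "Im z \<le> pi" for z
  proof -
    have "Im \<nu> * Im z \<le> \<bar>Im \<nu>\<bar> * pi" using that by (intro mult_mono) auto
    then show ?thesis by (simp add: K_def algebra_simps flip: exp_add)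
  qed
  have key: "norm (A M * (1 - E) - 2 * of_real pi * \<i> * residue f z0) \<le> R M + R' M"
    if M: "real M > \<bar>Re z0\<bar>" "exp (2 * real M) > (norm w)\<^sup>2" "exp (- (2 * real M)) < (norm w)\<^sup>2" for M
  proof -
    define a1 a2 a3 a4 where "a1 = Complex (- real M) 0" and "a2 = Complex (real M) 0"
      and "a3 = Complex (real M) pi" and "a4 = Complex (- real M) pi"
    have M0: "real M > 0" using M(1) by linarith
    have img: "path_image (rectpath a1 a3) \<subseteq> S - {z0}"
      using M Imz0 M0 unfolding S_def
      by (subst path_image_rectpath) (auto simp: a1_def a3_def)
    have "contour_integral (rectpath a1 a3) f = of_real (2 * pi) * \<i> * (\<Sum>p\<in>{z0}. winding_number (rectpath a1 a3) p * residue f p)"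
    proof (rule Residue_theorem[OF S(1) _ _ holo])
      show "connected S" using S by (simp add: convex_connected)
      show "\<forall>z. z \<notin> S \<longrightarrow> winding_number (rectpath a1 a3) z = 0"
        using img S by (intro allI impI winding_number_zero_outside[of _ S]) auto
    qed (use img in auto)
    moreover have "winding_number (rectpath a1 a3) z0 = 1"
      using M Imz0 by (intro winding_number_rectpath) (auto simp: in_box_complex_iff a1_def a3_def)
    ultimately have full: "contour_integral (rectpath a1 a3) f = 2 * of_real pi * \<i> * residue f z0" by simp
    have rp: "rectpath a1 a3 = linepath a1 a2 +++ linepath a2 a3 +++ linepath a3 a4 +++ linepath a4 a1"
      unfolding rectpath_def Let_def by (simp add: a1_def a2_def a3_def a4_def)
    have sub: "closed_segment a1 a2 \<subseteq> S - {z0}" "closed_segment a2 a3 \<subseteq> S - {z0}"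
      "closed_segment a3 a4 \<subseteq> S - {z0}" "closed_segment a4 a1 \<subseteq> S - {z0}"
      using img unfolding rp by (auto simp: path_image_join)
    have ci: "f contour_integrable_on linepath a1 a2" "f contour_integrable_on linepath a2 a3"
      "f contour_integrable_on linepath a3 a4" "f contour_integrable_on linepath a4 a1"
      by (intro contour_integrable_continuous_linepath continuous_on_subset[OF holomorphic_on_imp_continuous_on[OF holo]] sub)+
    have sum4: "contour_integral (rectpath a1 a3) f = contour_integral (linepath a1 a2) f + contour_integral (linepath a2 a3) f
        + contour_integral (linepath a3 a4) f + contour_integral (linepath a4 a1) f"
      unfolding rp using ci by (simp add: contour_integrable_joinI)
    have bottom: "contour_integral (linepath a1 a2) f = A M"
      unfolding A_def using M0 contour_integral_linepath_Reals_eq[of a1 a2 f]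
      by (simp add: a1_def a2_def complex_is_Real_iff)
    have top: "contour_integral (linepath a3 a4) f = - E * A M"
    proof -
      have "a3 = a2 + \<i> * of_real pi" "a4 = a1 + \<i> * of_real pi"
        by (auto simp: a1_def a2_def a3_def a4_def complex_eq_iff)
      then have "contour_integral (linepath a3 a4) f = contour_integral (linepath a2 a1) (\<lambda>z. E * f z)"
        using contour_integral_linepath_translate ci(3) by (simp add: shift)
      also have "\<dots> = - contour_integral (linepath a1 a2) (\<lambda>z. E * f z)"
        by (intro contour_integral_reverse_linepath continuous_intros
             continuous_on_subset[OF holomorphic_on_imp_continuous_on[OF holo]])
           (use sub(1) in \<open>simp add: closed_segment_commute\<close>)
      also have "\<dots> = - (E * A M)"
        using ci(1) bottom by (simp add: contour_integral_lmul)
      finally show ?thesis by simp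
    qed
    have "norm (contour_integral (linepath a2 a3) f) \<le> K * (exp ((1 - Re \<nu>) * real M) / (exp (2 * real M) - (norm w)\<^sup>2)) * norm (a3 - a2)"
    proof (rule contour_integral_bound_linepath[OF ci(2)])
      fix z assume "z \<in> closed_segment a2 a3"
      then have z: "Re z = real M" "0 \<le> Im z" "Im z \<le> pi"
        by (auto simp: a2_def a3_def closed_segment_same_Re closed_segment_eq_real_ivl)
      have "exp (2 * real M) - (norm w)\<^sup>2 \<le> norm (w\<^sup>2 + exp (2 * z))"
        using norm_triangle_ineq2[of "exp (2 * z)" "- w\<^sup>2"] z by (simp add: norm_power add.commute)
      then show "norm (f z) \<le> K * (exp ((1 - Re \<nu>) * real M) / (exp (2 * real M) - (norm w)\<^sup>2))"
        unfolding f_def norm_divide times_divide_eq_right using normf[OF z(2,3)] z(1) M(2)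
        by (intro frac_le) (auto simp: K_def)
    qed (use M in \<open>auto simp: K_def\<close>)
    moreover have "norm (a3 - a2) = pi" by (simp add: a2_def a3_def complex_diff cmod_def)
    ultimately have right: "norm (contour_integral (linepath a2 a3) f) \<le> R M" by (simp add: R_def)
    have "norm (contour_integral (linepath a4 a1) f) \<le> K * (exp (- ((1 - Re \<nu>) * real M)) / ((norm w)\<^sup>2 - exp (- (2 * real M)))) * norm (a1 - a4)"
    proof (rule contour_integral_bound_linepath[OF ci(4)])
      fix z assume "z \<in> closed_segment a4 a1"
      then have z: "Re z = - real M" "0 \<le> Im z" "Im z \<le> pi"
        by (auto simp: a1_def a4_def closed_segment_same_Re closed_segment_eq_real_ivl split: if_splits)
      have "(norm w)\<^sup>2 - exp (- (2 * real M)) \<le> norm (w\<^sup>2 + exp (2 * z))"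
        using norm_triangle_ineq2[of "w\<^sup>2" "- exp (2 * z)"] z by (simp add: norm_power)
      then show "norm (f z) \<le> K * (exp (- ((1 - Re \<nu>) * real M)) / ((norm w)\<^sup>2 - exp (- (2 * real M))))"
        unfolding f_def norm_divide times_divide_eq_right using normf[OF z(2,3)] z(1) M(3)
        by (intro frac_le) (auto simp: K_def)
    qed (use M in \<open>auto simp: K_def\<close>)
    moreover have "norm (a1 - a4) = pi" by (simp add: a1_def a4_def complex_diff cmod_def)
    ultimately have left: "norm (contour_integral (linepath a4 a1) f) \<le> R' M" by (simp add: R'_def)
    have "A M * (1 - E) - 2 * of_real pi * \<i> * residue f z0
        = - (contour_integral (linepath a2 a3) f + contour_integral (linepath a4 a1) f)"
      unfolding full[symmetric] sum4 bottom top by (simp add: algebra_simps)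
    then have "norm (A M * (1 - E) - 2 * of_real pi * \<i> * residue f z0)
        = norm (contour_integral (linepath a2 a3) f + contour_integral (linepath a4 a1) f)"
      by (simp only: norm_minus_cancel)
    then show ?thesis
      using norm_triangle_ineq[of "contour_integral (linepath a2 a3) f" "contour_integral (linepath a4 a1) f"] left right
      by linarith
  qed
  have limR: "(\<lambda>M. R M + R' M) \<longlonglongrightarrow> 0"
  proof -
    have 1: "(\<lambda>M::nat. exp ((1 - Re \<nu>) * real M) / (exp (2 * real M) - (norm w)\<^sup>2)) \<longlonglongrightarrow> 0"
      using filterlim_compose[OF exp_ratio_tendsto_0[OF \<nu>] filterlim_real_sequentially] .
    have lim: "(\<lambda>M. exp (- (c * real M))) \<longlonglongrightarrow> 0" if "0 < c" for c :: real
      by (intro filterlim_compose[OF exp_at_bot] filterlim_compose[OF filterlim_uminus_at_bot_at_top]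
          filterlim_tendsto_pos_mult_at_top[OF tendsto_const that filterlim_real_sequentially])
    have 2: "(\<lambda>M::nat. exp (- ((1 - Re \<nu>) * real M)) / ((norm w)\<^sup>2 - exp (- (2 * real M)))) \<longlonglongrightarrow> 0 / ((norm w)\<^sup>2 - 0)"
      by (intro tendsto_divide tendsto_diff tendsto_const lim) (use \<nu> w0 in auto)
    have "(\<lambda>M. R M + R' M) \<longlonglongrightarrow> K * 0 * pi + K * (0 / ((norm w)\<^sup>2 - 0)) * pi"
      unfolding R_def R'_def by (intro tendsto_add tendsto_mult tendsto_const 1 2)
    then show ?thesis by simp
  qed
  have evM: "\<forall>\<^sub>F M in sequentially. real M > \<bar>Re z0\<bar> \<and> exp (2 * real M) > (norm w)\<^sup>2 \<and> exp (- (2 * real M)) < (norm w)\<^sup>2"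
  proof -
    define W where "W = (norm w)\<^sup>2"
    have W: "W > 0" using w0 by (simp add: W_def)
    have "\<forall>\<^sub>F M in sequentially. real M > max \<bar>Re z0\<bar> \<bar>ln W\<bar>"
      using filterlim_real_sequentially unfolding filterlim_at_top_dense by blast
    then show ?thesis unfolding W_def[symmetric]
    proof eventually_elim
      case (elim M)
      moreover obtain u where "W = exp u" using W by (metis exp_ln)
      ultimately show ?case by auto
    qed
  qed
  have "(\<lambda>M. A M * (1 - E) - 2 * of_real pi * \<i> * residue f z0) \<longlonglongrightarrow> 0"
    by (rule Lim_null_comparison[OF _ limR]) (use evM key in \<open>auto elim!: eventually_mono\<close>)
  moreover have "A \<longlonglongrightarrow> I"
  proof -
    have "exp x *\<^sub>R stieltjes_kernel \<nu> 0 w (exp x) = f (of_real x)" for x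
    proof -
      have "of_real (exp x) powr (-\<nu>) = exp (- \<nu> * of_real x)"
        by (simp add: powr_def Ln_of_real flip: exp_of_real)
      moreover have "(of_real (exp x))\<^sup>2 = exp (2 * of_real x :: complex)"
        by (simp add: exp_double exp_of_real)
      moreover have "exp ((1 - \<nu>) * of_real x) = of_real (exp x) * exp (- \<nu> * of_real x)"
        unfolding exp_of_real[symmetric] exp_add[symmetric] by (rule arg_cong[of _ _ exp]) (simp add: algebra_simps)
      ultimately show ?thesis
        unfolding f_def stieltjes_kernel_def log_power_def by (simp add: scaleR_conv_of_real)
    qed
    then show ?thesis
      unfolding A_def I_def
      using integral_exp_substitution[OF absolutely_integrable_stieltjes_kernel[OF \<nu> w] continuous_on_stieltjes_kernel[OF w], of 0]
      by simp
  qed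
  then have "(\<lambda>M. A M * (1 - E) - 2 * of_real pi * \<i> * residue f z0) \<longlonglongrightarrow> I * (1 - E) - 2 * of_real pi * \<i> * residue f z0"
    by (intro tendsto_intros)
  ultimately have eq: "I * (1 - E) = 2 * of_real pi * \<i> * residue f z0"
    using LIMSEQ_unique by fastforce
  define X where "X = of_real pi * \<nu> / 2"
  define q where "q = exp (- (\<i> * X))"
  have q2: "q\<^sup>2 = exp (- (\<i> * of_real pi * \<nu>))"
    unfolding q_def exp_double[symmetric] by (rule arg_cong[of _ _ exp]) (simp add: X_def)
  have "E = exp (of_real pi * \<i>) * exp (- (\<i> * of_real pi * \<nu>))"
    unfolding E_def exp_add[symmetric] by (rule arg_cong[of _ _ exp]) (simp add: algebra_simps)
  then have "1 - E = 1 + q\<^sup>2" by (simp add: q2)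
  moreover have "exp (\<i> * X) * q = 1" by (simp add: q_def flip: exp_add)
  moreover have "2 * cos X * q = exp (\<i> * X) * q + q\<^sup>2"
    by (simp add: cos_exp_eq q_def power2_eq_square distrib_right)
  ultimately have oneE: "1 - E = 2 * cos X * q" by simp
  have "2 * of_real pi * \<i> * residue f z0 = of_real pi * \<i> * exp ((1 - \<nu>) * z0 - 2 * z0)"
    by (simp add: res exp_diff)
  also have "(1 - \<nu>) * z0 - 2 * z0 = - ((\<nu> + 1) * Ln w) + (- (\<i> * X) + - (\<i> * of_real pi / 2))"
    by (simp add: z0_def X_def field_simps)
  also have "exp \<dots> = exp (- ((\<nu> + 1) * Ln w)) * (q * exp (- (\<i> * of_real pi / 2)))"
    unfolding q_def by (simp only: exp_add)
  also have "exp (- (\<i> * of_real pi / 2)) = - \<i>"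
  proof -
    have "exp (- (\<i> * of_real pi / 2)) = cis (- (pi / 2))"
      unfolding cis_conv_exp by (rule arg_cong[of _ _ exp]) simp
    then show ?thesis by (simp add: complex_eq_iff)
  qed
  also have "exp (- ((\<nu> + 1) * Ln w)) = 1 / w powr (\<nu> + 1)"
    using w0 by (simp add: powr_def exp_minus inverse_eq_divide)
  finally have "I * (2 * cos X) * q = of_real pi / w powr (\<nu> + 1) * q"
    using eq oneE by (simp add: mult_ac)
  moreover have "q \<noteq> 0" by (simp add: q_def)
  ultimately have "I * (2 * cos X) = of_real pi / w powr (\<nu> + 1)"
    using mult_right_cancel by blast
  then show ?thesis
    unfolding I_def[symmetric] half_sec_def X_def[symmetric]
    using cos_half_pi_neq_0[OF \<nu>, folded X_def] w0 by (simp add: field_simps)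
qed

lemma holomorphic_half_sec: "half_sec holomorphic_on {\<nu>. \<bar>Re \<nu>\<bar> < 1}"
  unfolding half_sec_def by (intro holomorphic_intros) (use cos_half_pi_neq_0 in auto)

lemma open_strip: "open {\<nu>::complex. \<bar>Re \<nu>\<bar> < 1}"
  by (intro open_Collect_less continuous_intros)

lemma higher_deriv_exp_affine:
  "(deriv ^^ n) (\<lambda>z::complex. exp (c * (z + b))) = (\<lambda>z. c ^ n * exp (c * (z + b)))"
proof (induction n)
  case (Suc n)
  have "deriv (\<lambda>z::complex. c ^ n * exp (c * (z + b))) z = c ^ Suc n * exp (c * (z + b))" for z
    by (intro DERIV_imp_deriv) (auto intro!: derivative_eq_intros)
  then show ?case by (simp add: Suc fun_eq_iff)
qed simp

lemma higher_deriv_kernel_value: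
  assumes \<nu>: "\<bar>Re \<nu>\<bar> < 1" and w: "w \<noteq> 0"
  shows "(-1) ^ n * (deriv ^^ n) (\<lambda>\<nu>. of_real pi / (2 * w powr (\<nu> + 1)) * half_sec \<nu>) \<nu> = Delta1 n \<nu> w"
proof -
  let ?c = "of_real pi / 2 :: complex"
  have powE: "exp (- Ln w * (\<nu> + 1)) = 1 / w powr (\<nu> + 1)" for \<nu>
  proof -
    have "exp (- Ln w * (\<nu> + 1)) = inverse (exp ((\<nu> + 1) * Ln w))"
      unfolding exp_minus[symmetric] by (rule arg_cong[of _ _ exp]) (simp add: mult.commute)
    then show ?thesis using w by (simp add: powr_def inverse_eq_divide)
  qed
  have pw: "of_real pi / (2 * w powr (\<nu> + 1)) * half_sec \<nu> = ?c * (half_sec \<nu> * exp (- Ln w * (\<nu> + 1)))" for \<nu>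
    unfolding powE by simp
  have holo: "(\<lambda>\<nu>. half_sec \<nu> * exp (- Ln w * (\<nu> + 1))) holomorphic_on {\<nu>. \<bar>Re \<nu>\<bar> < 1}"
    by (intro holomorphic_intros holomorphic_half_sec)
  have "(deriv ^^ n) (\<lambda>\<nu>. of_real pi / (2 * w powr (\<nu> + 1)) * half_sec \<nu>) \<nu>
      = (deriv ^^ n) (\<lambda>\<nu>. ?c * (half_sec \<nu> * exp (- Ln w * (\<nu> + 1)))) \<nu>"
    by (simp only: pw)
  also have "\<dots> = ?c * (deriv ^^ n) (\<lambda>\<nu>. half_sec \<nu> * exp (- Ln w * (\<nu> + 1))) \<nu>"
    by (rule higher_deriv_cmult[OF holo _ open_strip]) (use \<nu> in auto)
  also have "(deriv ^^ n) (\<lambda>\<nu>. half_sec \<nu> * exp (- Ln w * (\<nu> + 1))) \<nu>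
      = (\<Sum>i=0..n. of_nat (n choose i) * (deriv ^^ i) half_sec \<nu> * (deriv ^^ (n - i)) (\<lambda>\<nu>. exp (- Ln w * (\<nu> + 1))) \<nu>)"
    by (rule higher_deriv_mult[OF holomorphic_half_sec _ open_strip]) (use \<nu> in \<open>auto intro!: holomorphic_intros\<close>)
  also have "\<dots> = exp (- Ln w * (\<nu> + 1)) * (\<Sum>i=0..n. of_nat (n choose i) * (deriv ^^ i) half_sec \<nu> * (- Ln w) ^ (n - i))"
    unfolding higher_deriv_exp_affine by (simp add: sum_distrib_left mult_ac)
  finally have "(-1) ^ n * (deriv ^^ n) (\<lambda>\<nu>. of_real pi / (2 * w powr (\<nu> + 1)) * half_sec \<nu>) \<nu>
     = ?c * exp (- Ln w * (\<nu> + 1)) * (\<Sum>i=0..n. (-1) ^ n * (of_nat (n choose i) * (deriv ^^ i) half_sec \<nu> * (- Ln w) ^ (n - i)))"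
    by (simp add: sum_distrib_left mult_ac)
  also have "(\<Sum>i=0..n. (-1) ^ n * (of_nat (n choose i) * (deriv ^^ i) half_sec \<nu> * (- Ln w) ^ (n - i)))
     = (\<Sum>i=0..n. (-1) ^ i * of_nat (n choose i) * Ln w ^ (n - i) * (deriv ^^ i) half_sec \<nu>)"
  proof (rule sum.cong[OF refl])
    fix i assume "i \<in> {0..n}"
    then have n: "(-1) ^ n = (-1) ^ i * ((-1) ^ (n - i) :: complex)" by (simp flip: power_add)
    have neg: "(- Ln w) ^ (n - i) = (-1) ^ (n - i) * Ln w ^ (n - i)" by (rule power_minus)
    have sq: "(-1) ^ (n - i) * (-1) ^ (n - i) = (1 :: complex)" by (simp flip: power_mult_distrib)
    have "a * b * (c * d * (b * e)) = a * c * e * d" if "b * b = 1" for a b c d e :: complex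
      using that by algebra
    from this[OF sq] show "(-1) ^ n * (of_nat (n choose i) * (deriv ^^ i) half_sec \<nu> * (- Ln w) ^ (n - i))
       = (-1) ^ i * of_nat (n choose i) * Ln w ^ (n - i) * (deriv ^^ i) half_sec \<nu>"
      unfolding n neg .
  qed
  also have "?c * exp (- Ln w * (\<nu> + 1)) = of_real pi / (2 * w powr (\<nu> + 1))"
    unfolding powE by simp
  finally show ?thesis by (simp add: Delta1_def)
qed

text \<open>Expanding \<open>t powr (- h) = exp (- h * ln t)\<close> makes the integrals with powers of the logarithm
  the Taylor coefficients, in the exponent, of the integral without logarithm.\<close>

lemma stieltjes_kernel_sums:
  assumes \<nu>: "\<bar>Re \<nu>\<bar> < 1" and w: "0 < Re w" and h: "norm h < (1 - \<bar>Re \<nu>\<bar>) / 2"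
  shows "(\<lambda>n. (-1) ^ n * integral {0<..} (stieltjes_kernel \<nu> n w) / fact n * h ^ n) sums
           integral {0<..} (stieltjes_kernel (\<nu> + h) 0 w)"
proof -
  define f where "f = (\<lambda>n t. (-1) ^ n / fact n * h ^ n * stieltjes_kernel \<nu> n w t)"
  define H where "H = norm h"
  define G where "G = (\<lambda>t. norm w / Re w * (t powr - (Re \<nu> - H) / ((norm w)\<^sup>2 + t\<^sup>2) + t powr - (Re \<nu> + H) / ((norm w)\<^sup>2 + t\<^sup>2)))"
  have int: "stieltjes_kernel \<nu> n w integrable_on {0<..}" for n
    using absolutely_integrable_stieltjes_kernel[OF \<nu> w, of n] by (simp add: absolutely_integrable_on_def)
  have f_eq: "f n t = stieltjes_kernel \<nu> 0 w t * ((- h * of_real (ln t)) ^ n / fact n)" for n t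
  proof -
    have "(- h * of_real (ln t)) ^ n = ((-1) * h * of_real (ln t)) ^ n" by simp
    also have "\<dots> = (-1) ^ n * h ^ n * of_real (ln t) ^ n" by (simp only: power_mult_distrib)
    finally show ?thesis unfolding f_def stieltjes_kernel_def log_power_def by (simp add: mult_ac)
  qed
  have H: "0 \<le> H" "\<bar>Re \<nu> - H\<bar> < 1" "\<bar>Re \<nu> + H\<bar> < 1"
  proof -
    show H0: "0 \<le> H" by (simp add: H_def)
    have H1: "H < (1 - \<bar>Re \<nu>\<bar>) / 2" using h by (simp add: H_def)
    have "\<bar>x - H\<bar> < 1 \<and> \<bar>x + H\<bar> < 1" if "\<bar>x\<bar> < 1" "H < (1 - \<bar>x\<bar>) / 2" for x :: real
      using that H0 by (cases "0 \<le> x") (auto simp: abs_less_iff)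
    from this[OF \<nu> H1] show "\<bar>Re \<nu> - H\<bar> < 1" "\<bar>Re \<nu> + H\<bar> < 1" by auto
  qed
  have "w \<noteq> 0" using w by auto
  then have G: "G integrable_on {0<..}"
    unfolding G_def using H by (intro integrable_on_mult_right integrable_add integrable_powr_over_square) auto
  have bound: "norm (\<Sum>n<N. f n t) \<le> G t" if "t \<in> {0<..}" for N t
  proof -
    have t: "0 < t" using that by auto
    have "norm (\<Sum>n<N. f n t) \<le> (\<Sum>n<N. norm (stieltjes_kernel \<nu> 0 w t) * ((H * \<bar>ln t\<bar>) ^ n / fact n))"
      by (rule sum_norm_le) (simp add: f_eq norm_mult norm_power norm_divide H_def)
    also have "\<dots> = norm (stieltjes_kernel \<nu> 0 w t) * (\<Sum>n<N. (H * \<bar>ln t\<bar>) ^ n /\<^sub>R fact n)"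
      by (simp add: sum_distrib_left divide_inverse mult_ac)
    also have "\<dots> \<le> norm (stieltjes_kernel \<nu> 0 w t) * exp (H * \<bar>ln t\<bar>)"
      unfolding exp_def using H(1)
      by (intro mult_left_mono sum_le_suminf summable_exp_generic) auto
    also have "\<dots> \<le> norm (stieltjes_kernel \<nu> 0 w t) * (t powr H + t powr - H)"
      using t by (intro mult_left_mono) (auto simp: powr_def abs_if)
    also have "\<dots> \<le> norm w / Re w * (norm (log_power (-\<nu>) 0 t) / ((norm w)\<^sup>2 + t\<^sup>2)) * (t powr H + t powr - H)"
      by (intro mult_right_mono norm_stieltjes_kernel_le w t) auto
    also have "\<dots> = norm w / Re w * ((t powr (- Re \<nu> + H) + t powr (- Re \<nu> - H)) / ((norm w)\<^sup>2 + t\<^sup>2))"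
      using t by (simp add: norm_log_power powr_add powr_diff powr_minus divide_inverse algebra_simps)
    also have "\<dots> = G t" by (simp add: G_def add_divide_distrib)
    finally show ?thesis .
  qed
  have lim: "(\<lambda>N. \<Sum>n<N. f n t) \<longlonglongrightarrow> stieltjes_kernel (\<nu> + h) 0 w t" if "t \<in> {0<..}" for t
  proof -
    have "of_real t powr - (\<nu> + h) = of_real t powr (-\<nu>) * exp (- h * of_real (ln t))"
      using that by (simp add: powr_def Ln_of_real algebra_simps flip: exp_add)
    then have eq: "stieltjes_kernel (\<nu> + h) 0 w t = stieltjes_kernel \<nu> 0 w t * exp (- h * of_real (ln t))"
      by (simp add: stieltjes_kernel_def log_power_def)
    have "(\<lambda>n. (- h * of_real (ln t)) ^ n /\<^sub>R fact n) sums exp (- h * of_real (ln t))" by (rule exp_converges)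
    then have "(\<lambda>n. stieltjes_kernel \<nu> 0 w t * ((- h * of_real (ln t)) ^ n /\<^sub>R fact n)) sums stieltjes_kernel (\<nu> + h) 0 w t"
      unfolding eq by (rule sums_mult)
    then show ?thesis unfolding sums_def by (simp add: f_eq scaleR_conv_of_real divide_inverse mult_ac)
  qed
  have "(\<lambda>N. integral {0<..} (\<lambda>t. \<Sum>n<N. f n t)) \<longlonglongrightarrow> integral {0<..} (stieltjes_kernel (\<nu> + h) 0 w)"
    by (rule dominated_convergence(2)[OF _ G bound lim])
       (auto simp: f_def intro!: integrable_sum integrable_on_mult_right int)
  moreover have "integral {0<..} (\<lambda>t. \<Sum>n<N. f n t) = (\<Sum>n<N. (-1) ^ n * integral {0<..} (stieltjes_kernel \<nu> n w) / fact n * h ^ n)" for N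
    unfolding f_def by (subst integral_sum) (auto intro!: integrable_on_mult_right int sum.cong)
  ultimately show ?thesis by (simp add: sums_def)
qed

lemma integral_stieltjes_kernel:
  assumes \<nu>: "\<bar>Re \<nu>\<bar> < 1" and w: "0 < Re w"
  shows "integral {0<..} (stieltjes_kernel \<nu> n w) = Delta1 n \<nu> w"
proof -
  define \<delta> where "\<delta> = (1 - \<bar>Re \<nu>\<bar>) / 2"
  have \<delta>: "0 < \<delta>" using \<nu> by (simp add: \<delta>_def)
  define Q where "Q = (\<lambda>\<nu>. of_real pi / (2 * w powr (\<nu> + 1)) * half_sec \<nu>)"
  define F where "F = Abs_fps (\<lambda>n. (-1) ^ n * integral {0<..} (stieltjes_kernel \<nu> n w) / fact n)"
  have w0: "w \<noteq> 0" using w by auto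
  have sums: "(\<lambda>n. fps_nth F n * h ^ n) sums Q (\<nu> + h)" if "norm h < \<delta>" for h
  proof -
    have "\<bar>Re (\<nu> + h)\<bar> < 1" using that abs_Re_le_cmod[of h] by (auto simp: \<delta>_def)
    then show ?thesis
      using stieltjes_kernel_sums[OF \<nu> w, of h] that integral_stieltjes_kernel_0[of "\<nu> + h" w] w
      by (simp add: F_def Q_def \<delta>_def)
  qed
  have "norm (of_real (\<delta> / 2) :: complex) \<le> conv_radius (fps_nth F)"
    using sums[of "of_real (\<delta> / 2)"] \<delta> by (intro conv_radius_geI) (auto dest: sums_summable)
  then have rad: "0 < fps_conv_radius F"
    using \<delta> unfolding fps_conv_radius_def by (auto simp: zero_ereal_def intro: less_le_trans[of _ "ereal (\<delta> / 2)"])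
  have Q: "Q holomorphic_on {\<nu>. \<bar>Re \<nu>\<bar> < 1}"
    unfolding Q_def using w0 by (intro holomorphic_intros holomorphic_half_sec) auto
  have "fps_nth F n = (deriv ^^ n) (eval_fps F) 0 / fact n"
    by (rule fps_nth_conv_deriv[OF rad])
  also have "(deriv ^^ n) (eval_fps F) 0 = (deriv ^^ n) (\<lambda>h. Q (1 * h + \<nu>)) 0"
  proof (rule higher_deriv_cong_ev)
    have "\<forall>\<^sub>F h in nhds 0. h \<in> ball (0::complex) \<delta>" using \<delta> by (intro eventually_nhds_in_open) auto
    then show "\<forall>\<^sub>F h in nhds 0. eval_fps F h = Q (1 * h + \<nu>)"
    proof eventually_elim
      case (elim h)
      then show ?case using sums[of h] by (auto simp: eval_fps_def sums_iff add.commute)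
    qed
  qed simp
  also have "\<dots> = 1 ^ n * (deriv ^^ n) Q (1 * 0 + \<nu>)"
  proof (rule higher_deriv_compose_linear'[OF Q _ open_strip])
    show "open (ball (0::complex) \<delta>)" by simp
    show "1 * z + \<nu> \<in> {\<nu>. \<bar>Re \<nu>\<bar> < 1}" if "z \<in> ball 0 \<delta>" for z
      using that abs_Re_le_cmod[of z] by (auto simp: \<delta>_def)
  qed (use \<delta> in auto)
  finally have "(-1) ^ n * integral {0<..} (stieltjes_kernel \<nu> n w) = (deriv ^^ n) Q \<nu>"
    by (simp add: F_def)
  then have "(-1) ^ n * ((-1) ^ n * integral {0<..} (stieltjes_kernel \<nu> n w)) = Delta1 n \<nu> w"
    using higher_deriv_kernel_value[OF \<nu> w0, of n] by (simp add: Q_def)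
  then show ?thesis by (simp flip: mult.assoc power_mult_distrib)
qed

lemma Delta2_eq_Delta1:
  assumes "0 < Re \<nu>" "Re \<nu> < 1" "w \<noteq> 0"
  shows "w * Delta2 n \<nu> w = Delta1 n (\<nu> - 1) w"
proof -
  have "cos (of_real pi * (\<nu> - 1) / 2) \<noteq> 0" using assms by (intro cos_half_pi_neq_0) auto
  moreover have "half_csc \<nu> \<noteq> 0 \<longleftrightarrow> sin (of_real pi * \<nu> / 2) \<noteq> 0" by (simp add: half_csc_def)
  ultimately have "sin (of_real pi * \<nu> / 2) \<noteq> 0"
    unfolding half_csc_eq_half_sec half_sec_def by simp
  moreover have "w powr (\<nu> + 1) = w powr (\<nu> - 1 + 1) * w"
    using assms(3) by (simp add: powr_add)
  ultimately show ?thesis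
    unfolding Delta2_def Delta1_def using assms(3) by (simp add: higher_deriv_half_csc)
qed

section \<open>Taylor series near the origin\<close>

lemma absolutely_integrable_log_power:
  assumes "-1 < Re \<alpha>" "0 < r"
  shows "log_power \<alpha> n absolutely_integrable_on {0<..<r}"
proof -
  define \<eta> where "\<eta> = (Re \<alpha> + 1) / 2"
  have \<eta>: "0 < \<eta>" "-1 < Re \<alpha> + \<eta>" "-1 < Re \<alpha> - \<eta>" using assms by (auto simp: \<eta>_def field_simps)
  have pw: "(\<lambda>t. t powr s) integrable_on {0<..<r}" if "-1 < s" for s
    using integrable_on_powr_from_0[OF that, of r] assms(2) integrable_on_Icc_iff_Ioo by auto
  have int: "(\<lambda>t. fact n / \<eta> ^ n * (t powr (Re \<alpha> + \<eta>) + t powr (Re \<alpha> - \<eta>))) integrable_on {0<..<r}"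
    by (intro integrable_on_mult_right integrable_add pw \<eta>)
  show ?thesis
  proof (rule continuous_bounded_imp_absolutely_integrable(1)[OF _ _ int])
    show "continuous_on {0<..<r} (log_power \<alpha> n)"
      by (rule continuous_on_subset[OF continuous_on_log_power]) auto
    show "norm (log_power \<alpha> n t) \<le> fact n / \<eta> ^ n * (t powr (Re \<alpha> + \<eta>) + t powr (Re \<alpha> - \<eta>))"
      if "t \<in> {0<..<r}" for t
      using that \<eta> by (intro norm_log_power_le) auto
  qed simp
qed

lemma log_power_primitive_isCont:
  assumes "0 < t" "\<alpha> \<noteq> -1"
  shows "isCont (log_power_primitive \<alpha> n) t"
  using has_vector_derivative_continuous[OF has_vector_derivative_log_power_primitive[OF assms]] .

lemma has_integral_log_power:
  assumes "-1 < Re \<alpha>" "0 < r"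
  shows "(log_power \<alpha> n has_integral log_power_primitive \<alpha> n r) {0<..<r}"
proof -
  have nz: "\<alpha> \<noteq> -1" using assms by auto
  have "(log_power \<alpha> n has_integral (log_power_primitive \<alpha> n r - 0)) (einterval (ereal 0) (ereal r))"
  proof (rule fundamental_theorem_of_calculus_improper)
    show "(log_power_primitive \<alpha> n \<longlongrightarrow> log_power_primitive \<alpha> n r) (to_end (ereal r))"
      using log_power_primitive_isCont[OF assms(2) nz, of n]
      by (auto simp: isCont_def intro: tendsto_within_subset)
  qed (use assms nz in \<open>auto intro: has_vector_derivative_log_power_primitive log_power_primitive_tendsto_0\<close>)
  then show ?thesis by simp
qed

lemma has_integral_log_power_at_top:
  assumes "Re \<alpha> < -1" "0 < r"
  shows "(log_power \<alpha> n has_integral - log_power_primitive \<alpha> n r) {r<..}"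
proof -
  have nz: "\<alpha> \<noteq> -1" using assms by auto
  have "(log_power \<alpha> n has_integral (0 - log_power_primitive \<alpha> n r)) (einterval (ereal r) \<infinity>)"
  proof (rule fundamental_theorem_of_calculus_improper)
    show "(log_power_primitive \<alpha> n \<longlongrightarrow> log_power_primitive \<alpha> n r) (at_right r)"
      using log_power_primitive_isCont[OF assms(2) nz, of n]
      by (auto simp: isCont_def intro: tendsto_within_subset)
  qed (use assms nz in \<open>auto intro: has_vector_derivative_log_power_primitive log_power_primitive_tendsto_0_at_top\<close>)
  then show ?thesis by simp
qed

lemma has_integral_log_power_Icc:
  assumes "\<alpha> \<noteq> -1" "0 < \<epsilon>" "\<epsilon> \<le> r"
  shows "(log_power \<alpha> n has_integral (log_power_primitive \<alpha> n r - log_power_primitive \<alpha> n \<epsilon>)) {\<epsilon>..r}"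
  by (rule fundamental_theorem_of_calculus)
     (use assms in \<open>auto intro!: has_vector_derivative_at_within[OF has_vector_derivative_log_power_primitive]\<close>)

lemma power_series_integral_sums:
  fixes \<phi> :: "real \<Rightarrow> complex"
  assumes r: "0 < r" and c: "summable (\<lambda>m. norm (c m) * r ^ m)"
    and \<phi>: "\<phi> absolutely_integrable_on {0<..<r}" "continuous_on {0<..<r} \<phi>"
  shows "(\<lambda>t. (\<Sum>m. c m * of_real t ^ m) * \<phi> t) integrable_on {0<..<r}"
    and "(\<lambda>m. c m * integral {0<..<r} (\<lambda>t. of_real t ^ m * \<phi> t)) sums
           integral {0<..<r} (\<lambda>t. (\<Sum>m. c m * of_real t ^ m) * \<phi> t)"
proof -
  let ?S = "{0<..<r}"
  define A where "A = (\<Sum>m. norm (c m) * r ^ m)"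
  have n\<phi>: "(\<lambda>t. norm (\<phi> t)) integrable_on ?S"
    using \<phi>(1) by (simp add: absolutely_integrable_on_def)
  have int: "(\<lambda>t. of_real t ^ m * \<phi> t) integrable_on ?S" for m
  proof (rule continuous_bounded_imp_absolutely_integrable(2)[of _ _ "\<lambda>t. r ^ m * norm (\<phi> t)"])
    show "(\<lambda>t. r ^ m * norm (\<phi> t)) integrable_on ?S"
      by (intro integrable_on_mult_right n\<phi>)
    show "norm (of_real t ^ m * \<phi> t) \<le> r ^ m * norm (\<phi> t)" if "t \<in> ?S" for t
      unfolding norm_mult norm_power using that by (intro mult_right_mono power_mono) auto
  qed (auto intro!: continuous_intros \<phi>)
  let ?f = "\<lambda>N t. \<Sum>m<N. c m * (of_real t ^ m * \<phi> t)"
  have bound: "norm (?f N t) \<le> A * norm (\<phi> t)" if "t \<in> ?S" for N t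
  proof -
    have "norm (?f N t) \<le> (\<Sum>m<N. norm (c m) * r ^ m * norm (\<phi> t))"
    proof (rule sum_norm_le)
      fix m
      have "t ^ m \<le> r ^ m" using that by (intro power_mono) auto
      then show "norm (c m * (of_real t ^ m * \<phi> t)) \<le> norm (c m) * r ^ m * norm (\<phi> t)"
        using that by (simp add: norm_mult norm_power mult.assoc mult_left_mono mult_right_mono)
    qed
    also have "\<dots> = (\<Sum>m<N. norm (c m) * r ^ m) * norm (\<phi> t)" by (simp add: sum_distrib_right)
    also have "\<dots> \<le> A * norm (\<phi> t)"
      unfolding A_def using r by (intro mult_right_mono sum_le_suminf c) auto
    finally show ?thesis .
  qed
  have lim: "(\<lambda>N. ?f N t) \<longlonglongrightarrow> (\<Sum>m. c m * of_real t ^ m) * \<phi> t" if "t \<in> ?S" for t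
  proof -
    have "summable (\<lambda>m. norm (c m * of_real t ^ m))"
    proof (rule summable_comparison_test'[OF c, of 0])
      show "norm (norm (c m * of_real t ^ m)) \<le> norm (c m) * r ^ m" for m
        using that by (simp add: norm_mult norm_power mult_left_mono power_mono)
    qed
    then have "(\<lambda>m. c m * of_real t ^ m) sums (\<Sum>m. c m * of_real t ^ m)"
      by (intro summable_sums) (rule summable_norm_cancel)
    from sums_mult2[OF this, of "\<phi> t"] show ?thesis by (simp add: sums_def mult.assoc)
  qed
  have intf: "?f N integrable_on ?S" for N
    by (intro integrable_sum integrable_on_mult_right int) auto
  have intA: "(\<lambda>t. A * norm (\<phi> t)) integrable_on ?S" by (intro integrable_on_mult_right n\<phi>)
  show "(\<lambda>t. (\<Sum>m. c m * of_real t ^ m) * \<phi> t) integrable_on ?S"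
    by (rule dominated_convergence(1)[OF intf intA bound lim])
  have "(\<lambda>N. integral ?S (?f N)) \<longlonglongrightarrow> integral ?S (\<lambda>t. (\<Sum>m. c m * of_real t ^ m) * \<phi> t)"
    by (rule dominated_convergence(2)[OF intf intA bound lim])
  moreover have "integral ?S (?f N) = (\<Sum>m<N. c m * integral ?S (\<lambda>t. of_real t ^ m * \<phi> t))" for N
    by (subst integral_sum) (auto intro!: integrable_on_mult_right int)
  ultimately show "(\<lambda>m. c m * integral ?S (\<lambda>t. of_real t ^ m * \<phi> t)) sums
           integral ?S (\<lambda>t. (\<Sum>m. c m * of_real t ^ m) * \<phi> t)"
    by (simp add: sums_def)
qed

locale stieltjes_disc =
  fixes \<nu> w :: complex and n :: nat and r :: real
  assumes \<nu>: "0 < Re \<nu>" "Re \<nu> < 1" and w: "0 < Re w" and wr: "norm w < r"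
begin

lemma r_pos: "0 < r"
  using wr norm_ge_zero[of w] by linarith

definition near_integral :: "nat \<Rightarrow> complex" where
  "near_integral m = integral {0<..<r} (\<lambda>t. of_real t ^ m * stieltjes_kernel \<nu> n w t)"

definition near_term :: "nat \<Rightarrow> nat \<Rightarrow> complex" where
  "near_term m s = (-1) ^ s * w ^ (2 * s) * log_power_primitive (of_nat m - \<nu> - 2 * of_nat s - 2) n r"

text \<open>The exponents stay at distance at least \<open>min (Re \<nu>) (1 - Re \<nu>)\<close> from \<open>-1\<close>.\<close>

lemma norm_near_term_le:
  obtains B where "0 \<le> B" "\<And>m s. norm (near_term m s) \<le> B * r ^ m * ((norm w / r)\<^sup>2) ^ s"
proof -
  define \<delta> where "\<delta> = min (Re \<nu>) (1 - Re \<nu>)"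
  have \<delta>: "0 < \<delta>" using \<nu> by (simp add: \<delta>_def)
  obtain B where B: "0 \<le> B" "\<And>\<alpha>. \<delta> \<le> norm (\<alpha> + 1) \<Longrightarrow> norm (log_power_primitive \<alpha> n r) \<le> B * r powr Re \<alpha>"
    using norm_log_power_primitive_le[OF r_pos \<delta>] by blast
  have "norm (near_term m s) \<le> B * r powr (- Re \<nu> - 2) * r ^ m * ((norm w / r)\<^sup>2) ^ s" for m s
  proof -
    let ?\<alpha> = "of_nat m - \<nu> - 2 * of_nat s - 2"
    define z :: int where "z = int m - 2 * int s - 1"
    have "\<bar>of_int z - Re \<nu>\<bar> \<ge> \<delta>"
    proof (cases "z \<le> 0")
      case True
      then have "of_int z \<le> (0::real)" by simp
      then show ?thesis using \<nu> by (simp add: \<delta>_def)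
    next
      case False
      then have "1 \<le> z" by simp
      then have "1 \<le> (of_int z::real)" by linarith
      then show ?thesis using \<nu> by (simp add: \<delta>_def)
    qed
    moreover have "Re (?\<alpha> + 1) = of_int z - Re \<nu>" by (simp add: z_def)
    ultimately have "\<delta> \<le> norm (?\<alpha> + 1)" using abs_Re_le_cmod[of "?\<alpha> + 1"] by linarith
    from B(2)[OF this] have "norm (near_term m s) \<le> norm w ^ (2 * s) * (B * r powr Re ?\<alpha>)"
      unfolding near_term_def norm_mult norm_power by (simp add: mult_left_mono)
    also have "r powr Re ?\<alpha> = r powr (- Re \<nu> - 2) * r ^ m / r ^ (2 * s)"
    proof -
      have "Re ?\<alpha> = (- Re \<nu> - 2) + real m - real (2 * s)" by simp
      then show ?thesis using r_pos by (simp only: powr_diff powr_add powr_realpow)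
    qed
    also have "norm w ^ (2 * s) * (B * (r powr (- Re \<nu> - 2) * r ^ m / r ^ (2 * s)))
        = B * r powr (- Re \<nu> - 2) * r ^ m * ((norm w / r)\<^sup>2) ^ s"
      by (simp add: power_divide mult_ac flip: power_mult)
    finally show ?thesis .
  qed
  then show ?thesis using B(1) by (intro that[of "B * r powr (- Re \<nu> - 2)"]) auto
qed

lemma ratio: "0 \<le> (norm w / r)\<^sup>2" "(norm w / r)\<^sup>2 < 1"
  using wr r_pos by (auto simp: power_less_one_iff)

lemma summable_near_term: "summable (near_term m)"
proof -
  obtain B where B: "\<And>m s. norm (near_term m s) \<le> B * r ^ m * ((norm w / r)\<^sup>2) ^ s"
    using norm_near_term_le by blast
  show ?thesis
    by (rule summable_comparison_test'[of "\<lambda>s. B * r ^ m * ((norm w / r)\<^sup>2) ^ s" 0])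
       (use ratio B in \<open>auto intro!: summable_mult summable_geometric\<close>)
qed

lemma suminf_near_term_rec:
  "suminf (near_term (m + 2)) + w\<^sup>2 * suminf (near_term m) = log_power_primitive (of_nat m - \<nu>) n r"
proof -
  have "near_term (m + 2) (Suc s) = - w\<^sup>2 * near_term m s" for s
    by (simp add: near_term_def power_add power2_eq_square algebra_simps)
  then have "(\<Sum>s. near_term (m + 2) (Suc s)) = - w\<^sup>2 * suminf (near_term m)"
    using suminf_mult[OF summable_near_term[of m], of "- w\<^sup>2"] by simp
  moreover have "(\<Sum>s. near_term (m + 2) (Suc s)) = suminf (near_term (m + 2)) - near_term (m + 2) 0"
    using suminf_split_head[OF summable_near_term] by simp
  moreover have "near_term (m + 2) 0 = log_power_primitive (of_nat m - \<nu>) n r"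
    by (simp add: near_term_def)
  ultimately show ?thesis by (simp add: algebra_simps)
qed

lemma kernel_shift: "0 < t \<Longrightarrow> of_real t * stieltjes_kernel \<nu> n w t = stieltjes_kernel (\<nu> - 1) n w t"
  using log_power_add[of t "-\<nu>" 1 n] by (simp add: stieltjes_kernel_def algebra_simps)

lemma kernel_on_disc:
  "stieltjes_kernel \<nu> n w absolutely_integrable_on {0<..<r}" "continuous_on {0<..<r} (stieltjes_kernel \<nu> n w)"
proof -
  show "stieltjes_kernel \<nu> n w absolutely_integrable_on {0<..<r}"
    by (rule set_integrable_subset[OF absolutely_integrable_stieltjes_kernel[of \<nu> w n]]) (use \<nu> w in auto)
  show "continuous_on {0<..<r} (stieltjes_kernel \<nu> n w)"
    by (rule continuous_on_subset[OF continuous_on_stieltjes_kernel[OF w]]) auto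
qed

lemma integrable_power_kernel: "(\<lambda>t. of_real t ^ m * stieltjes_kernel \<nu> n w t) integrable_on {0<..<r}"
proof -
  let ?c = "\<lambda>i. if i = m then 1 else 0 :: complex"
  have "summable (\<lambda>i. norm (?c i) * r ^ i)"
    by (rule summable_finite[of "{m}"]) auto
  from power_series_integral_sums(1)[OF r_pos this kernel_on_disc]
  have "(\<lambda>t. (\<Sum>i. ?c i * of_real t ^ i) * stieltjes_kernel \<nu> n w t) integrable_on {0<..<r}" .
  moreover have "(\<Sum>i. ?c i * of_real t ^ i) = (of_real t ^ m :: complex)" for t
    using suminf_finite[of "{m}" "\<lambda>i. ?c i * of_real t ^ i"] by simp
  ultimately show ?thesis by simp
qed

lemma near_integral_rec:
  "near_integral (m + 2) + w\<^sup>2 * near_integral m = log_power_primitive (of_nat m - \<nu>) n r"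
proof -
  have "near_integral (m + 2) + w\<^sup>2 * near_integral m
      = integral {0<..<r} (\<lambda>t. of_real t ^ (m + 2) * stieltjes_kernel \<nu> n w t + w\<^sup>2 * (of_real t ^ m * stieltjes_kernel \<nu> n w t))"
    unfolding near_integral_def
    by (subst integral_add) (auto intro!: integrable_on_mult_right integrable_power_kernel[of "Suc (Suc m)", simplified] integrable_power_kernel)
  also have "\<dots> = integral {0<..<r} (log_power (of_nat m - \<nu>) n)"
  proof (rule integral_cong)
    fix t assume "t \<in> {0<..<r}"
    then have lp: "log_power (- \<nu> + of_nat m) n t = log_power (- \<nu>) n t * of_real t ^ m"
      by (intro log_power_add) auto
    have nz: "w\<^sup>2 + (of_real t)\<^sup>2 \<noteq> 0" by (rule square_plus_square_neq_0[OF w])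
    have "of_real t ^ (m + 2) * (L / D) + w\<^sup>2 * (of_real t ^ m * (L / D))
        = L * of_real t ^ m * ((w\<^sup>2 + (of_real t)\<^sup>2) / D)" for L D
      by (simp add: add_divide_distrib algebra_simps power_add power2_eq_square)
    then have "of_real t ^ (m + 2) * stieltjes_kernel \<nu> n w t + w\<^sup>2 * (of_real t ^ m * stieltjes_kernel \<nu> n w t)
        = log_power (- \<nu>) n t * of_real t ^ m * ((w\<^sup>2 + (of_real t)\<^sup>2) / (w\<^sup>2 + (of_real t)\<^sup>2))"
      unfolding stieltjes_kernel_def .
    also have "\<dots> = log_power (- \<nu> + of_nat m) n t"
      unfolding lp divide_self[OF nz] by (rule mult_1_right)
    also have "- \<nu> + of_nat m = of_nat m - \<nu>" by simp
    finally show "of_real t ^ (m + 2) * stieltjes_kernel \<nu> n w t + w\<^sup>2 * (of_real t ^ m * stieltjes_kernel \<nu> n w t)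
        = log_power (of_nat m - \<nu>) n t" .
  qed
  also have "\<dots> = log_power_primitive (of_nat m - \<nu>) n r"
    by (rule integral_unique[OF has_integral_log_power]) (use \<nu> r_pos in auto)
  finally show ?thesis .
qed

lemma kernel_defect:
  assumes "\<bar>Re \<mu>\<bar> < 1"
  shows "integral {0<..<r} (stieltjes_kernel \<mu> n w)
     - (\<Sum>s. (-1) ^ s * w ^ (2 * s) * log_power_primitive (- \<mu> - 2 * of_nat s - 2) n r) = Delta1 n \<mu> w"
proof -
  have absint: "stieltjes_kernel \<mu> n w absolutely_integrable_on {0<..}"
    by (rule absolutely_integrable_stieltjes_kernel[OF assms w])
  have int1: "stieltjes_kernel \<mu> n w integrable_on {0<..<r}" and int2: "stieltjes_kernel \<mu> n w integrable_on {r<..}"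
  proof -
    have "{0<..<r} \<subseteq> {0<..}" "{r<..} \<subseteq> {0<..}" using r_pos by auto
    then have "stieltjes_kernel \<mu> n w absolutely_integrable_on {0<..<r}" "stieltjes_kernel \<mu> n w absolutely_integrable_on {r<..}"
      by (auto intro: set_integrable_subset[OF absint])
    then show "stieltjes_kernel \<mu> n w integrable_on {0<..<r}" "stieltjes_kernel \<mu> n w integrable_on {r<..}"
      by (auto simp: absolutely_integrable_on_def)
  qed
  have cont: "continuous_on {t. r \<le> t \<and> ereal t < \<infinity>} (stieltjes_kernel \<mu> n w)"
    by (rule continuous_on_subset[OF continuous_on_stieltjes_kernel[OF w]]) (use r_pos in auto)
  have "(\<lambda>s. (-1) ^ s * w ^ (2 * s) *
           integral {r<..} (\<lambda>t. stieltjes_kernel \<mu> n w t * (w\<^sup>2 + of_real t ^ 2) / of_real t ^ (2 * s + 2)))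
         sums integral {r<..} (stieltjes_kernel \<mu> n w)"
    using stieltjes_tail_sums(2)[OF r_pos _ cont _ wr] int2 by simp
  moreover have "integral {r<..} (\<lambda>t. stieltjes_kernel \<mu> n w t * (w\<^sup>2 + of_real t ^ 2) / of_real t ^ (2 * s + 2))
      = - log_power_primitive (- \<mu> - 2 * of_nat s - 2) n r" for s
  proof -
    have "integral {r<..} (\<lambda>t. stieltjes_kernel \<mu> n w t * (w\<^sup>2 + of_real t ^ 2) / of_real t ^ (2 * s + 2))
        = integral {r<..} (log_power (- \<mu> - 2 * of_nat s - 2) n)"
    proof (rule integral_cong)
      fix t assume "t \<in> {r<..}"
      then have t: "0 < t" using r_pos by auto
      have "log_power (- \<mu> - 2 * of_nat s - 2 + of_nat (2 * s + 2)) n t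
          = log_power (- \<mu> - 2 * of_nat s - 2) n t * of_real t ^ (2 * s + 2)"
        by (rule log_power_add[OF t])
      then have "log_power (- \<mu>) n t = log_power (- \<mu> - 2 * of_nat s - 2) n t * of_real t ^ (2 * s + 2)" by simp
      then show "stieltjes_kernel \<mu> n w t * (w\<^sup>2 + of_real t ^ 2) / of_real t ^ (2 * s + 2)
          = log_power (- \<mu> - 2 * of_nat s - 2) n t"
        unfolding stieltjes_kernel_def using t square_plus_square_neq_0[OF w, of t] by simp
    qed
    also have "\<dots> = - log_power_primitive (- \<mu> - 2 * of_nat s - 2) n r"
      by (rule integral_unique[OF has_integral_log_power_at_top]) (use assms r_pos in auto)
    finally show ?thesis .
  qed
  ultimately have "(\<lambda>s. - ((-1) ^ s * w ^ (2 * s) * log_power_primitive (- \<mu> - 2 * of_nat s - 2) n r))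
      sums integral {r<..} (stieltjes_kernel \<mu> n w)" by simp
  from sums_minus[OF this] have "(\<Sum>s. (-1) ^ s * w ^ (2 * s) * log_power_primitive (- \<mu> - 2 * of_nat s - 2) n r)
      = - integral {r<..} (stieltjes_kernel \<mu> n w)"
    by (simp add: sums_iff)
  moreover have "integral {0<..} (stieltjes_kernel \<mu> n w)
      = integral {0<..<r} (stieltjes_kernel \<mu> n w) + integral {r<..} (stieltjes_kernel \<mu> n w)"
  proof -
    have "integral {0<..} (stieltjes_kernel \<mu> n w) = integral ({0<..<r} \<union> {r<..}) (stieltjes_kernel \<mu> n w)"
      by (rule integral_spike_set) (use r_pos in \<open>auto intro: negligible_subset[of "{r}"]\<close>)
    also have "\<dots> = integral {0<..<r} (stieltjes_kernel \<mu> n w) + integral {r<..} (stieltjes_kernel \<mu> n w)"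
    proof (rule integral_Un[OF int1 int2])
      have "{0<..<r} \<inter> {r<..} = {}" by auto
      then show "negligible ({0<..<r} \<inter> {r<..})" by simp
    qed
    finally show ?thesis .
  qed
  ultimately show ?thesis using integral_stieltjes_kernel[OF assms w, of n] by simp
qed

lemma near_defect:
  "near_integral m - suminf (near_term m) =
     ((\<i> * w) ^ m + (- \<i> * w) ^ m) / 2 * Delta1 n \<nu> w
     + ((\<i> * w) ^ m - (- \<i> * w) ^ m) / (2 * \<i> * w) * Delta1 n (\<nu> - 1) w"
proof (induction m rule: induct_nat_012)
  have w0: "w \<noteq> 0" using w by auto
  case 0
  show ?case
    using kernel_defect[of \<nu>] \<nu> by (simp add: near_integral_def near_term_def[abs_def])
next
  have w0: "w \<noteq> 0" using w by auto
  case 1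
  have "near_integral 1 = integral {0<..<r} (stieltjes_kernel (\<nu> - 1) n w)"
    unfolding near_integral_def by (rule integral_cong) (simp add: kernel_shift)
  moreover have "near_term 1 = (\<lambda>s. (-1) ^ s * w ^ (2 * s) * log_power_primitive (- (\<nu> - 1) - 2 * of_nat s - 2) n r)"
    by (simp add: near_term_def[abs_def])
  ultimately show ?case using kernel_defect[of "\<nu> - 1"] \<nu> w0 by simp
next
  case (ge2 m)
  have "near_integral (m + 2) - suminf (near_term (m + 2)) = - w\<^sup>2 * (near_integral m - suminf (near_term m))"
    using near_integral_rec[of m] suminf_near_term_rec[of m] by (simp add: algebra_simps)
  moreover have "(\<i> * w) ^ (m + 2) = - w\<^sup>2 * (\<i> * w) ^ m" "(- \<i> * w) ^ (m + 2) = - w\<^sup>2 * (- \<i> * w) ^ m"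
  proof -
    have sq: "(\<i> * w)\<^sup>2 = - w\<^sup>2" "(- \<i> * w)\<^sup>2 = - w\<^sup>2" by (simp_all add: power_mult_distrib)
    show "(\<i> * w) ^ (m + 2) = - w\<^sup>2 * (\<i> * w) ^ m" "(- \<i> * w) ^ (m + 2) = - w\<^sup>2 * (- \<i> * w) ^ m"
      unfolding power_add sq by (simp_all only: mult.commute)
  qed
  moreover have "(- v * p + - v * q) / 2 * A + (- v * p - - v * q) / d * B = - v * ((p + q) / 2 * A + (p - q) / d * B)"
    for v p q d A B :: complex
    by (simp add: algebra_simps add_divide_distrib diff_divide_distrib)
  ultimately have "near_integral (m + 2) - suminf (near_term (m + 2)) =
     ((\<i> * w) ^ (m + 2) + (- \<i> * w) ^ (m + 2)) / 2 * Delta1 n \<nu> w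
     + ((\<i> * w) ^ (m + 2) - (- \<i> * w) ^ (m + 2)) / (2 * \<i> * w) * Delta1 n (\<nu> - 1) w"
    by (simp only: ge2)
  then show ?case unfolding add_2_eq_Suc' .
qed

end

context stieltjes_disc begin

text \<open>The double series converges absolutely because \<open>norm w < r\<close>, so that summation over the
  Taylor coefficients and over \<open>s\<close> may be interchanged.\<close>

lemma near_sums:
  assumes c: "summable (\<lambda>m. norm (c m) * r ^ m)"
  shows "summable (\<lambda>m. c m * log_power_primitive (of_nat m - \<nu> - 2 * of_nat s - 2) n r)"
    and "(\<lambda>s. (-1) ^ s * w ^ (2 * s) * (\<Sum>m. c m * log_power_primitive (of_nat m - \<nu> - 2 * of_nat s - 2) n r)) sums
     (integral {0<..<r} (\<lambda>t. (\<Sum>m. c m * of_real t ^ m) * stieltjes_kernel \<nu> n w t)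
      - (((\<Sum>m. c m * (\<i> * w) ^ m) + (\<Sum>m. c m * (- \<i> * w) ^ m)) / 2 * Delta1 n \<nu> w
         + ((\<Sum>m. c m * (\<i> * w) ^ m) - (\<Sum>m. c m * (- \<i> * w) ^ m)) / (2 * \<i> * w) * Delta1 n (\<nu> - 1) w))"
proof -
  define q where "q = (norm w / r)\<^sup>2"
  have q: "0 \<le> q" "q < 1" "norm q < 1" using ratio by (auto simp: q_def)
  have w0: "w \<noteq> 0" using w by auto
  obtain B where B: "0 \<le> B" "\<And>m s. norm (near_term m s) \<le> B * r ^ m * q ^ s"
    unfolding q_def using norm_near_term_le by blast
  define A where "A = (\<Sum>m. norm (c m) * r ^ m)"
  have sumg: "summable (\<lambda>s. b * q ^ s)" for b :: real
    using q by (intro summable_mult summable_geometric) auto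
  have bnd: "norm (c m * near_term m s) \<le> norm (c m) * r ^ m * (B * q ^ s)" for m s
    using mult_left_mono[OF B(2)[of m s], of "norm (c m)"] by (simp add: norm_mult mult_ac)
  have sum_m: "summable (\<lambda>m. c m * near_term m s)" for s
    by (rule summable_comparison_test'[OF summable_mult2[OF c, of "B * q ^ s"], of 0]) (use bnd in auto)
  have eq_term: "c m * near_term m s = (-1) ^ s * w ^ (2 * s) * (c m * log_power_primitive (of_nat m - \<nu> - 2 * of_nat s - 2) n r)" for m s
    by (simp add: near_term_def)
  show sum_P: "summable (\<lambda>m. c m * log_power_primitive (of_nat m - \<nu> - 2 * of_nat s - 2) n r)" for s
    using sum_m[of s] w0 unfolding eq_term by (simp add: summable_cmult_iff)
  define U where "U = (\<lambda>s. \<Sum>m. c m * near_term m s)"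
  have U_eq: "U s = (-1) ^ s * w ^ (2 * s) * (\<Sum>m. c m * log_power_primitive (of_nat m - \<nu> - 2 * of_nat s - 2) n r)" for s
    unfolding U_def eq_term by (rule suminf_mult[OF sum_P])
  have tail: "norm (suminf (near_term m) - (\<Sum>s<N. near_term m s)) \<le> B * r ^ m * (q ^ N / (1 - q))" for m N
  proof -
    have "suminf (near_term m) - (\<Sum>s<N. near_term m s) = (\<Sum>s. near_term m (s + N))"
      using suminf_minus_initial_segment[OF summable_near_term] by simp
    also have "norm \<dots> \<le> (\<Sum>s. B * r ^ m * q ^ N * q ^ s)"
    proof (rule norm_suminf_le[OF _ sumg])
      show "norm (near_term m (s + N)) \<le> B * r ^ m * q ^ N * q ^ s" for s
        using B(2)[of m "s + N"] by (simp add: power_add mult_ac)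
    qed
    also have "\<dots> = B * r ^ m * q ^ N * (1 / (1 - q))"
      using suminf_mult[OF summable_geometric[OF q(3)]] suminf_geometric[OF q(3)] by simp
    finally show ?thesis by simp
  qed
  have tail_c: "norm (c m * (suminf (near_term m) - (\<Sum>s<N. near_term m s))) \<le> norm (c m) * r ^ m * (B * (q ^ N / (1 - q)))" for m N
    using mult_left_mono[OF tail[of m N], of "norm (c m)"] by (simp add: norm_mult mult_ac)
  have sum_c: "summable (\<lambda>m. c m * (suminf (near_term m) - (\<Sum>s<N. near_term m s)))" for N
    by (rule summable_comparison_test'[OF summable_mult2[OF c, of "B * (q ^ N / (1 - q))"], of 0]) (use tail_c in auto)
  have sum_T: "summable (\<lambda>m. c m * suminf (near_term m))"
    using sum_c[of 0] by simp
  define V where "V = (\<Sum>m. c m * suminf (near_term m))"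
  have diff: "V - (\<Sum>s<N. U s) = (\<Sum>m. c m * (suminf (near_term m) - (\<Sum>s<N. near_term m s)))" for N
  proof -
    have "(\<Sum>s<N. U s) = (\<Sum>m. \<Sum>s<N. c m * near_term m s)"
      unfolding U_def by (rule suminf_sum[symmetric]) (rule sum_m)
    moreover have "summable (\<lambda>m. \<Sum>s<N. c m * near_term m s)"
      by (rule summable_sum) (rule sum_m)
    ultimately show ?thesis
      unfolding V_def using suminf_diff[OF sum_T] by (simp add: right_diff_distrib sum_distrib_left)
  qed
  have "(\<lambda>N. V - (\<Sum>s<N. U s)) \<longlonglongrightarrow> 0"
  proof (rule Lim_null_comparison)
    have "norm (V - (\<Sum>s<N. U s)) \<le> A * (B * (q ^ N / (1 - q)))" for N
    proof -
      have "norm (V - (\<Sum>s<N. U s)) \<le> (\<Sum>m. norm (c m) * r ^ m * (B * (q ^ N / (1 - q))))"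
        unfolding diff by (rule norm_suminf_le[OF tail_c summable_mult2[OF c]])
      also have "\<dots> = A * (B * (q ^ N / (1 - q)))"
        unfolding A_def by (rule suminf_mult2[OF c, symmetric])
      finally show ?thesis .
    qed
    then show "\<forall>\<^sub>F N in sequentially. norm (V - (\<Sum>s<N. U s)) \<le> A * (B * (q ^ N / (1 - q)))" by simp
    have "(\<lambda>N. A * (B * (q ^ N / (1 - q)))) \<longlonglongrightarrow> A * (B * (0 / (1 - q)))"
      using q by (intro tendsto_mult tendsto_const tendsto_divide LIMSEQ_power_zero) auto
    then show "(\<lambda>N. A * (B * (q ^ N / (1 - q)))) \<longlonglongrightarrow> 0" by simp
  qed
  then have "(\<lambda>N. V - (V - (\<Sum>s<N. U s))) \<longlonglongrightarrow> V - 0"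
    by (intro tendsto_diff tendsto_const)
  then have UV: "U sums V" by (simp add: sums_def)
  define \<kappa> where "\<kappa> = (\<lambda>z. \<Sum>m. c m * z ^ m)"
  have pow: "(\<lambda>m. c m * z ^ m) sums \<kappa> z" if "norm z \<le> r" for z
  proof -
    have "summable (\<lambda>m. norm (c m * z ^ m))"
    proof (rule summable_comparison_test'[OF c, of 0])
      show "norm (norm (c m * z ^ m)) \<le> norm (c m) * r ^ m" for m
        using that by (simp add: norm_mult norm_power mult_left_mono power_mono)
    qed
    then show ?thesis unfolding \<kappa>_def by (intro summable_sums) (rule summable_norm_cancel)
  qed
  define G where "G = integral {0<..<r} (\<lambda>t. (\<Sum>m. c m * of_real t ^ m) * stieltjes_kernel \<nu> n w t)"
  have J: "(\<lambda>m. c m * near_integral m) sums G"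
    unfolding G_def near_integral_def by (rule power_series_integral_sums(2)[OF r_pos c kernel_on_disc])
  have p: "(\<lambda>m. c m * (\<i> * w) ^ m) sums \<kappa> (\<i> * w)" "(\<lambda>m. c m * (- \<i> * w) ^ m) sums \<kappa> (- \<i> * w)"
    using wr by (intro pow; simp add: norm_mult)+
  have "(\<lambda>m. (c m * (\<i> * w) ^ m + c m * (- \<i> * w) ^ m) / 2 * Delta1 n \<nu> w
      + (c m * (\<i> * w) ^ m - c m * (- \<i> * w) ^ m) / (2 * \<i> * w) * Delta1 n (\<nu> - 1) w) sums
      ((\<kappa> (\<i> * w) + \<kappa> (- \<i> * w)) / 2 * Delta1 n \<nu> w + (\<kappa> (\<i> * w) - \<kappa> (- \<i> * w)) / (2 * \<i> * w) * Delta1 n (\<nu> - 1) w)"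
    by (intro sums_add sums_mult2 sums_divide sums_diff p)
  moreover have "(c m * (\<i> * w) ^ m + c m * (- \<i> * w) ^ m) / 2 * Delta1 n \<nu> w
      + (c m * (\<i> * w) ^ m - c m * (- \<i> * w) ^ m) / (2 * \<i> * w) * Delta1 n (\<nu> - 1) w
      = c m * (near_integral m - suminf (near_term m))" for m
  proof -
    have "(b * p + b * q) / 2 * A + (b * p - b * q) / d * B = b * ((p + q) / 2 * A + (p - q) / d * B)"
      for b p q d A B :: complex
      by (simp add: algebra_simps add_divide_distrib diff_divide_distrib)
    then show ?thesis unfolding near_defect .
  qed
  ultimately have "(\<lambda>m. c m * near_integral m - c m * (near_integral m - suminf (near_term m))) sums
      (G - ((\<kappa> (\<i> * w) + \<kappa> (- \<i> * w)) / 2 * Delta1 n \<nu> w + (\<kappa> (\<i> * w) - \<kappa> (- \<i> * w)) / (2 * \<i> * w) * Delta1 n (\<nu> - 1) w))"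
    by (intro sums_diff J) simp
  then have "V = G - ((\<kappa> (\<i> * w) + \<kappa> (- \<i> * w)) / 2 * Delta1 n \<nu> w + (\<kappa> (\<i> * w) - \<kappa> (- \<i> * w)) / (2 * \<i> * w) * Delta1 n (\<nu> - 1) w)"
    unfolding V_def by (simp add: right_diff_distrib sums_iff)
  then show "(\<lambda>s. (-1) ^ s * w ^ (2 * s) * (\<Sum>m. c m * log_power_primitive (of_nat m - \<nu> - 2 * of_nat s - 2) n r)) sums
     (integral {0<..<r} (\<lambda>t. (\<Sum>m. c m * of_real t ^ m) * stieltjes_kernel \<nu> n w t)
      - (((\<Sum>m. c m * (\<i> * w) ^ m) + (\<Sum>m. c m * (- \<i> * w) ^ m)) / 2 * Delta1 n \<nu> w
         + ((\<Sum>m. c m * (\<i> * w) ^ m) - (\<Sum>m. c m * (- \<i> * w) ^ m)) / (2 * \<i> * w) * Delta1 n (\<nu> - 1) w))"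
    using UV unfolding U_eq \<kappa>_def G_def by simp
qed

end

lemma integral_einterval_split:
  fixes f :: "real \<Rightarrow> complex"
  assumes f: "f integrable_on einterval (ereal \<epsilon>) a" and r: "\<epsilon> < r" "ereal r < a"
  shows "f integrable_on {\<epsilon>..r}" "f integrable_on einterval (ereal r) a"
    "integral (einterval (ereal \<epsilon>) a) f = integral {\<epsilon>..r} f + integral (einterval (ereal r) a) f"
proof -
  let ?S = "einterval (ereal \<epsilon>) a" and ?T = "einterval (ereal r) a"
  have le: "ereal x < a" if "x \<le> r" for x
    using that r(2) by (metis ereal_less_eq(3) order_le_less_trans)
  have "(\<lambda>x. if x \<in> ?S then f x else 0) integrable_on cbox \<epsilon> r"
    by (rule integrable_altD(1)[OF f])
  then have "f integrable_on (?S \<inter> cbox \<epsilon> r)" by (simp only: integrable_restrict_Int)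
  moreover have S: "?S \<inter> cbox \<epsilon> r = {\<epsilon><..r}"
    using r by (auto simp: einterval_iff le)
  ultimately have fr: "f integrable_on {\<epsilon><..r}" by simp
  then show f1: "f integrable_on {\<epsilon>..r}"
    by (rule integrable_spike_set) (auto intro: negligible_subset[of "{\<epsilon>}"])
  have "(\<lambda>x. (if x \<in> ?S then f x else 0) - (if x \<in> {\<epsilon><..r} then f x else 0)) integrable_on UNIV"
    using f fr by (intro integrable_diff) (simp_all only: integrable_restrict_UNIV)
  also have "(\<lambda>x. (if x \<in> ?S then f x else 0) - (if x \<in> {\<epsilon><..r} then f x else 0)) = (\<lambda>x. if x \<in> ?T then f x else 0)"
    using r by (auto simp: einterval_iff fun_eq_iff le)
  finally show f2: "f integrable_on ?T" by (simp only: integrable_restrict_UNIV)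
  have "?S = {\<epsilon><..r} \<union> ?T"
    using r by (auto simp: einterval_iff le)
  moreover have "{\<epsilon><..r} \<inter> ?T = {}" by (auto simp: einterval_iff)
  ultimately have "integral ?S f = integral {\<epsilon><..r} f + integral ?T f"
    using integral_Un[OF fr f2] by simp
  also have "integral {\<epsilon><..r} f = integral {\<epsilon>..r} f"
    by (rule integral_spike_set) (auto intro: negligible_subset[of "{\<epsilon>}"])
  finally show "integral ?S f = integral {\<epsilon>..r} f + integral ?T f" .
qed

lemma diverging_part_log_power_primitive:
  assumes "Re \<alpha> < -1"
  shows "diverging_part (log_power_primitive \<alpha> n)"
proof (induction n)
  have dp: "diverging_part (log_power (\<alpha> + 1) m)" for m
  proof -
    have "0 < Re (- (\<alpha> + 1))" using assms by simp
    from diverging_part_power_log[OF this, of m, unfolded minus_minus] show ?thesis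
      unfolding log_power_def[abs_def] .
  qed
  case 0
  show ?case using diverging_part_cmult[OF dp[of 0], of "1 / (\<alpha> + 1)"] by (simp add: fun_eq_iff[symmetric])
next
  have dp: "diverging_part (log_power (\<alpha> + 1) m)" for m
  proof -
    have "0 < Re (- (\<alpha> + 1))" using assms by simp
    from diverging_part_power_log[OF this, of m, unfolded minus_minus] show ?thesis
      unfolding log_power_def[abs_def] .
  qed
  case (Suc n)
  have "diverging_part (\<lambda>\<epsilon>. 1 / (\<alpha> + 1) * (log_power (\<alpha> + 1) (Suc n) \<epsilon> + (- of_nat (Suc n)) * log_power_primitive \<alpha> n \<epsilon>))"
    by (intro diverging_part_cmult diverging_part_add dp Suc)
  moreover have "(\<lambda>\<epsilon>. 1 / (\<alpha> + 1) * (log_power (\<alpha> + 1) (Suc n) \<epsilon> + (- of_nat (Suc n)) * log_power_primitive \<alpha> n \<epsilon>))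
     = log_power_primitive \<alpha> (Suc n)"
    by (simp add: fun_eq_iff del: of_nat_Suc)
  ultimately show ?case by (simp only:)
qed

text \<open>The \<open>2 s + 2\<close> lowest Taylor coefficients produce the diverging part, and the remainder of the
  Taylor series has an absolutely convergent integral.\<close>

lemma has_finite_part_log_power_integrand:
  fixes c :: "nat \<Rightarrow> complex"
  assumes \<nu>: "0 < Re \<nu>" "Re \<nu> < 1" and r: "0 < r" "ereal r < a"
    and c: "summable (\<lambda>m. norm (c m) * r ^ m)"
    and k: "\<And>t. 0 < t \<Longrightarrow> t \<le> r \<Longrightarrow> k (of_real t) = (\<Sum>m. c m * of_real t ^ m)"
    and int: "\<And>\<epsilon>. 0 < \<epsilon> \<Longrightarrow> ereal \<epsilon> < a \<Longrightarrow>
        log_power_integrand k n (\<nu> + 2 * of_nat s + 2) integrable_on einterval (ereal \<epsilon>) a"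
  shows "has_finite_part (log_power_integrand k n (\<nu> + 2 * of_nat s + 2)) a
      ((\<Sum>m. c m * log_power_primitive (of_nat m - \<nu> - 2 * of_nat s - 2) n r)
       + integral (einterval (ereal r) a) (log_power_integrand k n (\<nu> + 2 * of_nat s + 2)))"
proof -
  define L where "L = 2 * s + 2"
  define \<alpha> where "\<alpha> = \<nu> + 2 * of_nat s + 2"
  define f where "f = log_power_integrand k n \<alpha>"
  define P where "P = (\<lambda>m. log_power_primitive (of_nat m - \<nu> - 2 * of_nat s - 2) n)"
  have \<alpha>L: "- \<alpha> + of_nat L = - \<nu>" by (simp add: \<alpha>_def L_def)
  define \<tau> where "\<tau> = (\<lambda>t. (\<Sum>m. c (m + L) * of_real t ^ m) * log_power (- \<nu>) n t)"
  have cL: "summable (\<lambda>m. norm (c (m + L)) * r ^ m)"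
  proof -
    have "summable (\<lambda>m. norm (c (m + L)) * r ^ (m + L) * (1 / r ^ L))"
      using c by (intro summable_mult2) (rule summable_ignore_initial_segment)
    then show ?thesis using r by (simp add: power_add)
  qed
  have "-1 < Re (- \<nu>)" using \<nu> by simp
  note lp = absolutely_integrable_log_power[OF this r(1), of n]
    continuous_on_subset[OF continuous_on_log_power[of "- \<nu>" n], of "{0<..<r}"]
  have \<tau>_int: "\<tau> integrable_on {0<..<r}"
    unfolding \<tau>_def by (rule power_series_integral_sums(1)[OF r(1) cL lp]) auto
  have \<tau>_sums: "(\<lambda>m. c (m + L) * P (m + L) r) sums integral {0<..<r} \<tau>"
  proof -
    have "(\<lambda>m. c (m + L) * integral {0<..<r} (\<lambda>t. of_real t ^ m * log_power (- \<nu>) n t)) sums integral {0<..<r} \<tau>"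
      unfolding \<tau>_def by (rule power_series_integral_sums(2)[OF r(1) cL lp]) auto
    moreover have "integral {0<..<r} (\<lambda>t. of_real t ^ m * log_power (- \<nu>) n t) = P (m + L) r" for m
    proof -
      have "integral {0<..<r} (\<lambda>t. of_real t ^ m * log_power (- \<nu>) n t) = integral {0<..<r} (log_power (- \<nu> + of_nat m) n)"
        by (rule integral_cong) (subst log_power_add, auto simp: mult.commute)
      also have "\<dots> = log_power_primitive (- \<nu> + of_nat m) n r"
        by (rule integral_unique[OF has_integral_log_power]) (use \<nu> r in auto)
      also have "- \<nu> + of_nat m = of_nat (m + L) - \<nu> - 2 * of_nat s - 2" by (simp add: L_def)
      finally show ?thesis by (simp add: P_def)
    qed
    ultimately show ?thesis by simp
  qed
  have total: "(\<Sum>m. c m * P m r) = (\<Sum>m<L. c m * P m r) + integral {0<..<r} \<tau>"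
    using \<tau>_sums suminf_split_initial_segment[of "\<lambda>m. c m * P m r" L]
    by (simp add: sums_iff summable_iff_shift[of "\<lambda>m. c m * P m r" L])
  have f_eq: "f t = (\<Sum>m<L. c m * log_power (of_nat m - \<nu> - 2 * of_nat s - 2) n t) + \<tau> t" if "0 < t" "t \<le> r" for t
  proof -
    have "summable (\<lambda>m. norm (c m * of_real t ^ m))"
    proof (rule summable_comparison_test'[OF c, of 0])
      show "norm (norm (c m * of_real t ^ m)) \<le> norm (c m) * r ^ m" for m
        using that by (simp add: norm_mult norm_power mult_left_mono power_mono)
    qed
    then have sm: "summable (\<lambda>m. c m * of_real t ^ m)" by (rule summable_norm_cancel)
    have "(\<Sum>m. c (m + L) * of_real t ^ (m + L)) = of_real t ^ L * (\<Sum>m. c (m + L) * of_real t ^ m)"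
    proof -
      have "summable (\<lambda>m. c (m + L) * of_real t ^ (m + L) * (1 / of_real t ^ L))"
        using sm by (intro summable_mult2) (rule summable_ignore_initial_segment)
      then have "summable (\<lambda>m. c (m + L) * of_real t ^ m)" using that by (simp add: power_add)
      from suminf_mult[OF this, of "of_real t ^ L"] show ?thesis by (simp add: power_add mult_ac)
    qed
    then have "k (of_real t) = (\<Sum>m<L. c m * of_real t ^ m) + of_real t ^ L * (\<Sum>m. c (m + L) * of_real t ^ m)"
      using suminf_split_initial_segment[OF sm, of L] k[OF that] by simp
    moreover have "f t = k (of_real t) * log_power (- \<alpha>) n t"
      using that by (simp add: f_def log_power_integrand_def log_power_def powr_minus divide_inverse)
    moreover have "log_power (- \<nu>) n t = log_power (- \<alpha>) n t * of_real t ^ L"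
      using log_power_add[OF that(1), of "- \<alpha>" L n] unfolding \<alpha>L .
    moreover have "log_power (of_nat m - \<nu> - 2 * of_nat s - 2) n t = log_power (- \<alpha>) n t * of_real t ^ m" for m
      using log_power_add[OF that(1), of "- \<alpha>" m n] by (simp add: \<alpha>_def algebra_simps)
    ultimately show ?thesis
      by (simp add: \<tau>_def distrib_left distrib_right sum_distrib_left sum_distrib_right mult_ac)
  qed
  define D where "D = (\<lambda>\<epsilon>. \<Sum>m<L. (- c m) * P m \<epsilon>)"
  define C where "C = (\<lambda>\<epsilon>. integral (einterval (ereal \<epsilon>) a) f - D \<epsilon>)"
  have D: "diverging_part D"
    unfolding D_def P_def
  proof (intro diverging_part_sum diverging_part_cmult diverging_part_log_power_primitive)
    fix m assume "m \<in> {..<L}"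
    then have "real m \<le> 2 * real s + 1" by (simp add: L_def)
    then show "Re (of_nat m - \<nu> - 2 * of_nat s - 2) < -1" using \<nu> by simp
  qed simp
  have int_f: "f integrable_on einterval (ereal \<epsilon>) a" if "0 < \<epsilon>" "ereal \<epsilon> < a" for \<epsilon>
    using int[OF that] by (simp add: f_def \<alpha>_def)
  have \<tau>_Icc: "\<tau> integrable_on {0..r}" using \<tau>_int by (simp add: integrable_on_Icc_iff_Ioo)
  have C_eq: "C \<epsilon> = (\<Sum>m<L. c m * P m r) + integral {\<epsilon>..r} \<tau> + integral (einterval (ereal r) a) f"
    if \<epsilon>: "0 < \<epsilon>" "\<epsilon> < r" for \<epsilon>
  proof -
    have "ereal \<epsilon> < a" using \<epsilon> r(2) by (metis ereal_less_le less_ereal.simps(1) order.strict_trans)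
    then have "integral (einterval (ereal \<epsilon>) a) f = integral {\<epsilon>..r} f + integral (einterval (ereal r) a) f"
      using \<epsilon> by (intro integral_einterval_split(3) int_f r) auto
    moreover have "(f has_integral (\<Sum>m<L. c m * (P m r - P m \<epsilon>)) + integral {\<epsilon>..r} \<tau>) {\<epsilon>..r}"
    proof (rule has_integral_eq)
      show "(\<Sum>m<L. c m * log_power (of_nat m - \<nu> - 2 * of_nat s - 2) n t) + \<tau> t = f t" if "t \<in> {\<epsilon>..r}" for t
        using f_eq[of t] that \<epsilon> by simp
      have nz: "of_nat m - \<nu> - 2 * of_nat s - 2 \<noteq> -1" for m
      proof
        assume "of_nat m - \<nu> - 2 * of_nat s - 2 = -1"
        then have "\<nu> = of_int (int m - 2 * int s - 1)" by (simp add: algebra_simps)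
        then have "Re \<nu> = of_int (int m - 2 * int s - 1)" by (simp only: complex_Re_of_int)
        then have "0 < int m - 2 * int s - 1" "int m - 2 * int s - 1 < 1"
          using \<nu> by (simp_all only: of_int_0_less_iff of_int_less_1_iff)
        then show False by simp
      qed
      show "((\<lambda>t. (\<Sum>m<L. c m * log_power (of_nat m - \<nu> - 2 * of_nat s - 2) n t) + \<tau> t) has_integral
          (\<Sum>m<L. c m * (P m r - P m \<epsilon>)) + integral {\<epsilon>..r} \<tau>) {\<epsilon>..r}"
        unfolding P_def
      proof (intro has_integral_add has_integral_sum has_integral_mult_right has_integral_log_power_Icc nz)
        show "(\<tau> has_integral integral {\<epsilon>..r} \<tau>) {\<epsilon>..r}"
          by (intro integrable_integral integrable_subinterval_real[OF \<tau>_Icc]) (use \<epsilon> in auto)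
      qed (use \<epsilon> in auto)
    qed
    then have "integral {\<epsilon>..r} f = (\<Sum>m<L. c m * (P m r - P m \<epsilon>)) + integral {\<epsilon>..r} \<tau>" by (rule integral_unique)
    ultimately show ?thesis
      by (simp add: C_def D_def right_diff_distrib sum_subtractf sum_negf)
  qed
  have "(C \<longlongrightarrow> (\<Sum>m<L. c m * P m r) + integral {0..r} \<tau> + integral (einterval (ereal r) a) f) (at_right 0)"
  proof (rule Lim_transform_eventually)
    have "((\<lambda>\<epsilon>. integral {\<epsilon>..r} \<tau>) \<longlongrightarrow> integral {0..r} \<tau>) (at_right 0)"
      using continuous_on_Icc_at_rightD[OF indefinite_integral_continuous_1'[OF \<tau>_Icc] r(1)] .
    then show "((\<lambda>\<epsilon>. (\<Sum>m<L. c m * P m r) + integral {\<epsilon>..r} \<tau> + integral (einterval (ereal r) a) f) \<longlongrightarrow>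
        (\<Sum>m<L. c m * P m r) + integral {0..r} \<tau> + integral (einterval (ereal r) a) f) (at_right 0)"
      by (intro tendsto_add tendsto_const)
    show "\<forall>\<^sub>F \<epsilon> in at_right 0. (\<Sum>m<L. c m * P m r) + integral {\<epsilon>..r} \<tau> + integral (einterval (ereal r) a) f = C \<epsilon>"
      using eventually_at_right_real[OF r(1)] by eventually_elim (simp add: C_eq)
  qed
  also have "integral {0..r} \<tau> = integral {0<..<r} \<tau>" by (rule integral_open_interval_real)
  finally have "(C \<longlongrightarrow> (\<Sum>m. c m * P m r) + integral (einterval (ereal r) a) f) (at_right 0)"
    unfolding total .
  then have "has_finite_part f a ((\<Sum>m. c m * P m r) + integral (einterval (ereal r) a) f)"
    unfolding has_finite_part_def using D int_f
    by (intro conjI exI[of _ C] exI[of _ D]) (auto simp: C_def)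
  then show ?thesis unfolding f_def \<alpha>_def P_def .
qed

section \<open>The expansion and its leading term\<close>

lemma right_root:
  assumes "\<omega> \<noteq> 0" "\<bar>Arg \<omega>\<bar> \<noteq> pi / 2"
  shows "0 < Re (right_root \<omega>)" "norm (right_root \<omega>) = norm \<omega>" "(right_root \<omega>)\<^sup>2 = \<omega>\<^sup>2"
proof -
  show "0 < Re (right_root \<omega>)"
    using assms Re_Ln_pos_lt[of \<omega>] Re_Ln_pos_le[of \<omega>] by (auto simp: right_root_def Arg_eq_Im_Ln)
qed (auto simp: right_root_def)

lemma analytic_below_singularity_radius:
  assumes "ereal (norm z) < singularity_radius k"
  shows "k analytic_on {z}"
proof (rule ccontr)
  assume "\<not> k analytic_on {z}"
  then have "singularity_radius k \<le> ereal (norm z)"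
    unfolding singularity_radius_def by (intro INF_lower) simp
  then show False using assms by simp
qed

lemma singularity_radius_pos:
  assumes "k analytic_on {0}"
  shows "0 < singularity_radius k"
proof -
  obtain e where e: "0 < e" "k holomorphic_on ball 0 e" using assms by (auto simp: analytic_on_def)
  then have "k analytic_on ball 0 e" by (simp add: analytic_on_open)
  then have "k analytic_on {z}" if "norm z < e" for z
    by (rule analytic_on_subset) (use that in auto)
  then have "ereal e \<le> singularity_radius k"
    unfolding singularity_radius_def by (intro INF_greatest) (auto simp: not_less[symmetric])
  then show ?thesis using e(1) by (metis ereal_less(2) order_less_le_trans)
qed

lemma taylor_coefficients:
  assumes "0 < r" "ereal r < singularity_radius k"
  obtains c :: "nat \<Rightarrow> complex" where "summable (\<lambda>m. norm (c m) * r ^ m)"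
    "\<And>z. norm z \<le> r \<Longrightarrow> k z = (\<Sum>m. c m * z ^ m)"
proof -
  obtain R where R: "r < R" "ereal R < singularity_radius k"
    using ereal_dense2[OF assms(2)] by auto
  have "k analytic_on {z}" if "z \<in> ball 0 R" for z
  proof (rule analytic_below_singularity_radius)
    have "ereal (norm z) \<le> ereal R" using that by simp
    then show "ereal (norm z) < singularity_radius k" using R(2) by (rule order_le_less_trans)
  qed
  then have holo: "k holomorphic_on ball 0 R"
    using analytic_imp_holomorphic analytic_on_analytic_at by blast
  define c where "c = (\<lambda>m. (deriv ^^ m) k 0 / fact m)"
  have sums: "(\<lambda>m. c m * z ^ m) sums k z" if "norm z < R" for z
    using holomorphic_power_series[OF holo, of z] that by (simp add: c_def)
  obtain r' where r': "r < r'" "r' < R" using dense R(1) by blast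
  have "summable (\<lambda>m. norm (c m * of_real r ^ m))"
  proof (rule powser_insidea)
    show "summable (\<lambda>m. c m * of_real r' ^ m)"
      using assms r' by (intro sums_summable[OF sums]) simp
  qed (use assms r' in simp)
  then have "summable (\<lambda>m. norm (c m) * r ^ m)"
    using assms(1) by (simp add: norm_mult norm_power)
  then show ?thesis using that sums R(1) by (simp add: sums_iff)
qed

lemma finite_part_expansion:
  assumes \<nu>: "0 < Re \<nu>" "Re \<nu> < 1"
    and k: "k analytic_on (complex_of_real ` {t. 0 \<le> t \<and> ereal t < a})"
    and \<omega>: "\<omega> \<in> admissible k a"
    and int: "stieltjes_integrand k n \<nu> \<omega> integrable_on einterval 0 a"
  shows "\<exists>I. has_finite_part (log_power_integrand k n (\<nu> + 2 * of_nat s + 2)) a I" (is ?A)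
    and "(\<lambda>s. (-1) ^ s * \<omega> ^ (2 * s) * finite_part (log_power_integrand k n (\<nu> + 2 * of_nat s + 2)) a) sums
      (integral (einterval 0 a) (stieltjes_integrand k n \<nu> \<omega>)
       - ((k (\<i> * right_root \<omega>) + k (- \<i> * right_root \<omega>)) / 2 * Delta1 n \<nu> (right_root \<omega>)
          - \<i> * ((k (\<i> * right_root \<omega>) - k (- \<i> * right_root \<omega>)) / 2) * Delta2 n \<nu> (right_root \<omega>)))" (is ?B)
proof -
  define w where "w = right_root \<omega>"
  have \<omega>': "\<omega> \<noteq> 0" "ereal (norm \<omega>) < min a (singularity_radius k)" "\<bar>Arg \<omega>\<bar> \<noteq> pi / 2"
    using \<omega> by (auto simp: admissible_def)
  have wp: "0 < Re w" "norm w = norm \<omega>" "w\<^sup>2 = \<omega>\<^sup>2"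
    using right_root[OF \<omega>'(1,3)] by (auto simp: w_def)
  have w0: "w \<noteq> 0" using wp by auto
  obtain r where r: "norm w < r" "ereal r < min a (singularity_radius k)"
    using ereal_dense2[OF \<omega>'(2)] wp(2) by auto
  have r_a: "ereal r < a" and r_sing: "ereal r < singularity_radius k" using r by auto
  have r0: "0 < r" using r(1) norm_ge_zero[of w] by linarith
  interpret stieltjes_disc \<nu> w n r
    by unfold_locales (use \<nu> wp r in auto)
  obtain c :: "nat \<Rightarrow> complex" where c: "summable (\<lambda>m. norm (c m) * r ^ m)"
    and k_eq: "\<And>z. norm z \<le> r \<Longrightarrow> k z = (\<Sum>m. c m * z ^ m)"
    using taylor_coefficients[OF r0 r_sing] by blast
  define F where "F = stieltjes_integrand k n \<nu> \<omega>"
  define g where "g = (\<lambda>s. log_power_integrand k n (\<nu> + 2 * of_nat s + 2))"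
  have F_eq: "F t = k (of_real t) * stieltjes_kernel \<nu> n w t" if "0 < t" for t
    using that by (simp add: F_def stieltjes_integrand_def stieltjes_kernel_def log_power_def powr_minus
        divide_inverse wp(3))
  have F_g: "F t * (w\<^sup>2 + of_real t ^ 2) / of_real t ^ (2 * s + 2) = g s t" if "0 < t" for t s
  proof -
    have "log_power (- \<nu> - 2 * of_nat s - 2 + of_nat (2 * s + 2)) n t
        = log_power (- \<nu> - 2 * of_nat s - 2) n t * of_real t ^ (2 * s + 2)"
      by (rule log_power_add[OF that])
    then have "log_power (- \<nu>) n t = log_power (- \<nu> - 2 * of_nat s - 2) n t * of_real t ^ (2 * s + 2)" by simp
    then have "F t * (w\<^sup>2 + of_real t ^ 2) / of_real t ^ (2 * s + 2) = k (of_real t) * log_power (- \<nu> - 2 * of_nat s - 2) n t"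
      unfolding F_eq[OF that] stieltjes_kernel_def using that square_plus_square_neq_0[OF wp(1), of t] by simp
    also have "- \<nu> - 2 * of_nat s - 2 = - (\<nu> + 2 * of_nat s + 2)" by simp
    also have "k (of_real t) * log_power (- (\<nu> + 2 * of_nat s + 2)) n t = g s t"
      unfolding g_def log_power_integrand_def log_power_def powr_minus by (simp add: divide_inverse)
    finally show ?thesis .
  qed
  have contk: "continuous_on {t. 0 \<le> t \<and> ereal t < a} (\<lambda>t. k (of_real t))"
    by (rule continuous_on_compose2[OF holomorphic_on_imp_continuous_on[OF analytic_imp_holomorphic[OF k]]])
       (auto intro!: continuous_intros)
  have contF: "continuous_on {t. \<epsilon> \<le> t \<and> ereal t < a} F" if "0 < \<epsilon>" for \<epsilon>
  proof -
    have "continuous_on {t. \<epsilon> \<le> t \<and> ereal t < a} (\<lambda>t. k (of_real t) * stieltjes_kernel \<nu> n w t)"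
      by (intro continuous_on_mult continuous_on_subset[OF contk]
           continuous_on_subset[OF continuous_on_stieltjes_kernel[OF wp(1)]]) (use that in auto)
    then show ?thesis
      by (rule continuous_on_eq) (use that in \<open>auto simp: F_eq\<close>)
  qed
  have int0: "F integrable_on einterval (ereal 0) a" using int by (simp add: F_def zero_ereal_def)
  have intF: "F integrable_on einterval (ereal \<epsilon>) a" if "0 < \<epsilon>" "ereal \<epsilon> < a" for \<epsilon>
    by (rule integral_einterval_split(2)[OF int0 that])
  have F_g_cong: "integral (einterval (ereal \<epsilon>) a) (\<lambda>t. F t * (w\<^sup>2 + of_real t ^ 2) / of_real t ^ (2 * s + 2))
      = integral (einterval (ereal \<epsilon>) a) (g s)" if "0 < \<epsilon>" for \<epsilon> s
    by (rule integral_cong, rule F_g) (use that in \<open>auto simp: einterval_iff\<close>)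
  have int_g: "g s integrable_on einterval (ereal \<epsilon>) a" if "0 < \<epsilon>" "ereal \<epsilon> < a" for \<epsilon> s
    by (rule integrable_eq[OF stieltjes_tail_sums(1)[OF that contF[OF that(1)] intF[OF that], of w s]], rule F_g)
       (use that in \<open>auto simp: einterval_iff\<close>)
  define \<Phi> where "\<Phi> = (\<lambda>s. \<Sum>m. c m * log_power_primitive (of_nat m - \<nu> - 2 * of_nat s - 2) n r)"
  have fp: "has_finite_part (g s) a (\<Phi> s + integral (einterval (ereal r) a) (g s))" for s
    unfolding g_def \<Phi>_def
  proof (rule has_finite_part_log_power_integrand[OF \<nu> r0 r_a c])
    show "k (of_real t) = (\<Sum>m. c m * of_real t ^ m)" if "0 < t" "t \<le> r" for t
      using k_eq[of "of_real t"] that by simp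
    show "log_power_integrand k n (\<nu> + 2 * of_nat s + 2) integrable_on einterval (ereal \<epsilon>) a"
      if "0 < \<epsilon>" "ereal \<epsilon> < a" for \<epsilon>
      using int_g[OF that, of s] by (simp add: g_def)
  qed
  then show ?A unfolding g_def by blast
  have a0: "0 < a" using r_a r0 by (metis ereal_less(2) order.strict_trans)
  have fp_eq: "finite_part (g s) a = \<Phi> s + integral (einterval (ereal r) a) (g s)" for s
    by (rule finite_part_eqI[OF fp a0])
  have w_pow: "w ^ (2 * s) = \<omega> ^ (2 * s)" for s
    by (simp add: power_mult wp(3))
  define X where "X = (k (\<i> * w) + k (- \<i> * w)) / 2 * Delta1 n \<nu> w
      + (k (\<i> * w) - k (- \<i> * w)) / (2 * \<i> * w) * Delta1 n (\<nu> - 1) w"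
  have X: "X = (k (\<i> * w) + k (- \<i> * w)) / 2 * Delta1 n \<nu> w - \<i> * ((k (\<i> * w) - k (- \<i> * w)) / 2) * Delta2 n \<nu> w"
    unfolding X_def Delta2_eq_Delta1[OF \<nu> w0, symmetric] using w0 by (simp add: divide_simps)
  have near: "(\<lambda>s. (-1) ^ s * \<omega> ^ (2 * s) * \<Phi> s) sums (integral {0<..<r} F - X)"
  proof -
    have "integral {0<..<r} (\<lambda>t. (\<Sum>m. c m * of_real t ^ m) * stieltjes_kernel \<nu> n w t) = integral {0<..<r} F"
      by (rule integral_cong) (use k_eq in \<open>auto simp: F_eq\<close>)
    then show ?thesis
      using near_sums(2)[OF c] k_eq[of "\<i> * w"] k_eq[of "- \<i> * w"] r(1)
      by (simp add: \<Phi>_def X_def norm_mult flip: w_pow)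
  qed
  have far: "(\<lambda>s. (-1) ^ s * \<omega> ^ (2 * s) * integral (einterval (ereal r) a) (g s)) sums integral (einterval (ereal r) a) F"
    using stieltjes_tail_sums(2)[OF r0 r_a contF[OF r0] intF[OF r0 r_a] r(1)]
    unfolding F_g_cong[OF r0] w_pow .
  have total: "integral (einterval 0 a) F - X = (integral {0<..<r} F - X) + integral (einterval (ereal r) a) F"
    using integral_einterval_split(3)[OF int0 r0 r_a] by (simp add: zero_ereal_def integral_open_interval_real)
  have "(\<lambda>s. (-1) ^ s * \<omega> ^ (2 * s) * finite_part (g s) a) sums (integral (einterval 0 a) F - X)"
    using sums_add[OF near far] unfolding total fp_eq distrib_left .
  then show ?B unfolding X F_def g_def w_def .
qed

text \<open>As \<open>w\<close> tends to 0 the logarithm dominates: both \<open>\<Delta>\<close> terms are the common factor times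
  \<open>Ln w ^ n\<close> times a polynomial in \<open>1 / Ln w\<close>, whose constant term is \<open>half_sec \<nu>\<close>, respectively
  \<open>half_csc \<nu>\<close>.\<close>

lemma log_polynomial_tendsto:
  fixes w :: "'a \<Rightarrow> complex" and b :: "nat \<Rightarrow> complex"
  assumes lim: "((\<lambda>x. 1 / Ln (w x)) \<longlongrightarrow> 0) F" and nz: "\<forall>\<^sub>F x in F. Ln (w x) \<noteq> 0"
  shows "((\<lambda>x. (\<Sum>j=0..n. (-1) ^ j * of_nat (n choose j) * Ln (w x) ^ (n - j) * b j) / Ln (w x) ^ n) \<longlongrightarrow> b 0) F"
proof (rule Lim_transform_eventually)
  have "((\<lambda>x. \<Sum>j=0..n. (-1) ^ j * of_nat (n choose j) * (1 / Ln (w x)) ^ j * b j) \<longlongrightarrow>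
         (\<Sum>j=0..n. (-1) ^ j * of_nat (n choose j) * 0 ^ j * b j)) F"
    by (intro tendsto_sum tendsto_mult tendsto_const tendsto_power lim)
  also have "(\<Sum>j=0..n. (-1) ^ j * of_nat (n choose j) * 0 ^ j * b j) = b 0"
    by (subst sum.remove[of _ 0]) (auto intro!: sum.neutral simp: power_0_left)
  finally show "((\<lambda>x. \<Sum>j=0..n. (-1) ^ j * of_nat (n choose j) * (1 / Ln (w x)) ^ j * b j) \<longlongrightarrow> b 0) F" .
  show "\<forall>\<^sub>F x in F. (\<Sum>j=0..n. (-1) ^ j * of_nat (n choose j) * (1 / Ln (w x)) ^ j * b j)
      = (\<Sum>j=0..n. (-1) ^ j * of_nat (n choose j) * Ln (w x) ^ (n - j) * b j) / Ln (w x) ^ n"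
    using nz
  proof eventually_elim
    case (elim x)
    show ?case unfolding sum_divide_distrib
    proof (rule sum.cong[OF refl])
      fix j assume "j \<in> {0..n}"
      then have "Ln (w x) ^ n = Ln (w x) ^ (n - j) * Ln (w x) ^ j" by (simp flip: power_add)
      then show "(-1) ^ j * of_nat (n choose j) * (1 / Ln (w x)) ^ j * b j
          = (-1) ^ j * of_nat (n choose j) * Ln (w x) ^ (n - j) * b j / Ln (w x) ^ n"
        using elim by (simp add: power_one_over)
    qed
  qed
qed

lemma Delta_tendsto:
  fixes w :: "'a \<Rightarrow> complex"
  assumes \<nu>: "0 < Re \<nu>" "Re \<nu> < 1" and w: "(w \<longlongrightarrow> 0) F" "\<forall>\<^sub>F x in F. w x \<noteq> 0"
  shows "\<forall>\<^sub>F x in F. Delta1 n \<nu> (w x) \<noteq> 0"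
    and "((\<lambda>x. 1 / Delta1 n \<nu> (w x)) \<longlongrightarrow> 0) F"
    and "((\<lambda>x. Delta2 n \<nu> (w x) / Delta1 n \<nu> (w x)) \<longlongrightarrow> half_csc \<nu> / half_sec \<nu>) F"
proof -
  define p where "p = (\<lambda>h x. (\<Sum>j=0..n. (-1) ^ j * of_nat (n choose j) * Ln (w x) ^ (n - j) * (deriv ^^ j) h \<nu>) / Ln (w x) ^ n)"
  have sec0: "half_sec \<nu> \<noteq> 0"
    using cos_half_pi_neq_0[of \<nu>] \<nu> by (simp add: half_sec_def)
  have nw: "((\<lambda>x. norm (w x)) \<longlongrightarrow> 0) F" using w(1) by (rule tendsto_norm_zero)
  have small: "\<forall>\<^sub>F x in F. norm (w x) < 1" using nw by (rule order_tendstoD) simp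
  have Ln_ge: "- ln (norm (w x)) \<le> norm (Ln (w x))" if "w x \<noteq> 0" for x
    using abs_Re_le_cmod[of "Ln (w x)"] that by simp
  have nz: "\<forall>\<^sub>F x in F. Ln (w x) \<noteq> 0"
    using w(2) small
  proof eventually_elim
    case (elim x)
    then have "ln (norm (w x)) < 0" by simp
    then show ?case using Ln_ge[OF elim(1)] by auto
  qed
  have "filterlim (\<lambda>x. norm (w x)) (at_right 0) F"
    unfolding filterlim_at using nw w(2) by (auto elim: eventually_mono)
  then have "filterlim (\<lambda>x. - ln (norm (w x))) at_top F"
    using filterlim_compose[OF ln_at_0] filterlim_compose[OF filterlim_uminus_at_top_at_bot] by blast
  then have "filterlim (\<lambda>x. norm (Ln (w x))) at_top F"
    by (rule filterlim_at_top_mono) (use w(2) Ln_ge in \<open>auto elim: eventually_mono\<close>)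
  then have inf: "filterlim (\<lambda>x. Ln (w x)) at_infinity F" by (rule filterlim_norm_at_top_imp_at_infinity)
  have lim: "((\<lambda>x. 1 / Ln (w x)) \<longlongrightarrow> 0) F" by (rule tendsto_divide_0[OF tendsto_const inf])
  have p1: "(p half_sec \<longlongrightarrow> half_sec \<nu>) F" and p2: "(p half_csc \<longlongrightarrow> half_csc \<nu>) F"
    using log_polynomial_tendsto[OF lim nz, of n "\<lambda>j. (deriv ^^ j) half_sec \<nu>"]
      log_polynomial_tendsto[OF lim nz, of n "\<lambda>j. (deriv ^^ j) half_csc \<nu>"] by (simp_all add: p_def[abs_def])
  have D1: "Delta1 n \<nu> (w x) = of_real pi / (2 * w x powr (\<nu> + 1)) * (Ln (w x) ^ n * p half_sec x)"
    and D2: "Delta2 n \<nu> (w x) = of_real pi / (2 * w x powr (\<nu> + 1)) * (Ln (w x) ^ n * p half_csc x)"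
    if "Ln (w x) \<noteq> 0" for x
    using that by (simp_all add: Delta1_def Delta2_def p_def)
  have pnz: "\<forall>\<^sub>F x in F. p half_sec x \<noteq> 0" using p1 sec0 by (rule tendsto_imp_eventually_ne)
  show "\<forall>\<^sub>F x in F. Delta1 n \<nu> (w x) \<noteq> 0"
    using pnz nz w(2) by eventually_elim (simp add: D1)
  have "((\<lambda>x. p half_csc x / p half_sec x) \<longlongrightarrow> half_csc \<nu> / half_sec \<nu>) F"
    by (intro tendsto_divide p1 p2 sec0)
  moreover have "\<forall>\<^sub>F x in F. p half_csc x / p half_sec x = Delta2 n \<nu> (w x) / Delta1 n \<nu> (w x)"
    using nz w(2) by eventually_elim (simp add: D1 D2)
  ultimately show "((\<lambda>x. Delta2 n \<nu> (w x) / Delta1 n \<nu> (w x)) \<longlongrightarrow> half_csc \<nu> / half_sec \<nu>) F"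
    by (rule Lim_transform_eventually)
  have "((\<lambda>x. w x powr (\<nu> + 1)) \<longlongrightarrow> 0) F"
    by (rule tendsto_powr_complex_0[OF w(1) tendsto_const]) (use \<nu> in auto)
  then have "((\<lambda>x. 2 * w x powr (\<nu> + 1) / of_real pi * ((1 / Ln (w x)) ^ n / p half_sec x)) \<longlongrightarrow>
       2 * 0 / of_real pi * (0 ^ n / half_sec \<nu>)) F"
    by (intro tendsto_mult tendsto_divide tendsto_const tendsto_power lim p1 sec0) auto
  moreover have "\<forall>\<^sub>F x in F. 2 * w x powr (\<nu> + 1) / of_real pi * ((1 / Ln (w x)) ^ n / p half_sec x) = 1 / Delta1 n \<nu> (w x)"
    using nz by eventually_elim (simp add: D1 power_one_over)
  ultimately show "((\<lambda>x. 1 / Delta1 n \<nu> (w x)) \<longlongrightarrow> 0) F"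
    using Lim_transform_eventually by force
qed

lemma stieltjes_asymp_equiv:
  assumes \<nu>: "0 < Re \<nu>" "Re \<nu> < 1" and a: "0 < a"
    and k: "k analytic_on (complex_of_real ` {t. 0 \<le> t \<and> ereal t < a})" "k 0 \<noteq> 0"
    and int: "\<And>\<omega>. \<omega> \<in> admissible k a \<Longrightarrow> stieltjes_integrand k n \<nu> \<omega> integrable_on einterval 0 a"
  shows "(\<lambda>\<omega>. integral (einterval 0 a) (stieltjes_integrand k n \<nu> \<omega>))
           \<sim>[at 0 within admissible k a] (\<lambda>\<omega>. k 0 * Delta1 n \<nu> (right_root \<omega>))"
proof (rule asymp_equivI')
  let ?F = "at 0 within admissible k a"
  define f where "f = (\<lambda>s. (-1) ^ s * finite_part (log_power_integrand k n (\<nu> + 2 * of_nat s + 2)) a)"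
  define S where "S = (\<lambda>z. \<Sum>s. f s * z ^ s)"
  define A where "A = (\<lambda>w. (k (\<i> * w) + k (- \<i> * w)) / 2)"
  define B where "B = (\<lambda>w. \<i> * ((k (\<i> * w) - k (- \<i> * w)) / 2))"
  have k0: "k analytic_on {0}"
    by (rule analytic_on_subset[OF k(1)]) (use a in \<open>auto simp: image_iff zero_ereal_def intro!: exI[of _ 0]\<close>)
  obtain b where b: "0 < b" "ereal b < min a (singularity_radius k)"
    using ereal_dense2[of 0 "min a (singularity_radius k)"] a singularity_radius_pos[OF k0] by (auto simp: zero_ereal_def)
  have adm: "of_real b \<in> admissible k a" using b pi_gt_zero by (auto simp: admissible_def)
  have sums: "(\<lambda>s. f s * (\<omega>\<^sup>2) ^ s) sums
      (integral (einterval 0 a) (stieltjes_integrand k n \<nu> \<omega>)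
       - (A (right_root \<omega>) * Delta1 n \<nu> (right_root \<omega>) - B (right_root \<omega>) * Delta2 n \<nu> (right_root \<omega>)))"
    if "\<omega> \<in> admissible k a" for \<omega>
    using finite_part_expansion(2)[OF \<nu> k(1) that int[OF that]]
    unfolding f_def A_def B_def by (simp add: mult_ac flip: power_mult)
  have "isCont S 0"
    unfolding S_def using b by (intro isCont_powser[OF sums_summable[OF sums[OF adm]]]) auto
  then have S: "(S \<longlongrightarrow> S 0) (at 0)" by (simp add: isCont_def)
  have \<omega>_lim: "((\<lambda>\<omega>. \<omega>) \<longlongrightarrow> (0::complex)) ?F" by (rule tendsto_ident_at)
  have in_adm: "\<forall>\<^sub>F \<omega> in ?F. \<omega> \<in> admissible k a" by (simp add: eventually_at_filter)
  have rr: "(right_root \<longlongrightarrow> 0) ?F"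
  proof (rule tendsto_norm_zero_cancel)
    have "norm (right_root \<omega>) = norm \<omega>" for \<omega> by (simp add: right_root_def)
    then show "((\<lambda>\<omega>. norm (right_root \<omega>)) \<longlongrightarrow> 0) ?F" using tendsto_norm_zero[OF \<omega>_lim] by simp
  qed
  have rr0: "\<forall>\<^sub>F \<omega> in ?F. right_root \<omega> \<noteq> 0"
    using in_adm by eventually_elim (auto simp: admissible_def right_root_def)
  note \<Delta> = Delta_tendsto[OF \<nu> rr rr0, of n]
  have contk: "(k \<longlongrightarrow> k 0) (nhds 0)"
    using analytic_at_imp_isCont[OF k0] by (simp add: isCont_def tendsto_at_iff_tendsto_nhds)
  have lk: "((\<lambda>\<omega>. k (b * right_root \<omega>)) \<longlongrightarrow> k 0) ?F" for b
    using filterlim_compose[OF contk tendsto_mult_right_zero[OF rr]] .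
  have A: "((\<lambda>\<omega>. A (right_root \<omega>)) \<longlongrightarrow> (k 0 + k 0) / 2) ?F"
    unfolding A_def by (intro tendsto_divide tendsto_add lk tendsto_const) auto
  have B: "((\<lambda>\<omega>. B (right_root \<omega>)) \<longlongrightarrow> \<i> * ((k 0 - k 0) / 2)) ?F"
    unfolding B_def by (intro tendsto_mult tendsto_divide tendsto_diff lk tendsto_const) auto
  have "((\<lambda>\<omega>. S (\<omega>\<^sup>2)) \<longlongrightarrow> S 0) ?F"
  proof -
    have "(S \<longlongrightarrow> S 0) (nhds 0)" using S by (simp add: tendsto_at_iff_tendsto_nhds)
    moreover have "((\<lambda>\<omega>. \<omega>\<^sup>2) \<longlongrightarrow> (0::complex)) ?F"
      using tendsto_power[OF \<omega>_lim, of 2] by simp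
    ultimately show ?thesis by (rule filterlim_compose)
  qed
  then have "((\<lambda>\<omega>. S (\<omega>\<^sup>2) * (1 / Delta1 n \<nu> (right_root \<omega>)) / k 0 + A (right_root \<omega>) / k 0
       - B (right_root \<omega>) * (Delta2 n \<nu> (right_root \<omega>) / Delta1 n \<nu> (right_root \<omega>)) / k 0) \<longlongrightarrow>
     S 0 * 0 / k 0 + (k 0 + k 0) / 2 / k 0 - \<i> * ((k 0 - k 0) / 2) * (half_csc \<nu> / half_sec \<nu>) / k 0) ?F"
    by (intro tendsto_add tendsto_diff tendsto_mult tendsto_divide tendsto_const \<Delta>(2,3) A B k(2)) auto
  moreover have "S 0 * 0 / k 0 + (k 0 + k 0) / 2 / k 0 - \<i> * ((k 0 - k 0) / 2) * (half_csc \<nu> / half_sec \<nu>) / k 0 = 1"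
    using k(2) by simp
  moreover have "\<forall>\<^sub>F \<omega> in ?F. S (\<omega>\<^sup>2) * (1 / Delta1 n \<nu> (right_root \<omega>)) / k 0 + A (right_root \<omega>) / k 0
       - B (right_root \<omega>) * (Delta2 n \<nu> (right_root \<omega>) / Delta1 n \<nu> (right_root \<omega>)) / k 0
      = integral (einterval 0 a) (stieltjes_integrand k n \<nu> \<omega>) / (k 0 * Delta1 n \<nu> (right_root \<omega>))"
    using in_adm \<Delta>(1)
  proof eventually_elim
    case (elim \<omega>)
    have eq: "S * (1 / d) / u + x / u - y * (e / d) / u = (S + (x * d - y * e)) / (u * d)"
      if "d \<noteq> 0" "u \<noteq> 0" for S x y d e u :: complex
      using that by (simp add: field_simps)
    have "integral (einterval 0 a) (stieltjes_integrand k n \<nu> \<omega>)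
        = S (\<omega>\<^sup>2) + (A (right_root \<omega>) * Delta1 n \<nu> (right_root \<omega>) - B (right_root \<omega>) * Delta2 n \<nu> (right_root \<omega>))"
      using sums[OF elim(1)] by (simp add: sums_iff S_def)
    then show ?case using eq[OF elim(2) k(2)] by simp
  qed
  ultimately show "((\<lambda>\<omega>. integral (einterval 0 a) (stieltjes_integrand k n \<nu> \<omega>) / (k 0 * Delta1 n \<nu> (right_root \<omega>))) \<longlongrightarrow> 1) ?F"
    by (simp add: Lim_transform_eventually)
qed

theorem theorem4p1:
  fixes k :: "complex \<Rightarrow> complex" and a :: ereal and n :: nat and \<nu> :: complex
  assumes "n > 0" and "0 < Re \<nu>" and "Re \<nu> < 1" and "0 < a"
    and "k analytic_on (complex_of_real ` {t. 0 \<le> t \<and> ereal t < a})"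
    and "k 0 \<noteq> 0"
  shows "(\<forall>\<omega> \<in> admissible k a.
            stieltjes_integrand k n \<nu> \<omega> integrable_on einterval 0 a \<longrightarrow>
              (\<forall>s::nat. \<exists>I. has_finite_part (log_power_integrand k n (\<nu> + 2 * of_nat s + 2)) a I) \<and>
              summable (\<lambda>s. (-1) ^ s * \<omega> ^ (2 * s) *
                 finite_part (log_power_integrand k n (\<nu> + 2 * of_nat s + 2)) a) \<and>
              (let w = right_root \<omega> in
                integral (einterval 0 a) (stieltjes_integrand k n \<nu> \<omega>) =
                  (\<Sum>s. (-1) ^ s * \<omega> ^ (2 * s) *
                     finite_part (log_power_integrand k n (\<nu> + 2 * of_nat s + 2)) a)
                  + (k (\<i> * w) + k (- \<i> * w)) / 2 * Delta1 n \<nu> w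
                  - \<i> * ((k (\<i> * w) - k (- \<i> * w)) / 2) * Delta2 n \<nu> w))
       \<and> (\<forall>j. (deriv ^^ j) half_sec \<nu> = sec_deriv_formula j \<nu>)
       \<and> (\<forall>j. (deriv ^^ j) half_csc \<nu> = csc_deriv_formula j \<nu>)
       \<and> ((\<forall>\<omega> \<in> admissible k a. stieltjes_integrand k n \<nu> \<omega> integrable_on einterval 0 a) \<longrightarrow>
            (\<lambda>\<omega>. integral (einterval 0 a) (stieltjes_integrand k n \<nu> \<omega>))
              \<sim>[at 0 within admissible k a] (\<lambda>\<omega>. k 0 * Delta1 n \<nu> (right_root \<omega>)))"
proof (intro conjI ballI impI allI)
  fix \<omega> assume \<omega>: "\<omega> \<in> admissible k a"
    and int: "stieltjes_integrand k n \<nu> \<omega> integrable_on einterval 0 a"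
  note expansion = finite_part_expansion[OF assms(2,3,5) \<omega> int]
  show "\<exists>I. has_finite_part (log_power_integrand k n (\<nu> + 2 * of_nat s + 2)) a I" for s
    by (rule expansion(1))
  show "summable (\<lambda>s. (-1) ^ s * \<omega> ^ (2 * s) * finite_part (log_power_integrand k n (\<nu> + 2 * of_nat s + 2)) a)"
    by (rule sums_summable[OF expansion(2)])
  show "let w = right_root \<omega> in
          integral (einterval 0 a) (stieltjes_integrand k n \<nu> \<omega>) =
            (\<Sum>s. (-1) ^ s * \<omega> ^ (2 * s) * finite_part (log_power_integrand k n (\<nu> + 2 * of_nat s + 2)) a)
            + (k (\<i> * w) + k (- \<i> * w)) / 2 * Delta1 n \<nu> w
            - \<i> * ((k (\<i> * w) - k (- \<i> * w)) / 2) * Delta2 n \<nu> w"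
    unfolding Let_def sums_unique[OF expansion(2), symmetric] by (simp add: algebra_simps)
next
  have cos0: "cos (of_real pi * \<nu> / 2) \<noteq> 0" and "cos (of_real pi * (\<nu> - 1) / 2) \<noteq> 0"
    using assms(2,3) by (auto intro!: cos_half_pi_neq_0)
  then have sin0: "sin (of_real pi * \<nu> / 2) \<noteq> 0"
    using half_csc_eq_half_sec[of \<nu>] by (auto simp: half_csc_def half_sec_def)
  show "(deriv ^^ j) half_sec \<nu> = sec_deriv_formula j \<nu>" for j
    by (rule higher_deriv_half_sec_eq_formula[OF cos0])
  show "(deriv ^^ j) half_csc \<nu> = csc_deriv_formula j \<nu>" for j
    by (rule higher_deriv_half_csc_eq_formula[OF sin0])
next
  assume "\<forall>\<omega> \<in> admissible k a. stieltjes_integrand k n \<nu> \<omega> integrable_on einterval 0 a"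
  then show "(\<lambda>\<omega>. integral (einterval 0 a) (stieltjes_integrand k n \<nu> \<omega>))
              \<sim>[at 0 within admissible k a] (\<lambda>\<omega>. k 0 * Delta1 n \<nu> (right_root \<omega>))"
    using assms by (intro stieltjes_asymp_equiv) auto
qed

end
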